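(* Let $\{e^{-zA}\}_{z\in S_\theta}$ be a holomorphic contraction semigroup on a Banach space $\mathfrak{X}$, that is, $A\in\mathscr{H}_c(\theta,0)$. Let $B$ be the generator of a contraction semigroup on $\mathfrak{X}$, and suppose there exists $\alpha\in[0,1)$ such that $\mathrm{dom}((A^{\alpha})^* )\subseteq \mathrm{dom}(B^* )$ and $\mathrm{dom}(A)\subseteq\mathrm{dom}(B)$. If in addition $\mathrm{dom}(A^* )\subseteq\mathrm{dom}(B^* )$ (for the case when the space $\mathfrak{X}$ is not reflexive), then there are constants $M_3,M_4,\tilde M_4,\eta>0$ such that for any $t\ge 0$ and $n>2$: $$\left\|\left(e^{-tA/n}e^{-tB/n}\right)^n-e^{-t(A+B)}\right\|\le e^{\eta t}\,(M_3+M_4\,t^{1-\alpha})\,\frac{\ln n}{n^{1-\alpha}},\qquad \alpha>0,$$ $$\left\|\left(e^{-tA/n}e^{-tB/n}\right)^n-e^{-t(A+B)}\right\|\le e^{\eta t}\,(M_3+\tilde M_4\,t)\,\frac{2(\ln n)^2}{n},\qquad \alpha=0.$$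
   Context: Sign convention: the generator $A$ of a strongly continuous semigroup $\{U(t)\}_{t\ge0}$ is defined by $\lim_{t\to+0}(U(t)x-x)/t=-Ax$ for $x\in\mathrm{dom}(A)$, and one writes $U(t)=e^{-tA}$. A contraction semigroup is a $C_0$-semigroup with $\|e^{-tA}\|\le1$ for all $t\ge0$. $A+B$ is the algebraic sum of the operators, defined on $\mathrm{dom}(A)$, and $e^{-t(A+B)}$ denotes the semigroup generated by it. Here $n$ is an integer. For $0<\theta\le\pi/2$ let $S_\theta=\{z\in\mathbb{C}: z\ne0,\ |\arg z|<\theta\}$. A bounded holomorphic semigroup of semi-angle $\theta$ is a family $\{U(z)\}_{z\in S_\theta}$ of bounded operators on $\mathfrak{X}$ with: (i) for each $0<\epsilon<\theta$, $\|U(z)\|\le M_\epsilon<\infty$ for $z\in S_{\theta-\epsilon}$; (ii) $U(z_1)U(z_2)=U(z_1+z_2)$ for $z_1,z_2\in S_\theta$; (iii) $z\mapsto U(z)$ is analytic on $S_\theta$; (iv) for $0<\epsilon<\theta$ and $x\in\mathfrak{X}$, $U(z)x\to x$ as $z\to0$ in $S_{\theta-\epsilon}$. It is a holomorphic contraction semigroup if moreover its restriction to $[0,\infty)$ is a contraction $C_0$-semigroup; $\mathscr{H}_c(\theta,0)$ denotes the set of generators of holomorphic contraction semigroups of semi-angle $\theta$. Fractional powers: $A^0=\mathbb{1}$, and for $0<\alpha<1$, $A^\alpha$ is the usual closed fractional power of the generator of a bounded semigroup, given on $\mathrm{dom}(A)$ by $A^\alpha x=\frac{1}{\Gamma(-\alpha)}\int_0^\infty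 \lambda^{-\alpha-1}(e^{-\lambda A}-\mathbb{1})x\,d\lambda$. $A^*,B^*,(A^\alpha)^*$ are the adjoint operators in the dual space $\mathfrak{X}^*$. $\|\cdot\|$ is the operator norm on $\mathfrak{X}$.
   Formalization: The formal statement adds the hypothesis that the algebraic sum A+B on dom(A) generates a C_0-semigroup; for α>0 the stated conditions do not guarantee this (there is a counterexample on l^2 with α=1/2), so e^{-t(A+B)} could otherwise be undefined. *)

theory Defs
  imports "HOL-Analysis.Analysis"
begin

class complex_normed_vector = real_normed_vector +
  fixes scaleC :: "complex \<Rightarrow> 'a \<Rightarrow> 'a" (infixr "*\<^sub>C" 75)
  assumes scaleC_add_right: "c *\<^sub>C (x + y) = c *\<^sub>C x + c *\<^sub>C y"
    and scaleC_add_left: "(c + d) *\<^sub>C x = c *\<^sub>C x + d *\<^sub>C x"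
    and scaleC_scaleC: "c *\<^sub>C d *\<^sub>C x = (c * d) *\<^sub>C x"
    and scaleR_scaleC: "r *\<^sub>R x = complex_of_real r *\<^sub>C x"
    and norm_scaleC: "norm (c *\<^sub>C x) = cmod c * norm x"

class complex_banach = complex_normed_vector + banach

instantiation complex :: complex_banach
begin

definition scaleC_complex :: "complex \<Rightarrow> complex \<Rightarrow> complex" where
  "scaleC_complex c x = c * x"

instance
  by standard (simp_all add: scaleC_complex_def algebra_simps norm_mult scaleR_conv_of_real)

end

text \<open>Bounded operators and functionals are elements of the library type of bounded real-linear
  maps, whose norm is the operator norm; complex linearity is required separately.\<close>

definition complex_linear ::
  "('a::complex_normed_vector \<Rightarrow>\<^sub>L 'b::complex_normed_vector) \<Rightarrow> bool" where
  "complex_linear F \<longleftrightarrow> (\<forall>c x. F (c *\<^sub>C x) = c *\<^sub>C F x)"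

primrec blinfun_pow ::
  "nat \<Rightarrow> ('a::real_normed_vector \<Rightarrow>\<^sub>L 'a) \<Rightarrow> ('a \<Rightarrow>\<^sub>L 'a)" where
  "blinfun_pow 0 F = id_blinfun"
| "blinfun_pow (Suc n) F = F o\<^sub>L blinfun_pow n F"

definition C0_semigroup :: "(real \<Rightarrow> ('a::complex_banach \<Rightarrow>\<^sub>L 'a)) \<Rightarrow> bool" where
  "C0_semigroup U \<longleftrightarrow>
     (\<forall>t\<ge>0. complex_linear (U t)) \<and>
     U 0 = id_blinfun \<and>
     (\<forall>s\<ge>0. \<forall>t\<ge>0. U (s + t) = U s o\<^sub>L U t) \<and>
     (\<forall>x. ((\<lambda>t. U t x) \<longlongrightarrow> x) (at_right 0))"

definition contraction_semigroup :: "(real \<Rightarrow> ('a::complex_banach \<Rightarrow>\<^sub>L 'a)) \<Rightarrow> bool" where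
  "contraction_semigroup U \<longleftrightarrow> C0_semigroup U \<and> (\<forall>t\<ge>0. norm (U t) \<le> 1)"

text \<open>Unbounded operators are represented by their graphs, so that \<^term>\<open>Domain A\<close> is the
  domain of the operator \<open>A\<close>. Note the sign convention: the generator of \<open>U\<close> is the \<open>A\<close> with
  \<open>U t = exp (- t A)\<close>.\<close>

definition generator :: "(real \<Rightarrow> ('a::complex_banach \<Rightarrow>\<^sub>L 'a)) \<Rightarrow> ('a \<times> 'a) set" where
  "generator U = {(x, y). ((\<lambda>t. (U t x - x) /\<^sub>R t) \<longlongrightarrow> - y) (at_right 0)}"

definition operator_sum ::
  "('a::complex_banach \<times> 'a) set \<Rightarrow> ('a \<times> 'a) set \<Rightarrow> ('a \<times> 'a) set" where
  "operator_sum A B = {(x, y + z) | x y z. (x, y) \<in> A \<and> (x, z) \<in> B}"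

definition sector :: "real \<Rightarrow> complex set" where
  "sector \<theta> = {z. z \<noteq> 0 \<and> \<bar>Arg z\<bar> < \<theta>}"

text \<open>Analyticity is Frechet differentiability in operator norm, at each point of the (open)
  sector, with a complex-linear derivative.\<close>

definition bounded_holomorphic_semigroup ::
  "real \<Rightarrow> (complex \<Rightarrow> ('a::complex_banach \<Rightarrow>\<^sub>L 'a)) \<Rightarrow> bool" where
  "bounded_holomorphic_semigroup \<theta> U \<longleftrightarrow>
     (\<forall>z\<in>sector \<theta>. complex_linear (U z)) \<and>
     (\<forall>\<epsilon>. 0 < \<epsilon> \<and> \<epsilon> < \<theta> \<longrightarrow> (\<exists>M. \<forall>z\<in>sector (\<theta> - \<epsilon>). norm (U z) \<le> M)) \<and>
     (\<forall>z\<in>sector \<theta>. \<forall>w\<in>sector \<theta>. U z o\<^sub>L U w = U (z + w)) \<and>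
     (\<forall>z\<in>sector \<theta>. \<exists>D. (U has_derivative D) (at z) \<and> (\<forall>h x. D h x = h *\<^sub>C D 1 x)) \<and>
     (\<forall>\<epsilon> x. 0 < \<epsilon> \<and> \<epsilon> < \<theta> \<longrightarrow> ((\<lambda>z. U z x) \<longlongrightarrow> x) (at 0 within sector (\<theta> - \<epsilon>)))"

text \<open>The point \<open>0\<close> is not in the sector; the second conjunct also fixes \<open>U 0\<close> to be the
  identity.\<close>

definition holomorphic_contraction_semigroup ::
  "real \<Rightarrow> (complex \<Rightarrow> ('a::complex_banach \<Rightarrow>\<^sub>L 'a)) \<Rightarrow> bool" where
  "holomorphic_contraction_semigroup \<theta> U \<longleftrightarrow>
     bounded_holomorphic_semigroup \<theta> U \<and> contraction_semigroup (\<lambda>t. U (complex_of_real t))"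

text \<open>Graph of the fractional power (\<open>0 \<le> \<alpha> < 1\<close>) of the generator \<open>A\<close> of the bounded
  semigroup \<open>U\<close>. For \<open>\<alpha> > 0\<close> the integral formula defines it on the domain of \<open>A\<close>,
  which is a core of the closed operator (Balakrishnan's definition). The integral is absolutely
  convergent in norm; the gauge integral is used because the library's Bochner integral is
  restricted to separable spaces.\<close>

definition fractional_power ::
  "(real \<Rightarrow> ('a::complex_banach \<Rightarrow>\<^sub>L 'a)) \<Rightarrow> real \<Rightarrow> ('a \<times> 'a) set" where
  "fractional_power U \<alpha> =
     (if \<alpha> = 0 then Id
      else closure {(x, (1 / Gamma (- \<alpha>)) *\<^sub>R I) | x I. x \<in> Domain (generator U) \<and>
        ((\<lambda>l. (l powr (- \<alpha> - 1)) *\<^sub>R (U l x - x)) has_integral I) {0<..}})"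

definition dual_space :: "('a::complex_banach \<Rightarrow>\<^sub>L complex) set" where
  "dual_space = {f. complex_linear f}"

text \<open>For densely defined \<open>A\<close> this is the graph of an operator.\<close>

definition adjoint_operator ::
  "('a::complex_banach \<times> 'a) set \<Rightarrow> (('a \<Rightarrow>\<^sub>L complex) \<times> ('a \<Rightarrow>\<^sub>L complex)) set" where
  "adjoint_operator A =
     {(f, g). f \<in> dual_space \<and> g \<in> dual_space \<and> (\<forall>(x, y)\<in>A. f y = g x)}"

end

theory Submission
  imports Defs "HOL-Complex_Analysis.Complex_Analysis"
begin

text \<open>Let \<open>P\<close>, \<open>Q\<close>, \<open>T\<close> be the semigroups of \<open>A\<close>, \<open>B\<close>, \<open>A + B\<close>, let \<open>\<tau> = t / n\<close> and \<open>F = P \<tau> Q \<tau>\<close>.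
  Hahn--Banach and the uniform boundedness principle turn the dual domain condition into
  \<open>\<parallel>P s B\<parallel> \<le> K (s powr (- \<alpha>) + 1)\<close>. A singular Gronwall argument for Duhamel's formula carries this bound
  over to \<open>T s B\<close>, and its discrete analogue to \<open>F\<^sup>m P \<tau> B\<close>. Expanding once more, both
  \<open>T (k \<tau>) A P \<tau>\<close> and \<open>F\<^sup>m P \<tau> (P r - 1) / r\<close> are bounded by multiples of
  \<open>1 / (i \<tau>) + ln n ((i \<tau>) powr (- \<alpha>) + 1)\<close> with \<open>i = k + 1\<close> and \<open>i = m + 1\<close>. In the telescoping sum
  \<open>F\<^sup>n P \<tau> - P \<tau> T t = (\<Sum>m + k = n - 1. F\<^sup>m P \<tau> (Q \<tau> P \<tau> - T \<tau>) T (k \<tau>))\<close>, multiplied by \<open>P \<tau>\<close> from the right,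
  smoothing is therefore available on both sides, and each term is at most
  \<open>\<tau>\<^sup>2\<close> times a product of two such bounds. Summing gives the rate \<open>(ln n)\<^sup>2 / n\<close> for every \<open>\<alpha> < 1\<close>,
  which for \<open>\<alpha> > 0\<close> is better than \<open>ln n / n powr (1 - \<alpha>)\<close>.\<close>

section \<open>Hahn--Banach and uniform boundedness\<close>

text \<open>The dual hypothesis controls B only with a smoothing factor on its left, as in
  \<open>P s B\<close>. Neither \<open>T\<close> nor \<open>F\<close> has such a factor of its own,
  so each must inherit it by comparison with \<open>P\<close>. Putting \<open>P \<tau>\<close> at
  the right end of a power of \<open>F\<close> gives a product that begins and ends with P; thus
  even the extreme terms m = 0 and k = 0 of the telescoping sum carry smoothing. The price is three
  corrections, each of size \<tau> times a rate. One logarithm comes from convolving the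
  nonintegrable kernel 1 / r of A P, cut off at r = \<tau>, with the integrable kernel of
  \<open>P s B\<close>; a second one comes from summing 1 / i over the grid. Convolutions are never
  evaluated: they are cut in the middle, which is enough because both kernels decrease. The Duhamel
  comparisons are made on single vectors by differentiating products of orbits, so they form no
  vector-valued integral. Uniform boundedness on a closed graph does the work of the closed graph
  theorem, for the generators as well as for the adjoints.\<close>

definition sublinear :: "('a::real_vector \<Rightarrow> real) \<Rightarrow> bool" where
  "sublinear p \<longleftrightarrow> (\<forall>x y. p (x + y) \<le> p x + p y) \<and> (\<forall>c>0. \<forall>x. p (c *\<^sub>R x) \<le> c * p x)"

lemma sublinear_add: "sublinear p \<Longrightarrow> p (x + y) \<le> p x + p y"
  by (simp add: sublinear_def)

lemma sublinear_zero:
  assumes "sublinear p" shows "p 0 = 0"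
proof -
  have "p (2 *\<^sub>R 0) \<le> 2 * p 0" "p ((1/2) *\<^sub>R 0) \<le> (1/2) * p 0"
    using assms unfolding sublinear_def by (metis zero_less_numeral, metis half_gt_zero zero_less_one)
  thus ?thesis by simp
qed

text \<open>The definition asks for an inequality only, but using it with 1 / c reverses it.\<close>

lemma sublinear_scale:
  assumes "sublinear p" "c \<ge> 0" shows "p (c *\<^sub>R x) = c * p x"
proof (cases "c = 0")
  case False
  hence c: "c > 0" using assms by simp
  hence "p ((1/c) *\<^sub>R (c *\<^sub>R x)) \<le> (1/c) * p (c *\<^sub>R x)"
    using assms(1) unfolding sublinear_def by (metis zero_less_divide_1_iff)
  moreover have "p (c *\<^sub>R x) \<le> c * p x" using assms(1) c by (simp add: sublinear_def)
  ultimately show ?thesis using c by (simp add: field_simps)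
qed (use assms in \<open>simp add: sublinear_zero\<close>)

lemma sublinear_ge:
  assumes "sublinear p" shows "- p (- x) \<le> p x"
  using sublinear_add[OF assms, of x "-x"] sublinear_zero[OF assms] by simp

text \<open>Lies below \<open>p\<close> (take t = 0) and is at most \<open>- p y\<close> at
  \<open>- y\<close> (take t = 1). The first fact lets minimality act, the second yields norming
  functionals without extending anything from a subspace.\<close>

definition sublinear_shift :: "('a::real_vector \<Rightarrow> real) \<Rightarrow> 'a \<Rightarrow> 'a \<Rightarrow> real" where
  "sublinear_shift p y x = (INF t\<in>{0..}. p (x + t *\<^sub>R y) - t * p y)"

lemma sublinear_shift_le:
  assumes "sublinear p" "t \<ge> 0"
  shows "sublinear_shift p y x \<le> p (x + t *\<^sub>R y) - t * p y"
  unfolding sublinear_shift_def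
proof (rule cINF_lower)
  show "bdd_below ((\<lambda>t. p (x + t *\<^sub>R y) - t * p y) ` {0..})"
  proof (rule bdd_belowI2)
    fix s :: real assume "s \<in> {0..}"
    hence "s * p y = p ((x + s *\<^sub>R y) + - x)"
      using sublinear_scale[OF assms(1), of s y] by simp
    also have "\<dots> \<le> p (x + s *\<^sub>R y) + p (- x)" by (rule sublinear_add[OF assms(1)])
    finally show "- p (- x) \<le> p (x + s *\<^sub>R y) - s * p y" by simp
  qed
qed (use assms in auto)

lemma sublinear_shift_ge:
  assumes "\<And>t. t \<ge> 0 \<Longrightarrow> c \<le> p (x + t *\<^sub>R y) - t * p y"
  shows "c \<le> sublinear_shift p y x"
  unfolding sublinear_shift_def by (rule cINF_greatest) (use assms in auto)

lemma sublinear_shift_sublinear: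
  assumes p: "sublinear p" shows "sublinear (sublinear_shift p y)"
  unfolding sublinear_def
proof safe
  fix a b
  let ?q = "sublinear_shift p y"
  have "?q (a + b) \<le> (p (a + s *\<^sub>R y) - s * p y) + (p (b + t *\<^sub>R y) - t * p y)"
    if "s \<ge> 0" "t \<ge> 0" for s t
  proof -
    have "?q (a + b) \<le> p ((a + b) + (s + t) *\<^sub>R y) - (s + t) * p y"
      using that by (intro sublinear_shift_le[OF p]) auto
    also have "(a + b) + (s + t) *\<^sub>R y = (a + s *\<^sub>R y) + (b + t *\<^sub>R y)" by (simp add: algebra_simps)
    finally show ?thesis using sublinear_add[OF p, of "a + s *\<^sub>R y" "b + t *\<^sub>R y"]
      by (simp add: algebra_simps)
  qed
  hence "?q (a + b) - (p (a + s *\<^sub>R y) - s * p y) \<le> ?q b" if "s \<ge> 0" for s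
    using that by (intro sublinear_shift_ge) (smt (verit))
  hence "?q (a + b) - ?q b \<le> ?q a"
    by (intro sublinear_shift_ge) (smt (verit))
  thus "?q (a + b) \<le> ?q a + ?q b" by simp
next
  fix c :: real and x assume c: "c > 0"
  have "sublinear_shift p y (c *\<^sub>R x) / c \<le> sublinear_shift p y x"
  proof (rule sublinear_shift_ge)
    fix t :: real assume t: "t \<ge> 0"
    have "sublinear_shift p y (c *\<^sub>R x) \<le> p (c *\<^sub>R x + (c * t) *\<^sub>R y) - (c * t) * p y"
      using c t by (intro sublinear_shift_le[OF p]) auto
    also have "c *\<^sub>R x + (c * t) *\<^sub>R y = c *\<^sub>R (x + t *\<^sub>R y)" by (simp add: algebra_simps)
    also have "p \<dots> = c * p (x + t *\<^sub>R y)" using c by (intro sublinear_scale[OF p]) auto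
    finally show "sublinear_shift p y (c *\<^sub>R x) / c \<le> p (x + t *\<^sub>R y) - t * p y"
      using c by (simp add: field_simps)
  qed
  thus "sublinear_shift p y (c *\<^sub>R x) \<le> c * sublinear_shift p y x"
    using c by (simp add: field_simps)
qed

text \<open>A minimal sublinear functional is linear: it coincides with each of its shifts.\<close>

lemma exists_linear_below_sublinear:
  fixes p0 :: "'a::real_vector \<Rightarrow> real"
  assumes p0: "sublinear p0"
  shows "\<exists>f. linear f \<and> (\<forall>x. f x \<le> p0 x)"
proof -
  define S where "S = {p. sublinear p \<and> p \<le> p0}"
  have "\<exists>m\<in>S. \<forall>a\<in>S. a \<le> m \<longrightarrow> a = m"
  \<comment> \<open>The order is reversed, so a maximal element is a minimal sublinear functional; a
    chain is bounded by its pointwise infimum.\<close>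
  proof (rule predicate_Zorn[where P = "\<lambda>a b. b \<le> a"])
    show "partial_order_on S (relation_of (\<lambda>a b. b \<le> a) S)"
      by (rule partial_order_on_relation_ofI) auto
  next
    fix C assume C: "C \<in> Chains (relation_of (\<lambda>a b. b \<le> a) S)"
    hence CS: "C \<subseteq> S" by (auto simp: Chains_def relation_of_def)
    have chain: "a \<le> b \<or> b \<le> a" if "a \<in> C" "b \<in> C" for a b
      using C that by (auto simp: Chains_def relation_of_def)
    show "\<exists>u\<in>S. \<forall>a\<in>C. u \<le> a"
    proof (cases "C = {}")
      case True thus ?thesis using p0 by (auto simp: S_def)
    next
      case False
      define u where "u x = (INF p\<in>C. p x)" for x
      have bdd: "bdd_below ((\<lambda>p. p x) ` C)" for x
      proof (rule bdd_belowI2)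
        fix p assume "p \<in> C"
        hence "sublinear p" "p \<le> p0" using CS by (auto simp: S_def)
        thus "- p0 (- x) \<le> p x" using sublinear_ge[of p x] by (smt (verit) le_funE)
      qed
      have u_le: "u x \<le> p x" if "p \<in> C" for p x
        unfolding u_def using that bdd by (intro cINF_lower)
      have u_ge: "c \<le> u x" if "\<And>p. p \<in> C \<Longrightarrow> c \<le> p x" for c x
        unfolding u_def using False that by (intro cINF_greatest)
      have "u (x + y) \<le> u x + u y" for x y
      proof -
        have "u (x + y) \<le> p x + q y" if pq: "p \<in> C" "q \<in> C" for p q
        proof -
          \<comment> \<open>Two members of a chain are comparable, so the smaller one serves at both
            points.\<close>
          obtain r where r: "r \<in> C" "r \<le> p" "r \<le> q" using chain[OF pq] pq by blast
          have "u (x + y) \<le> r (x + y)" using r u_le by blast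
          also have "\<dots> \<le> r x + r y" using r CS by (intro sublinear_add) (auto simp: S_def)
          finally show ?thesis using r by (smt (verit) le_funE)
        qed
        hence "u (x + y) - p x \<le> u y" if "p \<in> C" for p using that by (intro u_ge) (smt (verit))
        hence "u (x + y) - u y \<le> u x" by (intro u_ge) (smt (verit))
        thus ?thesis by simp
      qed
      moreover have "u (c *\<^sub>R x) \<le> c * u x" if "c > 0" for c x
      proof -
        have "u (c *\<^sub>R x) / c \<le> u x"
        proof (rule u_ge)
          fix p assume p: "p \<in> C"
          hence "p (c *\<^sub>R x) = c * p x" using CS that by (intro sublinear_scale) (auto simp: S_def)
          thus "u (c *\<^sub>R x) / c \<le> p x" using u_le[OF p, of "c *\<^sub>R x"] that by (simp add: field_simps)
        qed
        thus ?thesis using that by (simp add: field_simps)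
      qed
      ultimately have "sublinear u" by (simp add: sublinear_def)
      moreover have "u \<le> p0"
      proof -
        obtain p where p: "p \<in> C" using False by blast
        hence "p \<le> p0" using CS by (auto simp: S_def)
        thus ?thesis using u_le[OF p] by (meson le_fun_def order_trans)
      qed
      ultimately show ?thesis using u_le by (intro bexI[of _ u]) (auto simp: S_def le_fun_def)
    qed
  qed
  then obtain p where p: "sublinear p" "p \<le> p0" and min: "\<And>a. a \<in> S \<Longrightarrow> a \<le> p \<Longrightarrow> a = p"
    by (auto simp: S_def)
  have shift: "sublinear_shift p y = p" for y
  proof (rule min)
    show le: "sublinear_shift p y \<le> p"
      using sublinear_shift_le[OF p(1), of 0 y] by (simp add: le_fun_def)
    show "sublinear_shift p y \<in> S"
      using sublinear_shift_sublinear[OF p(1)] order_trans[OF le p(2)] by (simp add: S_def)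
  qed
  \<comment> \<open>Since \<open>p\<close> equals its shift, the shift bound at t = 1 is the reverse
    of subadditivity.\<close>
  have add: "p (x + y) = p x + p y" for x y
    using sublinear_shift_le[OF p(1), of 1 y x] sublinear_add[OF p(1), of x y] by (simp add: shift)
  have neg: "p (- x) = - p x" for x
    using add[of x "-x"] sublinear_zero[OF p(1)] by simp
  have "p (c *\<^sub>R x) = c * p x" for c x
  proof (cases "c \<ge> 0")
    case False
    thus ?thesis using sublinear_scale[OF p(1), of "-c" x] neg[of "c *\<^sub>R x"] by simp
  qed (rule sublinear_scale[OF p(1)])
  hence "linear p" using add by (intro linearI) auto
  thus ?thesis using p(2) by (auto simp: le_fun_def)
qed

text \<open>Dominating by the norm shifted towards \<open>y\<close> pushes the value at
  \<open>- y\<close> down to \<open>- norm y\<close>, so the norm is attained at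
  \<open>y\<close>.\<close>

lemma exists_norming_real_functional:
  fixes y :: "'a::real_normed_vector"
  shows "\<exists>f. linear f \<and> (\<forall>x. f x \<le> norm x) \<and> f y = norm y"
proof -
  have n: "sublinear (norm :: 'a \<Rightarrow> real)"
    by (auto simp: sublinear_def norm_triangle_ineq)
  obtain f where f: "linear f" "\<And>x. f x \<le> sublinear_shift norm y x"
    using exists_linear_below_sublinear[OF sublinear_shift_sublinear[OF n]] by blast
  have le: "f x \<le> norm x" for x
    using f(2)[of x] sublinear_shift_le[OF n, of 0 y x] by simp
  have "f (- y) \<le> - norm y"
    using f(2)[of "-y"] sublinear_shift_le[OF n, of 1 y "-y"] by simp
  hence "f y = norm y" using le[of y] linear_neg[OF f(1), of y] by simp
  thus ?thesis using f(1) le by blast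
qed

lemma scaleC_scaleR_commute: "c *\<^sub>C (r *\<^sub>R x) = r *\<^sub>R (c *\<^sub>C x)"
  for x :: "'a::complex_normed_vector"
  by (simp add: scaleR_scaleC scaleC_scaleC mult.commute)

text \<open>The real norming functional becomes the real part of a complex-linear one. Its norm does
  not grow, because a unimodular factor rotates each value onto the positive axis, where only the
  real part is seen.\<close>

lemma exists_norming_functional:
  fixes y :: "'a::complex_banach"
  shows "\<exists>f\<in>dual_space. norm f \<le> 1 \<and> blinfun_apply f y = of_real (norm y)"
proof -
  obtain u where u: "linear u" "\<And>x. u x \<le> norm x" "u y = norm y"
    using exists_norming_real_functional by blast
  define f where "f x = Complex (u x) (- u (\<i> *\<^sub>C x))" for x
  have add: "f (x + z) = f x + f z" for x z
    by (simp add: f_def complex_eq_iff scaleC_add_right linear_add[OF u(1)])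
  have sR: "f (r *\<^sub>R x) = r *\<^sub>R f x" for r x
    by (simp add: f_def complex_eq_iff scaleC_scaleR_commute linear_scale[OF u(1)])
  have ii: "f (\<i> *\<^sub>C x) = \<i> * f x" for x
  proof -
    have "\<i> *\<^sub>C \<i> *\<^sub>C x = - x"
      using scaleR_scaleC[of "-1" x] by (simp add: scaleC_scaleC)
    thus ?thesis by (simp add: f_def complex_eq_iff linear_neg[OF u(1)])
  qed
  have sC: "f (c *\<^sub>C x) = c * f x" for c x
  proof -
    have "c *\<^sub>C x = Re c *\<^sub>R x + Im c *\<^sub>R (\<i> *\<^sub>C x)"
      by (simp add: scaleR_scaleC scaleC_scaleC mult.commute complex_eq[symmetric] flip: scaleC_add_left)
    hence "f (c *\<^sub>C x) = Re c *\<^sub>R f x + Im c *\<^sub>R (\<i> * f x)" by (simp add: add sR ii)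
    also have "\<dots> = c * f x"
      by (subst (3) complex_eq[of c]) (simp add: scaleR_conv_of_real algebra_simps)
    finally show ?thesis .
  qed
  have bnd: "norm (f x) \<le> norm x" for x
  proof (cases "f x = 0")
    case False
    define w where "w = cnj (sgn (f x))"
    have w: "norm w = 1" using False by (simp add: w_def norm_sgn)
    have "w * f x = cnj (f x) * f x / of_real (norm (f x))" by (simp add: w_def sgn_eq)
    also have "cnj (f x) * f x = of_real (norm (f x)) * of_real (norm (f x))"
      using complex_norm_square[of "f x"] by (simp add: power2_eq_square mult.commute)
    also have "\<dots> / of_real (norm (f x)) = of_real (norm (f x))" using False by simp
    finally have "w * f x = of_real (norm (f x))" .
    hence "norm (f x) = Re (f (w *\<^sub>C x))" by (simp add: sC)
    also have "\<dots> = u (w *\<^sub>C x)" by (simp add: f_def)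
    also have "\<dots> \<le> norm (w *\<^sub>C x)" by (rule u(2))
    finally show ?thesis using w by (simp add: norm_scaleC)
  qed simp
  have bl: "bounded_linear f"
    by (rule bounded_linear_intro[where K = 1]) (use add sR bnd in auto)
  define F where "F = Blinfun f"
  have F: "blinfun_apply F = f" using bl by (simp add: F_def bounded_linear_Blinfun_apply)
  have "norm F \<le> 1" by (rule norm_blinfun_bound) (use bnd F in auto)
  moreover have "f y = of_real (norm y)"
  proof -
    \<comment> \<open>The real part alone exhausts the bound \<open>norm y\<close>, which leaves no
      room for an imaginary part.\<close>
    have "Re (f y) = norm y" by (simp add: f_def u(3))
    moreover have "norm (f y) \<le> norm y" by (rule bnd)
    ultimately have "(norm y)\<^sup>2 + (Im (f y))\<^sup>2 \<le> (norm y)\<^sup>2"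
      by (metis cmod_power2 norm_ge_zero power_mono)
    hence "Im (f y) = 0" by simp
    thus ?thesis using \<open>Re (f y) = norm y\<close> by (simp add: complex_eq_iff)
  qed
  moreover have "F \<in> dual_space"
    by (simp add: dual_space_def complex_linear_def F sC scaleC_complex_def)
  ultimately show ?thesis using F by auto
qed

lemma norm_le_by_dual:
  fixes y :: "'a::complex_banach"
  assumes "\<And>f. f \<in> dual_space \<Longrightarrow> norm f \<le> 1 \<Longrightarrow> norm (blinfun_apply f y) \<le> c"
  shows "norm y \<le> c"
proof -
  obtain f where "f \<in> dual_space" "norm f \<le> 1" "blinfun_apply f y = of_real (norm y)"
    using exists_norming_functional by blast
  thus ?thesis using assms[of f] by simp
qed

text \<open>Baire category inside the closed subspace \<open>W\<close>, which in the applications is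
  a graph or the whole space. The form with sublinear functions covers difference quotients and
  values of functionals alike.\<close>

lemma uniform_boundedness_on_subspace:
  fixes F :: "'i \<Rightarrow> 'b::banach \<Rightarrow> real"
  assumes W: "closed W" "subspace W"
    and cont: "\<And>i. i \<in> I \<Longrightarrow> continuous_on UNIV (F i)"
    and sub: "\<And>i. i \<in> I \<Longrightarrow> sublinear (F i)"
    and bdd: "\<And>x. x \<in> W \<Longrightarrow> \<exists>c. \<forall>i\<in>I. F i x \<le> c"
  shows "\<exists>C\<ge>0. \<forall>i\<in>I. \<forall>x\<in>W. F i x \<le> C * norm x"
proof -
  \<comment> \<open>Both \<open>x\<close> and \<open>- x\<close> are controlled, because the centre
    of the ball found by Baire enters through its negative.\<close>
  define G where "G k = {x\<in>W. \<forall>i\<in>I. F i x \<le> real k \<and> F i (-x) \<le> real k}" for k :: nat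
  have cl1: "closed {x. F i x \<le> c}" if "i \<in> I" for i c
    by (rule closed_Collect_le[OF cont[OF that] continuous_on_const])
  have cl2: "closed {x. F i (- x) \<le> c}" if "i \<in> I" for i c
  proof -
    have "continuous_on UNIV (\<lambda>x. F i (- x))"
      by (rule continuous_on_compose2[OF cont[OF that] continuous_on_minus[OF continuous_on_id]]) simp
    thus ?thesis by (rule closed_Collect_le[OF _ continuous_on_const])
  qed
  have clG: "closed (G k)" for k
  proof -
    have "G k = W \<inter> (\<Inter>i\<in>I. {x. F i x \<le> real k} \<inter> {x. F i (-x) \<le> real k})"
      by (auto simp: G_def)
    moreover have "closed (\<Inter>i\<in>I. {x. F i x \<le> real k} \<inter> {x. F i (-x) \<le> real k})"
      using cl1 cl2 by (intro closed_INT ballI closed_Int)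
    ultimately show ?thesis using W(1) by (simp add: closed_Int)
  qed
  have UG: "\<Union>(range G) = W"
  proof safe
    fix x assume x: "x \<in> W"
    obtain c where c: "\<forall>i\<in>I. F i x \<le> c" using bdd x by blast
    obtain d where d: "\<forall>i\<in>I. F i (-x) \<le> d" using bdd[OF subspace_neg[OF W(2) x]] by blast
    obtain k :: nat where "max c d \<le> real k" using real_arch_simple by blast
    hence "x \<in> G k" using x c d unfolding G_def by (smt (verit) mem_Collect_eq)
    thus "x \<in> \<Union>(range G)" by blast
  qed (auto simp: G_def)
  have "\<not> (\<forall>k. (top_of_set W) interior_of (G k) = {})"
  proof
    assume *: "\<forall>k. (top_of_set W) interior_of (G k) = {}"
    have "(top_of_set W) interior_of (\<Union>(range G)) = {}"
    proof (rule Baire_category_alt)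
      show "completely_metrizable_space (top_of_set W) \<or> locally_compact_space (top_of_set W) \<and> regular_space (top_of_set W)"
        using completely_metrizable_space_closedin[OF completely_metrizable_space_euclidean, of W] W(1)
        by simp
      fix T assume "T \<in> range G"
      thus "closedin (top_of_set W) T \<and> top_of_set W interior_of T = {}"
        using * clG by (auto intro!: closed_subset simp: G_def)
    qed simp
    hence "W = {}" using interior_of_topspace[of "top_of_set W"] by (simp only: UG topspace_euclidean_subtopology)
    thus False using subspace_0[OF W(2)] by auto
  qed
  then obtain k x0 where "x0 \<in> (top_of_set W) interior_of (G k)" by blast
  then obtain U where U: "openin (top_of_set W) U" "x0 \<in> U" "U \<subseteq> G k"
    by (auto simp: interior_of_def)
  then obtain r where r: "r > 0" "ball x0 r \<inter> W \<subseteq> U" "x0 \<in> W"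
    by (meson openin_contains_ball subsetD openin_imp_subset)
  have "F i x \<le> (4 * real k / r) * norm x" if i: "i \<in> I" and x: "x \<in> W" for i x
  proof (cases "x = 0")
    case True thus ?thesis using sublinear_zero[OF sub[OF i]] by simp
  next
    case False
    define c where "c = r / (2 * norm x)"
    have c: "c > 0" using False r by (simp add: c_def)
    have "x0 + c *\<^sub>R x \<in> G k"
    proof -
      have "x0 + c *\<^sub>R x \<in> W" using r x W(2) by (auto intro: subspace_add subspace_scale)
      moreover have "x0 + c *\<^sub>R x \<in> ball x0 r" using r False by (simp add: dist_norm c_def)
      ultimately show ?thesis using r U by blast
    qed
    moreover have "x0 \<in> G k" using U by blast
    ultimately have *: "F i (x0 + c *\<^sub>R x) \<le> real k" "F i (- x0) \<le> real k" using i by (auto simp: G_def)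
    have "c * F i x = F i ((x0 + c *\<^sub>R x) + - x0)"
      using sublinear_scale[OF sub[OF i], of c x] c by simp
    also have "\<dots> \<le> F i (x0 + c *\<^sub>R x) + F i (- x0)" by (rule sublinear_add[OF sub[OF i]])
    finally have "c * F i x \<le> 2 * real k" using * by simp
    thus ?thesis using c False r by (simp add: c_def field_simps)
  qed
  thus ?thesis using r by (intro exI[of _ "4 * real k / r"]) auto
qed

section \<open>Contraction semigroups and their generators\<close>

lemma has_vector_derivative_iff_quotient:
  "(f has_vector_derivative D) (at r) \<longleftrightarrow> ((\<lambda>y. (f y - f r) /\<^sub>R (y - r)) \<longlongrightarrow> D) (at r)"
  for f :: "real \<Rightarrow> 'a::real_normed_vector"
proof -
  have "(f has_vector_derivative D) (at r) \<longleftrightarrow>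
      ((\<lambda>y. ((f y - f r) - (y - r) *\<^sub>R D) /\<^sub>R norm (y - r)) \<longlongrightarrow> 0) (at r)"
    by (simp add: has_vector_derivative_def has_derivative_at_within bounded_linear_scaleR_left)
  also have "\<dots> \<longleftrightarrow> ((\<lambda>y. norm (((f y - f r) - (y - r) *\<^sub>R D) /\<^sub>R norm (y - r))) \<longlongrightarrow> 0) (at r)"
    by (rule tendsto_norm_zero_iff[symmetric])
  also have "\<dots> \<longleftrightarrow> ((\<lambda>y. norm ((f y - f r) /\<^sub>R (y - r) - D)) \<longlongrightarrow> 0) (at r)"
  proof (rule Lim_cong_within)
    fix y assume "y \<noteq> r"
    hence "(f y - f r) /\<^sub>R (y - r) - D = ((f y - f r) - (y - r) *\<^sub>R D) /\<^sub>R (y - r)"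
      by (simp add: scaleR_diff_right)
    thus "norm (((f y - f r) - (y - r) *\<^sub>R D) /\<^sub>R norm (y - r)) = norm ((f y - f r) /\<^sub>R (y - r) - D)"
      by simp
  qed auto
  also have "\<dots> \<longleftrightarrow> ((\<lambda>y. (f y - f r) /\<^sub>R (y - r)) \<longlongrightarrow> D) (at r)"
    by (subst tendsto_norm_zero_iff) (rule LIM_zero_iff)
  finally show ?thesis .
qed

lemma norm_diff_le_of_derivative_bound:
  fixes f :: "real \<Rightarrow> 'a::real_normed_vector"
  assumes "a \<le> b" "continuous_on {a..b} f"
    and "\<And>r. a < r \<Longrightarrow> r < b \<Longrightarrow> (f has_vector_derivative f' r) (at r)"
    and "\<And>r. a < r \<Longrightarrow> r < b \<Longrightarrow> norm (f' r) \<le> c"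
  shows "norm (f b - f a) \<le> c * (b - a)"
proof (cases "a = b")
  case False
  have "norm (f b - f a) \<le> c * b - c * a"
    by (rule differentiable_bound_general[where f' = f' and \<phi>' = "\<lambda>_. c"])
       (use assms False in \<open>auto intro!: continuous_intros derivative_eq_intros\<close>)
  thus ?thesis by (simp add: algebra_simps)
qed simp

lemma generator_unique: "(x, y) \<in> generator U \<Longrightarrow> (x, z) \<in> generator U \<Longrightarrow> y = z"
  unfolding generator_def using tendsto_unique[OF trivial_limit_at_right_real] by fastforce

lemma generator_zero: "(0, 0) \<in> generator U"
  by (simp add: generator_def blinfun.zero_right)

lemma generator_add:
  assumes "(x, y) \<in> generator U" "(x', y') \<in> generator U"
  shows "(x + x', y + y') \<in> generator U"
proof -
  have "((\<lambda>t. (U t x - x) /\<^sub>R t + (U t x' - x') /\<^sub>R t) \<longlongrightarrow> - y + - y') (at_right 0)"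
    using assms by (intro tendsto_add) (auto simp: generator_def)
  thus ?thesis by (simp add: generator_def blinfun.add_right algebra_simps)
qed

lemma generator_scaleR:
  assumes "(x, y) \<in> generator U" shows "(c *\<^sub>R x, c *\<^sub>R y) \<in> generator U"
proof -
  have "((\<lambda>t. c *\<^sub>R ((U t x - x) /\<^sub>R t)) \<longlongrightarrow> c *\<^sub>R (- y)) (at_right 0)"
    using assms by (intro tendsto_intros) (auto simp: generator_def)
  thus ?thesis by (simp add: generator_def blinfun.scaleR_right algebra_simps)
qed

lemma generator_diff:
  assumes "(x, y) \<in> generator U" "(x', y') \<in> generator U"
  shows "(x - x', y - y') \<in> generator U"
  using generator_add[OF assms(1) generator_scaleR[OF assms(2), of "-1"]] by simp

lemma subspace_generator: "subspace (generator U)"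
  unfolding subspace_def
  using generator_zero[of U] generator_add[of _ _ U] generator_scaleR[of _ _ U]
  by (auto simp: zero_prod_def)

lemma C0_semigroup_add:
  assumes "C0_semigroup U" "s \<ge> 0" "t \<ge> 0"
  shows "blinfun_apply (U (s + t)) x = U s (U t x)"
proof -
  have "U (s + t) = U s o\<^sub>L U t" using assms by (simp add: C0_semigroup_def)
  thus ?thesis by simp
qed

lemma C0_semigroup_commute:
  assumes "C0_semigroup U" "s \<ge> 0" "t \<ge> 0"
  shows "blinfun_apply (U s) (U t x) = U t (U s x)"
  using C0_semigroup_add[OF assms] C0_semigroup_add[OF assms(1,3,2)] by (simp add: add.commute)

lemma generator_invariant:
  assumes C0: "C0_semigroup U" and x: "(x, y) \<in> generator U" and t: "t \<ge> 0"
  shows "(U t x, U t y) \<in> generator U"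
proof -
  have "((\<lambda>h. U t ((U h x - x) /\<^sub>R h)) \<longlongrightarrow> U t (- y)) (at_right 0)"
    by (intro blinfun.tendsto tendsto_const) (use x in \<open>simp add: generator_def\<close>)
  moreover have "eventually (\<lambda>h. U t ((U h x - x) /\<^sub>R h) = (U h (U t x) - U t x) /\<^sub>R h) (at_right 0)"
    using eventually_at_right_less[of 0]
    by eventually_elim (simp add: blinfun.bilinear_simps C0_semigroup_commute[OF C0 t])
  ultimately have "((\<lambda>h. (U h (U t x) - U t x) /\<^sub>R h) \<longlongrightarrow> U t (- y)) (at_right 0)"
    by (rule Lim_transform_eventually)
  thus ?thesis by (simp add: generator_def blinfun.minus_right)
qed

section \<open>Continuity and differentiability of orbits of contraction semigroups\<close>

locale contractions =
  fixes U :: "real \<Rightarrow> ('a::complex_banach \<Rightarrow>\<^sub>L 'a)"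
  assumes contraction: "contraction_semigroup U"
begin

lemma C0: "C0_semigroup U"
  using contraction by (simp add: contraction_semigroup_def)

lemma zero: "blinfun_apply (U 0) x = x"
  using C0 by (simp add: C0_semigroup_def)

lemma add: "s \<ge> 0 \<Longrightarrow> t \<ge> 0 \<Longrightarrow> blinfun_apply (U (s + t)) x = U s (U t x)"
  by (rule C0_semigroup_add[OF C0])

lemma commute: "s \<ge> 0 \<Longrightarrow> t \<ge> 0 \<Longrightarrow> blinfun_apply (U s) (U t x) = U t (U s x)"
  by (rule C0_semigroup_commute[OF C0])

lemma invariant: "(x, y) \<in> generator U \<Longrightarrow> t \<ge> 0 \<Longrightarrow> (U t x, U t y) \<in> generator U"
  by (rule generator_invariant[OF C0])

lemma norm_le: "t \<ge> 0 \<Longrightarrow> norm (blinfun_apply (U t) x) \<le> norm x"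
  using contraction norm_blinfun[of "U t" x] mult_right_mono[of "norm (U t)" 1 "norm x"]
  by (auto simp: contraction_semigroup_def intro: order_trans)

lemma norm_diff_le:
  assumes "0 \<le> s" "0 \<le> t"
  shows "norm (blinfun_apply (U t) x - U s x) \<le> norm (U \<bar>t - s\<bar> x - x)"
proof -
  have "norm (blinfun_apply (U t) x - U s x) \<le> norm (U (t - s) x - x)" if "0 \<le> s" "s \<le> t" for s t
  proof -
    have "U t x = U s (U (t - s) x)" using add[of s "t - s" x] that by simp
    hence "U t x - U s x = U s (U (t - s) x - x)" by (simp add: blinfun.diff_right)
    thus ?thesis using norm_le that by simp
  qed
  from this[of s t] this[of t s] show ?thesis
    using assms by (cases "s \<le> t") (auto simp: norm_minus_commute abs_if)
qed

lemma tendsto_zero: "((\<lambda>t. U t x) \<longlongrightarrow> x) (at_right 0)"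
  using C0 by (simp add: C0_semigroup_def)

lemma small_time:
  assumes "e > 0" obtains d where "d > 0" "\<And>t. 0 \<le> t \<Longrightarrow> t < d \<Longrightarrow> norm (U t x - x) < e"
proof -
  have "eventually (\<lambda>t. dist (U t x) x < e) (at_right 0)"
    using tendsto_zero assms by (rule tendstoD)
  then obtain d where d: "d > 0" "\<And>t. 0 < t \<Longrightarrow> t < d \<Longrightarrow> dist (U t x) x < e"
    unfolding eventually_at_right_field by blast
  show ?thesis
  proof (rule that[OF d(1)])
    fix t assume "0 \<le> t" "t < d"
    thus "norm (U t x - x) < e" using d(2)[of t] assms zero by (cases "t = 0") (auto simp: dist_norm)
  qed
qed

lemma continuous: "continuous_on {0..} (\<lambda>t. U t x)"
  unfolding continuous_on_iff
proof safe
  fix s e :: real assume s: "0 \<le> s" and e: "e > 0"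
  obtain d where d: "d > 0" "\<And>t. 0 \<le> t \<Longrightarrow> t < d \<Longrightarrow> norm (U t x - x) < e"
    using small_time[OF e] by blast
  show "\<exists>d>0. \<forall>t\<in>{0..}. dist t s < d \<longrightarrow> dist (U t x) (U s x) < e"
  proof (intro exI[of _ d] conjI ballI impI)
    fix t :: real assume t: "t \<in> {0..}" "dist t s < d"
    have "norm (U t x - U s x) \<le> norm (U \<bar>t - s\<bar> x - x)" using t s by (intro norm_diff_le) auto
    also have "\<dots> < e" using t by (intro d(2)) (auto simp: dist_real_def)
    finally show "dist (U t x) (U s x) < e" by (simp add: dist_norm)
  qed (rule d(1))
qed

text \<open>Joint strong continuity: by contractivity, \<open>U (f z) (g z - x)\<close> is no larger
  than \<open>g z - x\<close>, so only the time variable remains.\<close>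

lemma tendsto_compose:
  assumes f: "(f \<longlongrightarrow> a) F" and g: "(g \<longlongrightarrow> x) F" and pos: "eventually (\<lambda>z. f z \<ge> 0) F" and a: "a \<ge> 0"
  shows "((\<lambda>z. blinfun_apply (U (f z)) (g z)) \<longlongrightarrow> U a x) F"
proof -
  have 1: "((\<lambda>z. U (f z) x) \<longlongrightarrow> U a x) F"
    by (rule continuous_on_tendsto_compose[OF continuous f]) (use a pos in auto)
  have "((\<lambda>z. U (f z) (g z - x)) \<longlongrightarrow> 0) F"
  proof (rule Lim_null_comparison)
    show "eventually (\<lambda>z. norm (U (f z) (g z - x)) \<le> norm (g z - x)) F"
      using pos by eventually_elim (rule norm_le)
    show "((\<lambda>z. norm (g z - x)) \<longlongrightarrow> 0) F"
      using g by (intro tendsto_norm_zero) (simp add: LIM_zero)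
  qed
  from tendsto_add[OF this 1] show ?thesis by (simp add: blinfun.diff_right)
qed

lemma continuous_compose:
  assumes "continuous_on S f" "continuous_on S g" "\<And>z. z \<in> S \<Longrightarrow> f z \<ge> 0"
  shows "continuous_on S (\<lambda>z. blinfun_apply (U (f z)) (g z))"
  using assms unfolding continuous_on_def
  by (auto intro!: tendsto_compose simp: eventually_at_filter)

text \<open>Gives density of the domain from smoothing, since every \<open>U s x\<close> with s > 0
  then lies in the domain and these vectors tend to \<open>x\<close>.\<close>

lemma closure_eq_UNIV:
  assumes "\<And>s x. s > 0 \<Longrightarrow> U s x \<in> S" shows "closure S = UNIV"
proof -
  have "x \<in> closure S" for x
  proof -
    have "(\<lambda>n. U (1 / real (Suc n)) x) \<longlonglongrightarrow> x"
      using tendsto_compose[OF LIMSEQ_Suc[OF lim_1_over_n] tendsto_const[of x]] by (simp add: zero)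
    thus ?thesis unfolding closure_sequential
      by (intro exI[of _ "\<lambda>n. U (1 / real (Suc n)) x"]) (auto intro: assms)
  qed
  thus ?thesis by blast
qed

text \<open>The right quotient is \<open>U t\<close> applied to the quotient at zero. The left one
  is \<open>U (t - h)\<close> applied to that same quotient, so its limit needs operator and vector
  to vary together.\<close>

lemma orbit_derivative:
  assumes x: "(x, y) \<in> generator U" and t: "t > 0"
  shows "((\<lambda>s. U s x) has_vector_derivative - U t y) (at t)"
proof -
  have q: "((\<lambda>h. (U h x - x) /\<^sub>R h) \<longlongrightarrow> - y) (at_right 0)" using x by (simp add: generator_def)
  have "((\<lambda>h. U t ((U h x - x) /\<^sub>R h)) \<longlongrightarrow> U t (- y)) (at_right 0)"
    by (intro blinfun.tendsto tendsto_const q)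
  moreover have "eventually (\<lambda>h. U t ((U h x - x) /\<^sub>R h) = (U (h + t) x - U t x) /\<^sub>R (h + t - t)) (at_right 0)"
    using eventually_at_right_less[of 0]
    by eventually_elim (use t in \<open>simp add: blinfun.bilinear_simps add.commute[of _ t] add\<close>)
  ultimately have R: "((\<lambda>s. (U s x - U t x) /\<^sub>R (s - t)) \<longlongrightarrow> U t (- y)) (at_right t)"
    unfolding filterlim_at_right_to_0[of _ _ t] by (rule Lim_transform_eventually)
  have "((\<lambda>h. U (t - h) ((U h x - x) /\<^sub>R h)) \<longlongrightarrow> U t (- y)) (at_right 0)"
  proof (rule tendsto_compose[OF _ q])
    show "((\<lambda>h. t - h) \<longlongrightarrow> t) (at_right 0)" by (auto intro!: tendsto_eq_intros)
    show "\<forall>\<^sub>F h in at_right 0. 0 \<le> t - h"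
      using t by (auto simp: eventually_at_right_field intro!: exI[of _ t])
  qed (use t in auto)
  moreover have "eventually (\<lambda>h. U (t - h) ((U h x - x) /\<^sub>R h)
      = (U (- (h + - t)) x - U t x) /\<^sub>R (- (h + - t) - t)) (at_right 0)"
  proof -
    have "eventually (\<lambda>h. h < t) (at_right 0)"
      using t by (auto simp: eventually_at_right_field intro!: exI[of _ t])
    thus ?thesis using eventually_at_right_less[of 0]
    proof eventually_elim
      case (elim h)
      have "U t x = U (t - h) (U h x)" using add[of "t - h" h x] elim by simp
      thus ?case using elim by (simp add: blinfun.bilinear_simps scaleR_diff_right)
    qed
  qed
  ultimately have "((\<lambda>s. (U s x - U t x) /\<^sub>R (s - t)) \<longlongrightarrow> U t (- y)) (at_left t)"
    unfolding filterlim_at_left_to_right filterlim_at_right_to_0[of _ _ "- t"]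
    by (rule Lim_transform_eventually)
  thus ?thesis using R
    by (simp add: has_vector_derivative_iff_quotient filterlim_at_split blinfun.minus_right)
qed

lemma orbit_continuous: "continuous_on {0..t} (\<lambda>s. U s x)"
  by (rule continuous_on_subset[OF continuous]) auto

text \<open>Mean value inequality for \<open>U s x + s *\<^sub>R z\<close>. With z = 0 it makes
  orbits Lipschitz; with z near the generator value it makes difference quotients converge.\<close>

lemma orbit_shift_bound:
  assumes x: "(x, y) \<in> generator U" and t: "t \<ge> 0"
    and e: "\<And>s. 0 \<le> s \<Longrightarrow> s \<le> t \<Longrightarrow> norm (U s y - z) \<le> e"
  shows "norm (U t x - x + t *\<^sub>R z) \<le> e * t"
proof -
  have "norm ((U t x + t *\<^sub>R z) - (U 0 x + 0 *\<^sub>R z)) \<le> e * (t - 0)"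
  proof (rule norm_diff_le_of_derivative_bound[where f = "\<lambda>s. U s x + s *\<^sub>R z" and f' = "\<lambda>s. - U s y + z"])
    fix r assume "0 < r" "r < t"
    thus "((\<lambda>s. U s x + s *\<^sub>R z) has_vector_derivative - U r y + z) (at r)"
      by (auto intro!: derivative_eq_intros orbit_derivative[OF x])
    show "norm (- U r y + z) \<le> e"
      using e[of r] \<open>0 < r\<close> \<open>r < t\<close> by (simp add: norm_minus_commute)
  qed (use t in \<open>auto intro!: continuous_intros orbit_continuous\<close>)
  thus ?thesis by (simp add: zero algebra_simps)
qed

lemma orbit_lipschitz:
  assumes "(x, y) \<in> generator U" "t \<ge> 0"
  shows "norm (U t x - x) \<le> t * norm y"
  using orbit_shift_bound[OF assms, of 0 "norm y"] norm_le by (simp add: mult.commute)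

lemma closed_generator: "closed (generator U)"
  unfolding closed_sequential_limits
proof safe
  fix X x y assume X: "\<forall>n. X n \<in> generator U" and lim: "X \<longlonglongrightarrow> (x, y)"
  define a b where "a = fst \<circ> X" and "b = snd \<circ> X"
  have ab: "(a n, b n) \<in> generator U" for n using X by (simp add: a_def b_def)
  have la: "a \<longlonglongrightarrow> x" and lb: "b \<longlonglongrightarrow> y"
    using tendsto_fst[OF lim] tendsto_snd[OF lim] by (simp_all add: a_def b_def o_def)
  \<comment> \<open>The limit along the sequence is taken at fixed t, in an estimate uniform in the
    sequence; letting t tend to 0 afterwards exchanges the two limits.\<close>
  have bound: "norm (U t x - x + t *\<^sub>R y) \<le> e * t"
    if t: "t \<ge> 0" and e: "\<And>s. 0 \<le> s \<Longrightarrow> s \<le> t \<Longrightarrow> norm (U s y - y) \<le> e" for t e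
  proof (rule tendsto_le)
    show "(\<lambda>n. norm (U t (a n) - a n + t *\<^sub>R y)) \<longlonglongrightarrow> norm (U t x - x + t *\<^sub>R y)"
      using la by (auto intro!: tendsto_intros blinfun.tendsto)
    show "(\<lambda>n. (norm (b n - y) + e) * t) \<longlonglongrightarrow> e * t"
      using lb by (auto intro!: tendsto_eq_intros simp: LIM_zero)
    have "norm (U t (a n) - a n + t *\<^sub>R y) \<le> (norm (b n - y) + e) * t" for n
    proof (rule orbit_shift_bound[OF ab t])
      fix s assume s: "0 \<le> s" "s \<le> t"
      have "U s (b n) - y = U s (b n - y) + (U s y - y)" by (simp add: blinfun.diff_right)
      thus "norm (U s (b n) - y) \<le> norm (b n - y) + e"
        using norm_le[OF s(1), of "b n - y"] e[OF s] by (metis add_mono norm_triangle_le)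
    qed
    thus "\<forall>\<^sub>F n in sequentially. norm (U t (a n) - a n + t *\<^sub>R y) \<le> (norm (b n - y) + e) * t"
      by simp
  qed simp
  have "((\<lambda>t. (U t x - x) /\<^sub>R t) \<longlongrightarrow> - y) (at_right 0)"
  proof (rule tendstoI)
    fix e :: real assume e: "e > 0"
    obtain d where d: "d > 0" "\<And>t. 0 \<le> t \<Longrightarrow> t < d \<Longrightarrow> norm (U t y - y) < e / 2"
      using small_time[of "e / 2"] e by auto
    have "dist ((U t x - x) /\<^sub>R t) (- y) < e" if t: "0 < t" "t < d" for t
    proof -
      have "(U t x - x) /\<^sub>R t - (- y) = (U t x - x + t *\<^sub>R y) /\<^sub>R t"
        using t by (simp add: scaleR_add_right)
      moreover have "norm (U t x - x + t *\<^sub>R y) \<le> (e / 2) * t"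
        using t d(2) by (intro bound) (auto intro: less_imp_le)
      ultimately have "dist ((U t x - x) /\<^sub>R t) (- y) \<le> e / 2"
        using t by (simp add: dist_norm divide_simps mult.commute)
      thus ?thesis using e by simp
    qed
    thus "\<forall>\<^sub>F t in at_right 0. dist ((U t x - x) /\<^sub>R t) (- y) < e"
      unfolding eventually_at_right_field using d(1) by blast
  qed
  thus "(x, y) \<in> generator U" by (simp add: generator_def)
qed

text \<open>Leibniz rule behind every Duhamel comparison. In the first summand the minus sign of the
  generator convention cancels the one from \<open>s - \<rho>\<close>.\<close>

lemma product_derivative:
  assumes u: "(u has_vector_derivative u') (at r)" and w: "(u r, w) \<in> generator U" and r: "r < s"
  shows "((\<lambda>\<rho>. blinfun_apply (U (s - \<rho>)) (u \<rho>)) has_vector_derivative (U (s - r) w + U (s - r) u')) (at r)"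
proof -
  have "((\<lambda>z. U z (u r)) \<circ> (\<lambda>\<rho>. s - \<rho>) has_vector_derivative (-1) *\<^sub>R (- U (s - r) w)) (at r)"
    using r by (intro vector_diff_chain_at orbit_derivative[OF w]) (auto intro!: derivative_eq_intros)
  hence 1: "((\<lambda>\<rho>. (U (s - \<rho>) (u r) - U (s - r) (u r)) /\<^sub>R (\<rho> - r)) \<longlongrightarrow> U (s - r) w) (at r)"
    by (simp add: has_vector_derivative_iff_quotient o_def)
  have 2: "((\<lambda>\<rho>. U (s - \<rho>) ((u \<rho> - u r) /\<^sub>R (\<rho> - r))) \<longlongrightarrow> U (s - r) u') (at r)"
  proof (rule tendsto_compose)
    show "((\<lambda>\<rho>. s - \<rho>) \<longlongrightarrow> s - r) (at r)" by (auto intro!: tendsto_eq_intros)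
    show "\<forall>\<^sub>F \<rho> in at r. 0 \<le> s - \<rho>"
      using r by (auto simp: eventually_at intro!: exI[of _ "s - r"] simp: dist_real_def)
  qed (use u r in \<open>auto simp: has_vector_derivative_iff_quotient\<close>)
  have "(U (s - \<rho>) (u \<rho>) - U (s - r) (u r)) /\<^sub>R (\<rho> - r) =
      (U (s - \<rho>) (u r) - U (s - r) (u r)) /\<^sub>R (\<rho> - r) + U (s - \<rho>) ((u \<rho> - u r) /\<^sub>R (\<rho> - r))" for \<rho>
    by (simp add: blinfun.bilinear_simps flip: scaleR_add_right)
  with tendsto_add[OF 1 2] show ?thesis by (simp add: has_vector_derivative_iff_quotient)
qed

end

section \<open>Relative bounds and contractivity of the semigroup of the sum\<close>

lemma norm_Pair_le_add: "norm (x, y) \<le> norm x + norm y"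
  by (metis norm_Pair sqrt_add_le_add_sqrt norm_ge_zero real_sqrt_abs abs_norm_cancel zero_le_power2)

text \<open>At a domain vector the difference quotients of \<open>V\<close> are bounded, because its
  orbit is Lipschitz. Uniform boundedness on the closed graph of the generator of \<open>U\<close>
  bounds them by the graph norm, and h tends to 0.\<close>

lemma generator_relatively_bounded:
  fixes U V :: "real \<Rightarrow> ('a::complex_banach \<Rightarrow>\<^sub>L 'a)"
  assumes U: "contraction_semigroup U" and V: "contraction_semigroup V"
    and dom: "Domain (generator U) \<subseteq> Domain (generator V)"
  shows "\<exists>K\<ge>0. \<forall>x y z. (x, y) \<in> generator U \<longrightarrow> (x, z) \<in> generator V \<longrightarrow> norm z \<le> K * (norm x + norm y)"
proof -
  interpret U: contractions U by standard (rule U)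
  interpret V: contractions V by standard (rule V)
  have "\<exists>C\<ge>0. \<forall>h\<in>{0<..}. \<forall>p\<in>generator U. norm ((V h (fst p) - fst p) /\<^sub>R h) \<le> C * norm p"
  proof (rule uniform_boundedness_on_subspace)
    fix h :: real assume "h \<in> {0<..}"
    show "continuous_on UNIV (\<lambda>p :: 'a \<times> 'a. norm ((V h (fst p) - fst p) /\<^sub>R h))"
      by (intro continuous_intros)
    show "sublinear (\<lambda>p :: 'a \<times> 'a. norm ((V h (fst p) - fst p) /\<^sub>R h))"
      unfolding sublinear_def
    proof safe
      fix a b a' b' :: 'a
      have "V h (a + a') - (a + a') = (V h a - a) + (V h a' - a')" by (simp add: blinfun.add_right)
      thus "norm ((V h (fst ((a, b) + (a', b'))) - fst ((a, b) + (a', b'))) /\<^sub>R h)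
          \<le> norm ((V h (fst (a, b)) - fst (a, b)) /\<^sub>R h) + norm ((V h (fst (a', b')) - fst (a', b')) /\<^sub>R h)"
        by (metis fst_conv norm_triangle_ineq plus_prod_def scaleR_add_right)
    next
      fix c :: real and a b :: 'a assume "c > 0"
      have "V h (c *\<^sub>R a) - c *\<^sub>R a = c *\<^sub>R (V h a - a)" by (simp add: blinfun.scaleR_right scaleR_diff_right)
      thus "norm ((V h (fst (c *\<^sub>R (a, b))) - fst (c *\<^sub>R (a, b))) /\<^sub>R h)
          \<le> c * norm ((V h (fst (a, b)) - fst (a, b)) /\<^sub>R h)"
        using \<open>c > 0\<close> by (simp add: abs_mult)
    qed
  next
    fix p assume "p \<in> generator U"
    then obtain z where z: "(fst p, z) \<in> generator V" using dom by (metis Domain.simps subset_iff prod.collapse DomainE)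
    have "norm ((V h (fst p) - fst p) /\<^sub>R h) \<le> norm z" if "h > 0" for h
      using V.orbit_lipschitz[OF z, of h] that by (simp add: divide_simps mult.commute)
    thus "\<exists>c. \<forall>h\<in>{0<..}. norm ((V h (fst p) - fst p) /\<^sub>R h) \<le> c" by auto
  qed (simp_all add: U.closed_generator subspace_generator)
  then obtain C where C: "C \<ge> 0" "\<And>h x y. h > 0 \<Longrightarrow> (x, y) \<in> generator U \<Longrightarrow> norm ((V h x - x) /\<^sub>R h) \<le> C * norm (x, y)"
    by fastforce
  have "norm z \<le> C * (norm x + norm y)" if "(x, y) \<in> generator U" "(x, z) \<in> generator V" for x y z
  proof -
    have "((\<lambda>h. (V h x - x) /\<^sub>R h) \<longlongrightarrow> - z) (at_right 0)" using that by (simp add: generator_def)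
    moreover have "\<forall>\<^sub>F h in at_right 0. norm ((V h x - x) /\<^sub>R h) \<le> C * norm (x, y)"
      using eventually_at_right_less[of 0] by eventually_elim (rule C(2)[OF _ that(1)])
    ultimately have "norm (- z) \<le> C * norm (x, y)"
      using tendsto_upperbound[OF tendsto_norm] trivial_limit_at_right_real by blast
    also have "\<dots> \<le> C * (norm x + norm y)" using C(1) norm_Pair_le_add by (intro mult_left_mono)
    finally show ?thesis by simp
  qed
  thus ?thesis using C(1) by blast
qed

text \<open>Give \<open>g\<close> a slack e and take the last time at which it lies below the line
  of slope e through its initial value; the bound on increments to the right pushes beyond that
  time.\<close>

lemma nonincreasing_of_right_derivative:
  fixes g :: "real \<Rightarrow> real"
  assumes ab: "a \<le> b" and cont: "continuous_on {a..b} g"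
    and dini: "\<And>t e. a \<le> t \<Longrightarrow> t < b \<Longrightarrow> e > 0 \<Longrightarrow> \<forall>\<^sub>F h in at_right 0. g (t + h) \<le> g t + e * h"
  shows "g b \<le> g a"
proof -
  have "g b \<le> g a + e * (b - a)" if e: "e > 0" for e
  proof (rule ccontr)
    define S where "S = {t\<in>{a..b}. g t - e * (t - a) \<le> g a}"
    assume neg: "\<not> ?thesis"
    have "closed S" unfolding S_def
      by (intro continuous_on_closed_Collect_le continuous_intros cont)
    hence "compact S" unfolding compact_eq_bounded_closed
      by (auto simp: S_def intro: bounded_subset[of "{a..b}"])
    moreover have "a \<in> S" using ab by (simp add: S_def)
    ultimately obtain c where c: "c \<in> S" "\<And>t. t \<in> S \<Longrightarrow> t \<le> c"
      using compact_attains_sup[of S] by blast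
    have cb: "a \<le> c" "c < b" using c(1) neg by (auto simp: S_def order_less_le)
    obtain d where d: "d > 0" "\<And>h. 0 < h \<Longrightarrow> h < d \<Longrightarrow> g (c + h) \<le> g c + e * h"
      using dini[OF cb e] unfolding eventually_at_right_field by auto
    define h where "h = min (d / 2) (b - c)"
    have h: "0 < h" "h < d" "h \<le> b - c" using d cb by (auto simp: h_def)
    have "c + h \<in> S" using d(2)[OF h(1,2)] c(1) h cb by (auto simp: S_def algebra_simps)
    thus False using c(2) h(1) by fastforce
  qed
  hence "g b - g a \<le> e" if "e > 0" for e
  proof (cases "a = b")
    case False
    hence "b - a > 0" using ab by simp
    thus ?thesis using \<open>\<And>e. e > 0 \<Longrightarrow> g b \<le> g a + e * (b - a)\<close>[of "e / (b - a)"] that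
      by simp
  qed (use that in auto)
  thus ?thesis by (metis diff_gt_0_iff_gt dense linorder_not_le)
qed

text \<open>Otherwise the norms are unbounded along a sequence of times tending to 0, although
  \<open>T (t n) x\<close> converges for every \<open>x\<close>.\<close>

lemma C0_semigroup_locally_bounded:
  fixes T :: "real \<Rightarrow> ('a::complex_banach \<Rightarrow>\<^sub>L 'a)"
  assumes T: "C0_semigroup T"
  shows "\<exists>d>0. \<exists>M. \<forall>t\<in>{0..d}. norm (T t) \<le> M"
proof (rule ccontr)
  assume neg: "\<not> ?thesis"
  have "\<exists>t. 0 \<le> t \<and> t \<le> 1 / real (Suc n) \<and> norm (T t) > real n" for n
    using neg by (metis atLeastAtMost_iff linorder_not_le of_nat_0_less_iff zero_less_Suc zero_less_divide_1_iff)
  then obtain t where t: "\<And>n. 0 \<le> t n" "\<And>n. t n \<le> 1 / real (Suc n)" "\<And>n. norm (T (t n)) > real n"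
    by metis
  have t0: "t \<longlonglongrightarrow> 0"
    by (rule tendsto_sandwich[of "\<lambda>_. 0" _ _ "\<lambda>n. 1 / real (Suc n)"])
       (use t LIMSEQ_Suc[OF lim_1_over_n] in auto)
  have "(\<lambda>n. T (t n) x) \<longlonglongrightarrow> x" for x
  proof -
    have "((\<lambda>t. T t x) \<longlongrightarrow> T 0 x) (at 0 within {0..})"
      using T by (simp add: C0_semigroup_def at_within_Ici_at_right)
    hence "(\<lambda>n. T (t n) x) \<longlonglongrightarrow> T 0 x"
      using t t0 by (intro continuous_within_tendsto_compose'[where S = "{0..}" and a = 0 and f = "\<lambda>t. T t x"])
        (auto simp: continuous_within)
    thus ?thesis using T by (simp add: C0_semigroup_def)
  qed
  hence bd: "\<exists>c. \<forall>n\<in>UNIV. norm (T (t n) x) \<le> c" for x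
    using convergent_imp_Bseq[of "\<lambda>n. T (t n) x"] unfolding convergent_def Bseq_def by blast
  have "\<exists>C\<ge>0. \<forall>n\<in>UNIV. \<forall>x\<in>UNIV. norm (T (t n) x) \<le> C * norm x"
    by (rule uniform_boundedness_on_subspace)
       (use bd in \<open>auto simp: sublinear_def blinfun.add_right blinfun.scaleR_right norm_triangle_ineq
          intro!: continuous_intros\<close>)
  then obtain C where "C \<ge> 0" "\<And>n x. norm (T (t n) x) \<le> C * norm x" by blast
  hence "norm (T (t n)) \<le> C" for n by (intro norm_blinfun_bound)
  thus False using t(3) by (metis linorder_not_le order.strict_trans1 reals_Archimedean2 not_less_iff_gr_or_eq)
qed

lemma dense_bound_extends:
  fixes F :: "'a::real_normed_vector \<Rightarrow>\<^sub>L 'b::real_normed_vector"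
  assumes "closure D = UNIV" "\<And>x. x \<in> D \<Longrightarrow> norm (F x) \<le> c * norm x"
  shows "norm (F x) \<le> c * norm x"
proof -
  have "closed {x. norm (F x) \<le> c * norm x}"
    by (intro closed_Collect_le continuous_intros)
  hence "closure D \<subseteq> {x. norm (F x) \<le> c * norm x}"
    using assms(2) by (intro closure_minimal) auto
  thus ?thesis using assms(1) by auto
qed

text \<open>To first order in \<open>h\<close>, \<open>T h\<close> acts on a domain vector like the contraction \<open>P h (Q h)\<close>;
  hence orbits of \<open>T\<close> in the domain have nonincreasing norm.\<close>

lemma contraction_semigroup_of_generator_sum:
  fixes P Q T :: "real \<Rightarrow> ('a::complex_banach \<Rightarrow>\<^sub>L 'a)"
  assumes P: "contraction_semigroup P" and Q: "contraction_semigroup Q" and T: "C0_semigroup T"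
    and gen: "generator T = operator_sum (generator P) (generator Q)"
    and dense: "closure (Domain (generator T)) = UNIV"
  shows "contraction_semigroup T"
proof -
  interpret P: contractions P by standard (rule P)
  interpret Q: contractions Q by standard (rule Q)
  obtain d M where d: "d > 0" and M: "\<And>t. 0 \<le> t \<Longrightarrow> t \<le> d \<Longrightarrow> norm (T t) \<le> M"
    using C0_semigroup_locally_bounded[OF T] by fastforce
  have T0: "((\<lambda>t. T t x) \<longlongrightarrow> x) (at_right 0)" for x using T by (simp add: C0_semigroup_def)
  have M0: "M \<ge> 0" using M[of 0] d norm_ge_zero order_trans by (metis less_imp_le order_refl)
  have close: "norm (T t x - T s x) \<le> M * norm (T \<bar>t - s\<bar> x - x)" if "s \<in> {0..d}" "t \<in> {0..d}" for s t x
  proof -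
    \<comment> \<open>Contractivity is still to be shown, so orbit continuity on [0, d] rests on the
      local bound \<open>M\<close>.\<close>
    have *: "norm (T t x - T s x) \<le> M * norm (T (t - s) x - x)" if "0 \<le> s" "s \<le> t" "t \<le> d" for s t
    proof -
      have "T t x = T s (T (t - s) x)" using C0_semigroup_add[OF T, of s "t - s" x] that by simp
      hence "T t x - T s x = T s (T (t - s) x - x)" by (simp add: blinfun.diff_right)
      also have "norm \<dots> \<le> norm (T s) * norm (T (t - s) x - x)" by (rule norm_blinfun)
      also have "\<dots> \<le> M * norm (T (t - s) x - x)" using M that by (intro mult_right_mono) auto
      finally show ?thesis .
    qed
    show ?thesis using *[of s t] *[of t s] that by (cases "s \<le> t") (auto simp: norm_minus_commute abs_if)
  qed
  have cont: "continuous_on {0..d} (\<lambda>t. T t x)" for x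
    unfolding continuous_on_def
  proof
    fix s assume s: "s \<in> {0..d}"
    have "((\<lambda>t. T t x) \<longlongrightarrow> T 0 x) (at 0 within {0..})"
      using T by (simp add: C0_semigroup_def at_within_Ici_at_right)
    hence "((\<lambda>t. T \<bar>t - s\<bar> x) \<longlongrightarrow> T 0 x) (at s within {0..d})"
      by (intro continuous_within_tendsto_compose'[where S = "{0..}" and a = 0 and f = "\<lambda>t. T t x"])
         (auto simp: continuous_within intro!: tendsto_eq_intros)
    hence "((\<lambda>t. T \<bar>t - s\<bar> x) \<longlongrightarrow> x) (at s within {0..d})"
      using T by (simp add: C0_semigroup_def)
    hence "((\<lambda>t. M * norm (T \<bar>t - s\<bar> x - x)) \<longlongrightarrow> M * norm (x - x)) (at s within {0..d})"
      by (intro tendsto_mult_left tendsto_norm tendsto_diff tendsto_const)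
    hence lim: "((\<lambda>t. M * norm (T \<bar>t - s\<bar> x - x)) \<longlongrightarrow> 0) (at s within {0..d})" by simp
    have "((\<lambda>t. T t x - T s x) \<longlongrightarrow> 0) (at s within {0..d})"
    proof (rule Lim_null_comparison[OF _ lim])
      show "\<forall>\<^sub>F t in at s within {0..d}. norm (T t x - T s x) \<le> M * norm (T \<bar>t - s\<bar> x - x)"
        unfolding eventually_at_filter by (intro always_eventually allI impI close s)
    qed
    thus "((\<lambda>t. T t x) \<longlongrightarrow> T s x) (at s within {0..d})" by (simp add: LIM_zero_iff)
  qed
  have dom: "norm (T s x) \<le> norm x" if x: "x \<in> Domain (generator T)" and s: "s \<in> {0..d}" for x s
  proof -
    have "norm (T s x) \<le> norm (T 0 x)"
    proof (rule nonincreasing_of_right_derivative[where g = "\<lambda>t. norm (T t x)" and a = 0 and b = s])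
      show "continuous_on {0..s} (\<lambda>t. norm (T t x))"
        using s by (intro continuous_on_norm continuous_on_subset[OF cont]) auto
      fix t e :: real assume t: "0 \<le> t" "t < s" and e: "e > 0"
      define y where "y = T t x"
      have "y \<in> Domain (generator T)" using x generator_invariant[OF T _ t(1)] by (auto simp: y_def)
      then obtain a b where ab: "(y, a) \<in> generator P" "(y, b) \<in> generator Q" "(y, a + b) \<in> generator T"
        unfolding gen operator_sum_def by blast
      have qb: "((\<lambda>h. (Q h y - y) /\<^sub>R h) \<longlongrightarrow> - b) (at_right 0)"
        and pa: "((\<lambda>h. (P h y - y) /\<^sub>R h) \<longlongrightarrow> - a) (at_right 0)"
        and tc: "((\<lambda>h. (T h y - y) /\<^sub>R h) \<longlongrightarrow> - (a + b)) (at_right 0)"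
        using ab by (auto simp: generator_def)
      \<comment> \<open>\<open>P h (Q h y) - y\<close> is the sum of \<open>P h (Q h y - y)\<close>
        and \<open>P h y - y\<close>, so its quotient tends to \<open>- (a + b)\<close>, as does
        that of \<open>T\<close>.\<close>
      have "((\<lambda>h. P h ((Q h y - y) /\<^sub>R h)) \<longlongrightarrow> P 0 (- b)) (at_right 0)"
        by (rule P.tendsto_compose[OF _ qb]) (auto intro: eventually_at_right_less[of 0, THEN eventually_mono])
      hence "((\<lambda>h. (T h y - y) /\<^sub>R h - (P h ((Q h y - y) /\<^sub>R h) + (P h y - y) /\<^sub>R h))
          \<longlongrightarrow> - (a + b) - (P 0 (- b) + - a)) (at_right 0)"
        by (intro tendsto_diff tendsto_add tc pa)
      hence "((\<lambda>h. (T h y - P h (Q h y)) /\<^sub>R h) \<longlongrightarrow> 0) (at_right 0)"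
        by (simp add: P.zero blinfun.bilinear_simps flip: scaleR_diff_right scaleR_add_right)
      hence "\<forall>\<^sub>F h in at_right 0. norm ((T h y - P h (Q h y)) /\<^sub>R h) < e"
        using e by (auto dest!: tendstoD simp: dist_norm)
      thus "\<forall>\<^sub>F h in at_right 0. norm (T (t + h) x) \<le> norm (T t x) + e * h"
        using eventually_at_right_less[of 0]
      proof eventually_elim
        case (elim h)
        have "norm (T h y) \<le> norm (P h (Q h y)) + norm (T h y - P h (Q h y))"
          using norm_triangle_sub by blast
        moreover have "norm (P h (Q h y)) \<le> norm y"
          using P.norm_le[of h "Q h y"] Q.norm_le[of h y] elim by simp
        moreover have "norm (T h y - P h (Q h y)) \<le> e * h" using elim by (simp add: divide_simps mult.commute)
        moreover have "T (t + h) x = T h y"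
          using C0_semigroup_add[OF T, of h t x] elim t by (simp add: y_def add.commute)
        ultimately show ?case by (simp add: y_def)
      qed
    qed (use s in auto)
    thus ?thesis using T by (simp add: C0_semigroup_def)
  qed
  have small: "norm (T s x) \<le> norm x" if "s \<in> {0..d}" for s x
    using dense_bound_extends[OF dense, of "T s" 1] dom[OF _ that] by simp
  \<comment> \<open>The short-time bound is iterated; an arbitrary t is n copies of t / n, with n so
    large that t / n is at most d.\<close>
  have "norm (T (real n * s) x) \<le> norm x" if s: "s \<in> {0..d}" for n s x
  proof (induction n)
    case 0 thus ?case using small[of 0] d by simp
  next
    case (Suc n)
    have "T (real (Suc n) * s) x = T s (T (real n * s) x)"
      using C0_semigroup_add[OF T, of s "real n * s" x] s by (simp add: algebra_simps)
    thus ?case using small[OF s] Suc.IH by (metis order_trans)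
  qed
  hence "norm (T t x) \<le> norm x" if t: "t \<ge> 0" for t x
  proof -
    obtain n :: nat where n: "t / d < real n" using reals_Archimedean2 by blast
    have n0: "real n > 0" using n t d by (smt (verit) divide_nonneg_pos)
    hence "t / real n \<in> {0..d}" using n t d by (simp add: field_simps)
    from \<open>\<And>s n x. s \<in> {0..d} \<Longrightarrow> norm (T (real n * s) x) \<le> norm x\<close>[OF this, of n x]
    show ?thesis using n0 by simp
  qed
  hence "norm (T t) \<le> 1" if "t \<ge> 0" for t using that by (intro norm_blinfun_bound) auto
  thus ?thesis using T by (simp add: contraction_semigroup_def)
qed

section \<open>Smoothing by the holomorphic semigroup\<close>

text \<open>With t = tan (\<theta> / 2), this \<open>r\<close> satisfies r / (1 - r) = t / (2 + t) <
  t, so the disc stays below the slope t. Its radius is proportional to \<open>s\<close>, which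
  later produces the factor 1 / s.\<close>

lemma cball_subset_sector:
  assumes \<theta>: "0 < \<theta>" "\<theta> \<le> pi / 2" and s: "s > 0"
    and r: "r = tan (\<theta> / 2) / (2 * (1 + tan (\<theta> / 2)))"
  shows "cball (of_real s) (r * s) \<subseteq> sector (\<theta> / 2)" and "r > 0"
proof -
  define t where "t = tan (\<theta> / 2)"
  have t: "t > 0" unfolding t_def using \<theta> by (intro tan_gt_zero) auto
  have rt: "r = t / (2 * (1 + t))" using r by (simp add: t_def)
  show r0: "r > 0" using t by (simp add: rt)
  have r1: "r < 1" using t by (simp add: rt field_simps)
  have "1 - r = (2 + t) / (2 * (1 + t))" using t by (simp add: rt field_simps)
  hence "t * (1 - r) = r * (2 + t)" by (simp add: rt)
  also have "\<dots> > r" using mult_pos_pos[OF r0 t] r0 by (simp add: algebra_simps)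
  finally have r2: "r < t * (1 - r)" .
  show "cball (of_real s) (r * s) \<subseteq> sector (\<theta> / 2)"
  proof
    fix z assume "z \<in> cball (complex_of_real s) (r * s)"
    hence n: "norm (z - of_real s) \<le> r * s" by (simp add: dist_norm norm_minus_commute)
    have im: "\<bar>Im z\<bar> \<le> r * s" using abs_Im_le_cmod[of "z - of_real s"] n by simp
    have "\<bar>Re z - s\<bar> \<le> r * s" using abs_Re_le_cmod[of "z - of_real s"] n by simp
    hence re: "Re z \<ge> s * (1 - r)" by (simp add: algebra_simps abs_le_iff)
    have re0: "Re z > 0" using re mult_pos_pos[of s "1 - r"] s r1 by linarith
    have "r * s < t * (s * (1 - r))" using r2 s by (simp add: mult.left_commute)
    also have "\<dots> \<le> t * Re z" using re t by (intro mult_left_mono) auto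
    finally have "\<bar>Im z / Re z\<bar> < t" using im re0 by (simp add: field_simps)
    hence "Im z / Re z < t" "- t < Im z / Re z" by linarith+
    hence "\<bar>arctan (Im z / Re z)\<bar> < arctan t"
      using arctan_less_iff[of "Im z / Re z" t] arctan_less_iff[of "- t" "Im z / Re z"]
      by (simp add: arctan_minus abs_less_iff minus_less_iff)
    also have "arctan t = \<theta> / 2" unfolding t_def using \<theta> by (intro arctan_tan) auto
    finally show "z \<in> sector (\<theta> / 2)" using re0 by (auto simp: sector_def arg_conv_arctan)
  qed
qed

text \<open>The Cauchy inequality is applied to scalar functions \<open>z \<mapsto> f (U z x)\<close> on discs
  around \<open>s\<close> with radius proportional to \<open>s\<close>.\<close>

lemma holomorphic_semigroup_smoothing:
  assumes \<theta>: "0 < \<theta>" "\<theta> \<le> pi / 2" and U: "holomorphic_contraction_semigroup \<theta> U"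
  shows "\<exists>K\<ge>0. \<forall>s>0. \<forall>x. \<exists>y. (U (of_real s) x, y) \<in> generator (\<lambda>t. U (of_real t)) \<and> norm y \<le> K / s * norm x"
proof -
  have hol: "bounded_holomorphic_semigroup \<theta> U" and con: "contraction_semigroup (\<lambda>t. U (of_real t))"
    using U by (auto simp: holomorphic_contraction_semigroup_def)
  interpret contractions "\<lambda>t. U (of_real t)" by standard (rule con)
  obtain M0 where M0: "\<And>z. z \<in> sector (\<theta> - \<theta> / 2) \<Longrightarrow> norm (U z) \<le> M0"
    using hol \<theta> unfolding bounded_holomorphic_semigroup_def by (metis half_gt_zero field_sum_of_halves less_add_same_cancel1)
  define M where "M = max M0 0"
  have M: "norm (U z) \<le> M" if "z \<in> sector (\<theta> / 2)" for z
    using M0[of z] that by (simp add: M_def)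
  have M_nn: "M \<ge> 0" by (simp add: M_def)
  have sub: "sector (\<theta> / 2) \<subseteq> sector \<theta>" using \<theta> by (auto simp: sector_def)
  define r where "r = tan (\<theta> / 2) / (2 * (1 + tan (\<theta> / 2)))"
  note ball = cball_subset_sector[OF \<theta> _ r_def]
  have r0: "r > 0" using ball(2)[of 1] by simp
  have "\<exists>y. (U (of_real s) x, y) \<in> generator (\<lambda>t. U (of_real t)) \<and> norm y \<le> (M / r) / s * norm x"
    if s: "s > 0" for s x
  proof -
    have s_in: "of_real s \<in> sector \<theta>" using ball(1)[OF s] sub s r0 by (auto simp: subset_iff)
    obtain D where D: "(U has_derivative D) (at (of_real s))" "\<And>h x. D h x = h *\<^sub>C D 1 x"
      using hol s_in unfolding bounded_holomorphic_semigroup_def by blast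
    have "((\<lambda>h. U (of_real (s + h)) x) has_derivative (\<lambda>h. D (of_real h) x)) (at 0)"
    proof -
      have "((\<lambda>h. complex_of_real (s + h)) has_derivative of_real) (at 0)"
        by (auto intro!: derivative_eq_intros)
      from has_derivative_compose[OF this, of U D] D(1)
      have "((\<lambda>h. U (of_real (s + h))) has_derivative (\<lambda>h. D (of_real h))) (at 0)" by simp
      thus ?thesis by (rule bounded_linear.has_derivative[OF blinfun.bounded_linear_left])
    qed
    hence "((\<lambda>h. U (of_real (s + h)) x) has_vector_derivative D 1 x) (at 0)"
      by (simp add: has_vector_derivative_def D(2)[of "of_real _"] scaleR_scaleC)
    hence "((\<lambda>h. (U (of_real (s + h)) x - U (of_real s) x) /\<^sub>R h) \<longlongrightarrow> D 1 x) (at_right 0)"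
      by (auto simp: has_vector_derivative_iff_quotient intro: filterlim_mono at_le)
    moreover have "\<forall>\<^sub>F h in at_right 0. (U (of_real (s + h)) x - U (of_real s) x) /\<^sub>R h
        = (U (of_real h) (U (of_real s) x) - U (of_real s) x) /\<^sub>R h"
      using eventually_at_right_less[of 0]
      by eventually_elim (use add[of _ s x] s in \<open>simp add: add.commute\<close>)
    ultimately have "((\<lambda>h. (U (of_real h) (U (of_real s) x) - U (of_real s) x) /\<^sub>R h) \<longlongrightarrow> D 1 x) (at_right 0)"
      by (rule Lim_transform_eventually)
    \<comment> \<open>The derivative at \<open>s\<close> along real increments is the right
      derivative at 0 of the orbit of \<open>U (of_real s) x\<close>.\<close>
    hence gen: "(U (of_real s) x, - D 1 x) \<in> generator (\<lambda>t. U (of_real t))" by (simp add: generator_def)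
    have "norm (D 1 x) \<le> (M / r) / s * norm x"
    proof (rule norm_le_by_dual)
      fix f :: "'a \<Rightarrow>\<^sub>L complex" assume f: "f \<in> dual_space" "norm f \<le> 1"
      have fC: "f (c *\<^sub>C y) = c * f y" for c y
        using f(1) by (simp add: dual_space_def complex_linear_def scaleC_complex_def)
      define \<phi> where "\<phi> z = f (U z x)" for z
      have der: "(\<phi> has_field_derivative f (D' 1 x)) (at z)"
        if "(U has_derivative D') (at z)" "\<And>h x. D' h x = h *\<^sub>C D' 1 x" for z D'
      proof -
        have "(\<phi> has_derivative (\<lambda>h. f (D' h x))) (at z)" unfolding \<phi>_def
          by (intro bounded_linear.has_derivative[OF blinfun.bounded_linear_right]
              bounded_linear.has_derivative[OF blinfun.bounded_linear_left] that(1))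
        moreover have "(\<lambda>h. f (D' h x)) = (*) (f (D' 1 x))"
          by (rule ext) (subst that(2), simp add: fC mult.commute)
        ultimately show ?thesis by (simp add: has_field_derivative_def)
      qed
      have diff: "\<phi> field_differentiable (at z)" if "z \<in> sector \<theta>" for z
      proof -
        obtain D' where "(U has_derivative D') (at z)" "\<And>h x. D' h x = h *\<^sub>C D' 1 x"
          using hol \<open>z \<in> sector \<theta>\<close> unfolding bounded_holomorphic_semigroup_def by blast
        from der[OF this] show ?thesis by (auto simp: field_differentiable_def)
      qed
      have sub': "cball (of_real s) (r * s) \<subseteq> sector \<theta>" using ball(1)[OF s] sub by blast
      have hol\<phi>: "\<phi> holomorphic_on cball (of_real s) (r * s)"
        using diff sub' by (auto simp: holomorphic_on_def intro: field_differentiable_at_within)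
      have "norm ((deriv ^^ 1) \<phi> (of_real s)) \<le> fact 1 * (M * norm x) / (r * s) ^ 1"
      proof (rule Cauchy_inequality)
        show "\<phi> holomorphic_on ball (of_real s) (r * s)"
          by (rule holomorphic_on_subset[OF hol\<phi>]) auto
        show "continuous_on (cball (of_real s) (r * s)) \<phi>"
          by (rule holomorphic_on_imp_continuous_on[OF hol\<phi>])
        fix z :: complex assume "norm (of_real s - z) = r * s"
        hence "z \<in> sector (\<theta> / 2)" using ball(1)[OF s] by (auto simp: dist_norm)
        hence Mz: "norm (U z) \<le> M" by (rule M)
        have "norm (\<phi> z) \<le> norm f * norm (U z x)" unfolding \<phi>_def by (rule norm_blinfun)
        also have "\<dots> \<le> 1 * (norm (U z) * norm x)" by (intro mult_mono f(2) norm_blinfun) auto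
        also have "\<dots> \<le> M * norm x" using Mz by (simp add: mult_right_mono)
        finally show "norm (\<phi> z) \<le> M * norm x" .
      qed (use r0 s in simp)
      moreover have "deriv \<phi> (of_real s) = f (D 1 x)" by (rule DERIV_imp_deriv[OF der[OF D]])
      ultimately show "norm (f (D 1 x)) \<le> (M / r) / s * norm x" by (simp add: field_simps)
    qed
    thus ?thesis using gen by (intro exI[of _ "- D 1 x"]) simp
  qed
  moreover have "M / r \<ge> 0" using M_nn r0 by simp
  ultimately show ?thesis by blast
qed

section \<open>The dual domain condition\<close>

text \<open>Envelope for the fractional-power integrand: for small l the orbit increment is at most
  K l / s, for large l at most 2. Splitting at l = s makes both parts scale like
  \<open>s powr (- \<alpha>)\<close>.\<close>

lemma has_integral_powr_min:
  fixes \<alpha> K s :: real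
  assumes \<alpha>: "0 < \<alpha>" "\<alpha> < 1" and s: "s > 0"
  shows "((\<lambda>l. if l \<le> s then K / s * l powr (- \<alpha>) else 2 * l powr (- \<alpha> - 1)) has_integral
      (K / (1 - \<alpha>) + 2 / \<alpha>) * s powr (- \<alpha>)) {0<..}"
proof -
  let ?h = "\<lambda>l. if l \<le> s then K / s * l powr (- \<alpha>) else 2 * l powr (- \<alpha> - 1)"
  have "((\<lambda>l. K / s * l powr (- \<alpha>)) has_integral K / s * (s powr (- \<alpha> + 1) / (- \<alpha> + 1))) {0..s}"
    using \<alpha> s by (intro has_integral_mult_right has_integral_powr_from_0) auto
  also have "K / s * (s powr (- \<alpha> + 1) / (- \<alpha> + 1)) = K / (1 - \<alpha>) * s powr (- \<alpha>)"
  proof -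
    have "s powr (- \<alpha> + 1) = s powr (- \<alpha>) * s" using s by (subst powr_add) simp
    thus ?thesis using s by simp
  qed
  finally have 1: "(?h has_integral K / (1 - \<alpha>) * s powr (- \<alpha>)) {0..s}"
    by (rule has_integral_eq[rotated]) auto
  have "((\<lambda>l. 2 * l powr (- \<alpha> - 1)) has_integral 2 * (- (s powr (- \<alpha> - 1 + 1)) / (- \<alpha> - 1 + 1))) {s..}"
    using \<alpha> s by (intro has_integral_mult_right has_integral_powr_to_inf) auto
  hence "((\<lambda>l. 2 * l powr (- \<alpha> - 1)) has_integral 2 / \<alpha> * s powr (- \<alpha>)) {s..}" by simp
  hence 2: "(?h has_integral 2 / \<alpha> * s powr (- \<alpha>)) {s..}"
    by (rule has_integral_spike[of "{s}", rotated 2]) auto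
  have "(?h has_integral K / (1 - \<alpha>) * s powr (- \<alpha>) + 2 / \<alpha> * s powr (- \<alpha>)) ({0..s} \<union> {s..})"
  proof (rule has_integral_Un[OF 1 2])
    have "{0..s} \<inter> {s..} = {s}" using s by auto
    thus "negligible ({0..s} \<inter> {s..})" by simp
  qed
  also have "{0..s} \<union> {s..} = {0..}" using s by auto
  finally have "(?h has_integral (K / (1 - \<alpha>) + 2 / \<alpha>) * s powr (- \<alpha>)) {0..}"
    by (simp add: algebra_simps)
  moreover have "({0..} - {0<..}) \<union> ({0<..} - {0..}) = {0 :: real}" by auto
  ultimately show ?thesis
    by (subst has_integral_spike_set_eq[of "{0<..}" "{0..}"]) (auto intro: negligible_subset[of "{0}"])
qed

text \<open>On functionals, \<open>P s\<close> maps into the domain of the adjoint of the fractional power, because the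
  vector-valued integral only has to be evaluated against a functional, where it becomes a scalar
  integral that converges absolutely for every \<open>x\<close>.\<close>

lemma functional_in_adjoint_fractional_power:
  fixes P :: "real \<Rightarrow> ('a::complex_banach \<Rightarrow>\<^sub>L 'a)"
  assumes P: "contraction_semigroup P" and \<alpha>: "0 \<le> \<alpha>" "\<alpha> < 1" and K: "K \<ge> 0"
    and smooth: "\<And>s x. s > 0 \<Longrightarrow> \<exists>y. (P s x, y) \<in> generator P \<and> norm y \<le> K / s * norm x"
  shows "\<exists>C\<ge>0. \<forall>s>0. \<forall>f\<in>dual_space. \<exists>g. (f o\<^sub>L P s, g) \<in> adjoint_operator (fractional_power P \<alpha>) \<and>
    norm g \<le> C * s powr (- \<alpha>) * norm f"
proof -
  interpret contractions P by standard (rule P)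
  have lin: "complex_linear (P s)" if "s \<ge> 0" for s using C0 that by (simp add: C0_semigroup_def)
  have fP: "f o\<^sub>L P s \<in> dual_space" if "f \<in> dual_space" "s > 0" for f :: "'a \<Rightarrow>\<^sub>L complex" and s
    using that lin[of s] by (simp add: dual_space_def complex_linear_def)
  have fPn: "norm (f o\<^sub>L P s) \<le> norm f" if "s > 0" for f :: "'a \<Rightarrow>\<^sub>L complex" and s
  proof (rule norm_blinfun_bound)
    fix x
    have "norm (f (P s x)) \<le> norm f * norm (P s x)" by (rule norm_blinfun)
    also have "\<dots> \<le> norm f * norm x" using norm_le[of s x] that by (intro mult_left_mono) auto
    finally show "norm ((f o\<^sub>L P s) x) \<le> norm f * norm x" by simp
  qed simp
  show ?thesis
  proof (cases "\<alpha> = 0")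
    case True
    have "(f o\<^sub>L P s, f o\<^sub>L P s) \<in> adjoint_operator (fractional_power P \<alpha>) \<and>
      norm (f o\<^sub>L P s) \<le> 1 * s powr (- \<alpha>) * norm f" if "s > 0" "f \<in> dual_space" for s f
      using fP[OF that(2,1)] fPn[OF that(1), of f] that True
      by (auto simp: adjoint_operator_def fractional_power_def)
    thus ?thesis by (intro exI[of _ 1]) (use zero_le_one in blast)
  next
    case False
    hence \<alpha>0: "\<alpha> > 0" using \<alpha> by simp
    define c where "c = 1 / Gamma (- \<alpha>)"
    define C where "C = \<bar>c\<bar> * (K / (1 - \<alpha>) + 2 / \<alpha>)"
    have C: "C \<ge> 0" using K \<alpha> \<alpha>0 by (simp add: C_def)
    have "\<exists>g. (f o\<^sub>L P s, g) \<in> adjoint_operator (fractional_power P \<alpha>) \<and>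
      norm g \<le> C * s powr (- \<alpha>) * norm f" if s: "s > 0" and f: "f \<in> dual_space" for s f
    proof -
      have fC: "f (a *\<^sub>C y) = a * f y" for a y
        using f by (simp add: dual_space_def complex_linear_def scaleC_complex_def)
      have PC: "P t (a *\<^sub>C y) = a *\<^sub>C P t y" if "t \<ge> 0" for t a y
        using lin[OF that] by (simp add: complex_linear_def)
      \<comment> \<open>Formally the integral is, up to the factor \<open>c\<close>, the functional
        \<open>f\<close> at the fractional power of \<open>P s x\<close>; smoothing by
        \<open>P s\<close> makes the singularity at l = 0 integrable for every
        \<open>x\<close>.\<close>
      define k where "k x l = l powr (- \<alpha> - 1) *\<^sub>R f (P (l + s) x - P s x)" for x l
      define h where "h l = (if l \<le> s then K / s * l powr (- \<alpha>) else 2 * l powr (- \<alpha> - 1))" for l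
      have hint: "((\<lambda>l. norm f * norm x * h l) has_integral
          norm f * norm x * ((K / (1 - \<alpha>) + 2 / \<alpha>) * s powr (- \<alpha>))) {0<..}" for x :: 'a
        unfolding h_def by (intro has_integral_mult_right has_integral_powr_min \<alpha>0 \<alpha> s)
      have kh: "norm (k x l) \<le> norm f * norm x * h l" if l: "l > 0" for x l
      proof -
        obtain y where y: "(P s x, y) \<in> generator P" "norm y \<le> K / s * norm x"
          using smooth[OF s] by blast
        have "P (l + s) x = P l (P s x)" using add l s by simp
        hence "norm (P (l + s) x - P s x) \<le> l * norm y" using orbit_lipschitz[OF y(1)] l by simp
        also have "\<dots> \<le> l * (K / s * norm x)" using y(2) l by (intro mult_left_mono) auto
        finally have 1: "norm (P (l + s) x - P s x) \<le> K / s * l * norm x" by (simp add: mult_ac)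
        have "norm (P (l + s) x - P s x) \<le> norm (P (l + s) x) + norm (P s x)" by (rule norm_triangle_ineq4)
        hence 2: "norm (P (l + s) x - P s x) \<le> 2 * norm x"
          using norm_le[of "l + s" x] norm_le[of s x] l s by simp
        have "l powr (- \<alpha> - 1) * norm (P (l + s) x - P s x) \<le> norm x * h l"
        proof (cases "l \<le> s")
          case True
          have "l powr (- \<alpha> - 1) * norm (P (l + s) x - P s x) \<le> l powr (- \<alpha> - 1) * (K / s * l * norm x)"
            by (intro mult_left_mono 1) auto
          also have "\<dots> = norm x * (K / s * (l powr (- \<alpha> - 1) * l powr 1))" using l by (simp add: mult_ac)
          also have "l powr (- \<alpha> - 1) * l powr 1 = l powr (- \<alpha>)" by (subst powr_add[symmetric]) simp
          finally show ?thesis using True by (simp add: h_def)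
        next
          case False
          have "l powr (- \<alpha> - 1) * norm (P (l + s) x - P s x) \<le> l powr (- \<alpha> - 1) * (2 * norm x)"
            by (intro mult_left_mono 2) auto
          thus ?thesis using False by (simp add: h_def mult_ac)
        qed
        moreover have "norm (k x l) \<le> norm f * (l powr (- \<alpha> - 1) * norm (P (l + s) x - P s x))"
          using mult_left_mono[OF norm_blinfun[of f "P (l + s) x - P s x"], of "l powr (- \<alpha> - 1)"]
          by (simp add: k_def mult_ac)
        ultimately show ?thesis
          using mult_left_mono[of "l powr (- \<alpha> - 1) * norm (P (l + s) x - P s x)" "norm x * h l" "norm f"]
          by (simp add: mult.assoc)
      qed
      have kmeas: "k x \<in> borel_measurable (lebesgue_on {0<..})" for x
      proof (rule continuous_imp_measurable_on_sets_lebesgue)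
        have 1: "continuous_on {0<..} (\<lambda>l. l powr (- \<alpha> - 1))" by (intro continuous_intros) auto
        have "continuous_on {0<..} (\<lambda>l. P (l + s) x)"
          using s by (intro continuous_compose continuous_intros) auto
        hence 2: "continuous_on {0<..} (\<lambda>l. P (l + s) x - P s x)"
          by (rule continuous_on_diff[OF _ continuous_on_const])
        show "continuous_on {0<..} (k x)" unfolding k_def
          by (rule continuous_on_scaleR[OF 1 blinfun.continuous_on[OF continuous_on_const 2]])
      qed auto
      have kint: "k x integrable_on {0<..}" for x
        by (rule measurable_bounded_by_integrable_imp_integrable[OF kmeas has_integral_integrable[OF hint[of x]]])
           (use kh in auto)
      have kbound: "norm (integral {0<..} (k x)) \<le> norm f * norm x * ((K / (1 - \<alpha>) + 2 / \<alpha>) * s powr (- \<alpha>))" for x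
        by (rule integral_norm_bound_integral'[OF _ kmeas _ hint]) (use kh in auto)
      define g where "g x = c *\<^sub>R integral {0<..} (k x)" for x
      have gbound: "norm (g x) \<le> norm x * (C * s powr (- \<alpha>) * norm f)" for x
        using mult_left_mono[OF kbound[of x], of "\<bar>c\<bar>"] by (simp add: g_def C_def mult_ac)
      have gadd: "g (x + y) = g x + g y" for x y
      proof -
        have "k (x + y) = (\<lambda>l. k x l + k y l)"
          by (rule ext) (simp add: k_def blinfun.bilinear_simps algebra_simps)
        thus ?thesis using integral_add[OF kint[of x] kint[of y]] by (simp add: g_def scaleR_add_right)
      qed
      have gC: "g (a *\<^sub>C x) = a * g x" for a x
      proof -
        have "k (a *\<^sub>C x) l = a * k x l" if "l \<in> {0<..}" for l
        proof -
          have "P (l + s) (a *\<^sub>C x) - P s (a *\<^sub>C x) = a *\<^sub>C (P (l + s) x) - a *\<^sub>C P s x"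
            using that s by (simp add: PC)
          hence "f (P (l + s) (a *\<^sub>C x) - P s (a *\<^sub>C x)) = a * f (P (l + s) x - P s x)"
            by (simp add: blinfun.diff_right fC right_diff_distrib)
          thus ?thesis by (simp add: k_def)
        qed
        hence "integral {0<..} (k (a *\<^sub>C x)) = integral {0<..} (\<lambda>l. a * k x l)"
          by (rule Henstock_Kurzweil_Integration.integral_cong)
        also have "\<dots> = a * integral {0<..} (k x)" by (rule integral_mult_right)
        finally show ?thesis by (simp add: g_def)
      qed
      have "bounded_linear g"
        by (rule bounded_linear_intro[OF gadd _ gbound]) (simp add: scaleR_scaleC gC scaleC_complex_def)
      define G where "G = Blinfun g"
      have G: "blinfun_apply G = g" using \<open>bounded_linear g\<close> by (simp add: G_def bounded_linear_Blinfun_apply)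
      have "norm G \<le> C * s powr (- \<alpha>) * norm f"
        using C gbound by (intro norm_blinfun_bound) (auto simp: G mult.commute)
      moreover have "(f o\<^sub>L P s, G) \<in> adjoint_operator (fractional_power P \<alpha>)"
      proof -
        \<comment> \<open>On this core the identity follows by pulling \<open>f\<close> and
          \<open>P s\<close> through the vector integral. It is a closed condition on pairs, hence
          survives the closure.\<close>
        define S where "S = {(x, c *\<^sub>R I) | x I. x \<in> Domain (generator P) \<and>
          ((\<lambda>l. (l powr (- \<alpha> - 1)) *\<^sub>R (P l x - x)) has_integral I) {0<..}}"
        have "S \<subseteq> {p. f (P s (snd p)) = G (fst p)}"
        proof (clarsimp simp: S_def)
          fix x I assume "((\<lambda>l. (l powr (- \<alpha> - 1)) *\<^sub>R (P l x - x)) has_integral I) {0<..}"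
          hence "((f o\<^sub>L P s) \<circ> (\<lambda>l. (l powr (- \<alpha> - 1)) *\<^sub>R (P l x - x)) has_integral (f o\<^sub>L P s) I) {0<..}"
            by (rule has_integral_linear[OF _ blinfun.bounded_linear_right])
          moreover have "((f o\<^sub>L P s) \<circ> (\<lambda>l. (l powr (- \<alpha> - 1)) *\<^sub>R (P l x - x))) l = k x l" if "l \<in> {0<..}" for l
            using that s add[of s l x]
            by (simp add: k_def blinfun.scaleR_right blinfun.diff_right add.commute[of l s])
          ultimately have "(k x has_integral f (P s I)) {0<..}"
            by (subst (asm) has_integral_cong[where g = "k x"]) auto
          thus "f (P s (c *\<^sub>R I)) = G x"
            by (simp add: G g_def integral_unique blinfun.scaleR_right)
        qed
        moreover have "closed {p. f (P s (snd p)) = G (fst p)}"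
          by (intro closed_Collect_eq continuous_intros)
        ultimately have "closure S \<subseteq> {p. f (P s (snd p)) = G (fst p)}" by (rule closure_minimal)
        moreover have "fractional_power P \<alpha> = closure S"
          using False by (simp add: fractional_power_def S_def c_def)
        moreover have "G \<in> dual_space" by (simp add: dual_space_def complex_linear_def scaleC_complex_def G gC)
        ultimately show ?thesis using fP[OF f s] by (auto simp: adjoint_operator_def)
      qed
      ultimately show ?thesis by blast
    qed
    thus ?thesis using C by blast
  qed
qed

lemma adjoint_operator_iff:
  "(f, g) \<in> adjoint_operator A \<longleftrightarrow>
     f \<in> dual_space \<and> g \<in> dual_space \<and> (\<forall>x y. (x, y) \<in> A \<longrightarrow> blinfun_apply f y = g x)"
  by (auto simp: adjoint_operator_def)

text \<open>Makes the graph of an adjoint complete, so that it can be the \<open>W\<close> of the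
  uniform boundedness lemma.\<close>

lemma closed_adjoint_operator: "closed (adjoint_operator A)"
proof -
  have "closed {p :: ('a \<Rightarrow>\<^sub>L complex) \<times> ('a \<Rightarrow>\<^sub>L complex). fst p \<in> dual_space}"
    unfolding dual_space_def complex_linear_def scaleC_complex_def
    by (auto intro!: closed_Collect_all closed_Collect_eq continuous_intros)
  moreover have "closed {p :: ('a \<Rightarrow>\<^sub>L complex) \<times> ('a \<Rightarrow>\<^sub>L complex). snd p \<in> dual_space}"
    unfolding dual_space_def complex_linear_def scaleC_complex_def
    by (auto intro!: closed_Collect_all closed_Collect_eq continuous_intros)
  moreover have "closed (\<Inter>q\<in>A. {p :: ('a \<Rightarrow>\<^sub>L complex) \<times> ('a \<Rightarrow>\<^sub>L complex). blinfun_apply (fst p) (snd q) = blinfun_apply (snd p) (fst q)})"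
    by (intro closed_INT ballI closed_Collect_eq continuous_intros)
  ultimately have "closed ({p. fst p \<in> dual_space} \<inter> {p. snd p \<in> dual_space} \<inter>
      (\<Inter>q\<in>A. {p :: ('a \<Rightarrow>\<^sub>L complex) \<times> ('a \<Rightarrow>\<^sub>L complex). blinfun_apply (fst p) (snd q) = blinfun_apply (snd p) (fst q)}))"
    by (intro closed_Int)
  also have "{p. fst p \<in> dual_space} \<inter> {p. snd p \<in> dual_space} \<inter>
      (\<Inter>q\<in>A. {p :: ('a \<Rightarrow>\<^sub>L complex) \<times> ('a \<Rightarrow>\<^sub>L complex). blinfun_apply (fst p) (snd q) = blinfun_apply (snd p) (fst q)}) = adjoint_operator A"
    by (force simp: adjoint_operator_iff)
  finally show ?thesis .
qed

lemma subspace_adjoint_operator: "subspace (adjoint_operator A)"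
  unfolding subspace_def
  by (auto simp: adjoint_operator_iff dual_space_def complex_linear_def scaleC_complex_def
      zero_prod_def blinfun.bilinear_simps algebra_simps)

text \<open>The domain inclusion says that each functional in the first component of the graph is
  bounded on the vectors y with (x, y) in the generator of \<open>Q\<close> and norm x at most 1.
  Uniform boundedness on that graph gives a bound by the graph norm, which is evaluated at
  \<open>f o\<^sub>L P s\<close>.\<close>

lemma smoothing_after_generator:
  fixes P Q :: "real \<Rightarrow> ('a::complex_banach \<Rightarrow>\<^sub>L 'a)"
  assumes P: "contraction_semigroup P" and \<alpha>: "0 \<le> \<alpha>" "\<alpha> < 1" and K: "K \<ge> 0"
    and smooth: "\<And>s x. s > 0 \<Longrightarrow> \<exists>y. (P s x, y) \<in> generator P \<and> norm y \<le> K / s * norm x"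
    and dom: "Domain (adjoint_operator (fractional_power P \<alpha>)) \<subseteq> Domain (adjoint_operator (generator Q))"
  shows "\<exists>C\<ge>0. \<forall>s>0. \<forall>(x, y)\<in>generator Q. norm (P s y) \<le> C * (s powr (- \<alpha>) + 1) * norm x"
proof -
  interpret contractions P by standard (rule P)
  obtain C1 where C1: "C1 \<ge> 0" and adj: "\<And>s f. s > 0 \<Longrightarrow> f \<in> dual_space \<Longrightarrow>
      \<exists>g. (f o\<^sub>L P s, g) \<in> adjoint_operator (fractional_power P \<alpha>) \<and> norm g \<le> C1 * s powr (- \<alpha>) * norm f"
    using functional_in_adjoint_fractional_power[OF P \<alpha> K smooth] by blast
  let ?W = "adjoint_operator (fractional_power P \<alpha>)"
  have "\<exists>C\<ge>0. \<forall>q\<in>{q\<in>generator Q. norm (fst q) \<le> 1}. \<forall>w\<in>?W. norm (blinfun_apply (fst w) (snd q)) \<le> C * norm w"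
  proof (rule uniform_boundedness_on_subspace)
    fix q :: "'a \<times> 'a"
    show "continuous_on UNIV (\<lambda>w :: ('a \<Rightarrow>\<^sub>L complex) \<times> ('a \<Rightarrow>\<^sub>L complex). norm (blinfun_apply (fst w) (snd q)))"
      by (intro continuous_intros)
    show "sublinear (\<lambda>w :: ('a \<Rightarrow>\<^sub>L complex) \<times> ('a \<Rightarrow>\<^sub>L complex). norm (blinfun_apply (fst w) (snd q)))"
      by (auto simp: sublinear_def blinfun.add_left blinfun.scaleR_left norm_triangle_ineq)
  next
    fix w assume "w \<in> ?W"
    hence "fst w \<in> Domain ?W" by (metis DomainI prod.collapse)
    then obtain h where h: "(fst w, h) \<in> adjoint_operator (generator Q)" using dom by blast
    have "norm (blinfun_apply (fst w) (snd q)) \<le> norm h" if "q \<in> generator Q" "norm (fst q) \<le> 1" for q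
    proof -
      have "blinfun_apply (fst w) (snd q) = h (fst q)" using h that(1) by (auto simp: adjoint_operator_def)
      moreover have "norm (h (fst q)) \<le> norm h * norm (fst q)" by (rule norm_blinfun)
      moreover have "\<dots> \<le> norm h * 1" using that by (intro mult_left_mono) auto
      ultimately show ?thesis by simp
    qed
    thus "\<exists>c. \<forall>q\<in>{q\<in>generator Q. norm (fst q) \<le> 1}. norm (blinfun_apply (fst w) (snd q)) \<le> c" by blast
  qed (simp_all add: closed_adjoint_operator subspace_adjoint_operator)
  then obtain C2 where C2: "C2 \<ge> 0" and bd: "\<And>x y w. (x, y) \<in> generator Q \<Longrightarrow> norm x \<le> 1 \<Longrightarrow> w \<in> ?W \<Longrightarrow>
      norm (blinfun_apply (fst w) y) \<le> C2 * norm w" by fastforce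
  define C where "C = C2 * (1 + C1)"
  have C: "C \<ge> 0" using C1 C2 by (simp add: C_def)
  have unit: "norm (P s y) \<le> C * (s powr (- \<alpha>) + 1)" if s: "s > 0" and xy: "(x, y) \<in> generator Q" "norm x \<le> 1" for s x y
  proof (rule norm_le_by_dual)
    fix f :: "'a \<Rightarrow>\<^sub>L complex" assume f: "f \<in> dual_space" "norm f \<le> 1"
    obtain g where g: "(f o\<^sub>L P s, g) \<in> ?W" "norm g \<le> C1 * s powr (- \<alpha>) * norm f"
      using adj[OF s f(1)] by blast
    have "norm (f o\<^sub>L P s) \<le> norm f * norm (P s)" by (rule norm_blinfun_compose)
    also have "\<dots> \<le> 1 * 1"
      using P s f by (intro mult_mono) (auto simp: contraction_semigroup_def)
    finally have n1: "norm (f o\<^sub>L P s) \<le> 1" by simp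
    have n2: "norm g \<le> C1 * s powr (- \<alpha>)"
      using g(2) mult_left_mono[OF f(2), of "C1 * s powr (- \<alpha>)"] C1 by simp
    have "norm (f (P s y)) \<le> C2 * norm (f o\<^sub>L P s, g)" using bd[OF xy g(1)] by simp
    also have "\<dots> \<le> C2 * (1 + C1 * s powr (- \<alpha>))"
      using C2 norm_Pair_le_add[of "f o\<^sub>L P s" g] n1 n2 by (intro mult_left_mono) auto
    also have "\<dots> \<le> C2 * ((1 + C1) * (s powr (- \<alpha>) + 1))"
      using C1 C2 by (intro mult_left_mono) (auto simp: algebra_simps)
    finally show "norm (f (P s y)) \<le> C * (s powr (- \<alpha>) + 1)" by (simp add: C_def mult_ac)
  qed
  have "norm (P s y) \<le> C * (s powr (- \<alpha>) + 1) * norm x" if s: "s > 0" and xy: "(x, y) \<in> generator Q" for s x y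
  proof (cases "x = 0")
    case True
    hence "y = 0" using generator_unique[OF _ generator_zero] xy by blast
    thus ?thesis using True by simp
  next
    case False
    have "(inverse (norm x) *\<^sub>R x, inverse (norm x) *\<^sub>R y) \<in> generator Q" by (rule generator_scaleR[OF xy])
    from unit[OF s this] have "inverse (norm x) * norm (P s y) \<le> C * (s powr (- \<alpha>) + 1)"
      using False by (simp add: blinfun.scaleR_right)
    thus ?thesis using False by (simp add: field_simps)
  qed
  thus ?thesis using C by blast
qed

section \<open>Convolution estimates\<close>

text \<open>On each half of the interval the kernel away from its singularity is frozen at s / 2 and
  the other one enters through its primitive, so monotone kernels suffice and no beta integral
  appears.\<close>

lemma derivative_convolution_bound:
  fixes f :: "real \<Rightarrow> 'a::real_normed_vector"
  assumes s: "s > 0" and f: "continuous_on {0..s} f"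
    and f': "\<And>r. 0 < r \<Longrightarrow> r < s \<Longrightarrow> (f has_vector_derivative f' r) (at r)"
    and bound: "\<And>r. 0 < r \<Longrightarrow> r < s \<Longrightarrow> norm (f' r) \<le> p (s - r) * q r"
    and p: "\<And>r. 0 < r \<Longrightarrow> r < s \<Longrightarrow> (p' has_real_derivative p r) (at r)" "continuous_on {0..s} p'"
    and q: "\<And>r. 0 < r \<Longrightarrow> r < s \<Longrightarrow> (q' has_real_derivative q r) (at r)" "continuous_on {0..s} q'"
    and mono: "antimono_on {0<..<s} p" "antimono_on {0<..<s} q"
    and nonneg: "\<And>r. 0 < r \<Longrightarrow> r < s \<Longrightarrow> 0 \<le> p r" "\<And>r. 0 < r \<Longrightarrow> r < s \<Longrightarrow> 0 \<le> q r"
  shows "norm (f s - f 0) \<le> p (s / 2) * (q' (s / 2) - q' 0) + q (s / 2) * (p' (s / 2) - p' 0)"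
proof -
  have "norm (f (s / 2) - f 0) \<le> p (s / 2) * q' (s / 2) - p (s / 2) * q' 0"
  proof (rule differentiable_bound_general[where f' = f' and \<phi>' = "\<lambda>r. p (s / 2) * q r"])
    show "continuous_on {0..s / 2} f" "continuous_on {0..s / 2} (\<lambda>r. p (s / 2) * q' r)"
      using s by (auto intro!: continuous_intros continuous_on_subset[OF f] continuous_on_subset[OF q(2)])
    fix r assume r: "0 < r" "r < s / 2"
    show "(f has_vector_derivative f' r) (at r)" using f' r by simp
    show "((\<lambda>r. p (s / 2) * q' r) has_vector_derivative p (s / 2) * q r) (at r)"
      using DERIV_cmult[OF q(1)[of r]] r by (simp add: has_real_derivative_iff_has_vector_derivative)
    have "norm (f' r) \<le> p (s - r) * q r" using bound r by simp
    also have "\<dots> \<le> p (s / 2) * q r"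
      using r s nonneg monotone_onD[OF mono(1), of "s / 2" "s - r"] by (intro mult_right_mono) auto
    finally show "norm (f' r) \<le> p (s / 2) * q r" .
  qed (use s in simp)
  moreover have "norm (f s - f (s / 2)) \<le> - (q (s / 2) * p' (s - s)) - - (q (s / 2) * p' (s - s / 2))"
  proof (rule differentiable_bound_general[where f' = f' and \<phi> = "\<lambda>r. - (q (s / 2) * p' (s - r))"
        and \<phi>' = "\<lambda>r. q (s / 2) * p (s - r)"])
    show "continuous_on {s / 2..s} f" using s by (auto intro: continuous_on_subset[OF f])
    show "continuous_on {s / 2..s} (\<lambda>r. - (q (s / 2) * p' (s - r)))"
      using s by (intro continuous_on_minus continuous_on_mult_left continuous_on_compose2[OF p(2)])
        (auto intro!: continuous_intros)
    fix r assume r: "s / 2 < r" "r < s"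
    show "(f has_vector_derivative f' r) (at r)" using f' r s by simp
    have "((\<lambda>r. - (q (s / 2) * p' (s - r))) has_real_derivative - (q (s / 2) * (p (s - r) * (0 - 1)))) (at r)"
      using r s by (intro DERIV_minus DERIV_cmult DERIV_chain2[OF p(1)] DERIV_diff DERIV_const DERIV_ident) auto
    thus "((\<lambda>r. - (q (s / 2) * p' (s - r))) has_vector_derivative q (s / 2) * p (s - r)) (at r)"
      by (simp add: has_real_derivative_iff_has_vector_derivative)
    have "norm (f' r) \<le> p (s - r) * q r" using bound r s by simp
    also have "\<dots> \<le> p (s - r) * q (s / 2)"
      using r s nonneg monotone_onD[OF mono(2), of "s / 2" r] by (intro mult_left_mono) auto
    finally show "norm (f' r) \<le> q (s / 2) * p (s - r)" by (simp add: mult.commute)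
  qed (use s in simp)
  moreover have "norm (f s - f 0) \<le> norm (f s - f (s / 2)) + norm (f (s / 2) - f 0)"
    by (metis diff_add_cancel add_diff_eq norm_triangle_ineq)
  ultimately show ?thesis by (simp add: algebra_simps)
qed

text \<open>The indices j + 1 and m - j add up to m + 1, so one of them reaches the midpoint; that
  factor is frozen there and the other is summed.\<close>

lemma sum_convolution_bound:
  fixes p q :: "real \<Rightarrow> real"
  assumes mono: "antimono_on {0<..} p" "antimono_on {0<..} q"
    and nonneg: "\<And>r. 0 < r \<Longrightarrow> 0 \<le> p r" "\<And>r. 0 < r \<Longrightarrow> 0 \<le> q r"
  shows "(\<Sum>j<m. p (real (Suc j)) * q (real (m - j))) \<le>
    p (real (Suc m) / 2) * (\<Sum>j<m. q (real (Suc j))) + q (real (Suc m) / 2) * (\<Sum>j<m. p (real (Suc j)))"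
proof -
  let ?h = "real (Suc m) / 2"
  have "p (real (Suc j)) * q (real (m - j)) \<le> p ?h * q (real (m - j)) + q ?h * p (real (Suc j))"
    if j: "j < m" for j
  proof (cases "real (Suc j) \<ge> ?h")
    case True
    have "p (real (Suc j)) * q (real (m - j)) \<le> p ?h * q (real (m - j))"
      using True j monotone_onD[OF mono(1), of ?h "real (Suc j)"] nonneg by (intro mult_right_mono) auto
    thus ?thesis using nonneg(2)[of ?h] nonneg(1)[of "real (Suc j)"] by (simp add: add_increasing2)
  next
    case False
    hence "real (m - j) \<ge> ?h" using j by (simp add: of_nat_diff)
    hence "p (real (Suc j)) * q (real (m - j)) \<le> p (real (Suc j)) * q ?h"
      using j monotone_onD[OF mono(2), of ?h "real (m - j)"] nonneg by (intro mult_left_mono) auto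
    thus ?thesis using nonneg(1)[of ?h] nonneg(2)[of "real (m - j)"] j by (simp add: add_increasing mult.commute)
  qed
  hence "(\<Sum>j<m. p (real (Suc j)) * q (real (m - j))) \<le> (\<Sum>j<m. p ?h * q (real (m - j)) + q ?h * p (real (Suc j)))"
    by (intro sum_mono) auto
  also have "\<dots> = p ?h * (\<Sum>j<m. q (real (m - j))) + q ?h * (\<Sum>j<m. p (real (Suc j)))"
    by (simp add: sum.distrib sum_distrib_left)
  also have "(\<Sum>j<m. q (real (m - j))) = (\<Sum>j<m. q (real (Suc j)))"
    using sum.nat_diff_reindex[of "\<lambda>i. q (real (Suc i))" m] by (simp add: Suc_diff_Suc)
  finally show ?thesis .
qed

lemma sum_powr_le:
  fixes \<alpha> :: real
  assumes \<alpha>: "0 \<le> \<alpha>" "\<alpha> < 1"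
  shows "(\<Sum>j<m. real (Suc j) powr (- \<alpha>)) \<le> real m powr (1 - \<alpha>) / (1 - \<alpha>)"
proof (induction m)
  case (Suc m)
  have step: "real m powr (1 - \<alpha>) \<le> real (Suc m) powr (1 - \<alpha>) - (1 - \<alpha>) * real (Suc m) powr (- \<alpha>)"
  proof (cases "m = 0")
    case False
    define x where "x = real (Suc m)"
    have x: "x > 1" using False by (simp add: x_def)
    \<comment> \<open>Weighted mean inequality for (x - 1) / x and 1. Scaled by
      \<open>x powr (1 - \<alpha>)\<close> it compares one summand with an increment of the
      primitive.\<close>
    have "((x - 1) / x) powr (1 - \<alpha>) * 1 powr \<alpha> \<le> (1 - \<alpha>) * ((x - 1) / x) + \<alpha> * 1"
      using \<alpha> x by (intro Youngs_inequality_0) auto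
    hence "((x - 1) / x) powr (1 - \<alpha>) \<le> 1 - (1 - \<alpha>) / x" using x by (simp add: field_simps)
    hence "x powr (1 - \<alpha>) * ((x - 1) / x) powr (1 - \<alpha>) \<le> x powr (1 - \<alpha>) * (1 - (1 - \<alpha>) / x)"
      by (intro mult_left_mono) auto
    also have "x powr (1 - \<alpha>) * ((x - 1) / x) powr (1 - \<alpha>) = (x - 1) powr (1 - \<alpha>)"
      using x by (simp flip: powr_mult)
    also have "x powr (1 - \<alpha>) * (1 - (1 - \<alpha>) / x) = x powr (1 - \<alpha>) - (1 - \<alpha>) * (x powr (1 - \<alpha>) / x)"
      by (simp add: algebra_simps diff_divide_distrib)
    also have "x powr (1 - \<alpha>) / x = x powr (- \<alpha>)" using x by (simp add: powr_diff powr_minus_divide)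
    finally show ?thesis by (simp add: x_def)
  qed (use \<alpha> in simp)
  have "(\<Sum>j<Suc m. real (Suc j) powr (- \<alpha>)) \<le> real m powr (1 - \<alpha>) / (1 - \<alpha>) + real (Suc m) powr (- \<alpha>)"
    using Suc.IH by simp
  also have "\<dots> \<le> (real (Suc m) powr (1 - \<alpha>) - (1 - \<alpha>) * real (Suc m) powr (- \<alpha>)) / (1 - \<alpha>) + real (Suc m) powr (- \<alpha>)"
    using step \<alpha> by (intro add_right_mono divide_right_mono) auto
  also have "\<dots> = real (Suc m) powr (1 - \<alpha>) / (1 - \<alpha>)" using \<alpha> by (simp add: diff_divide_distrib)
  finally show ?case .
qed simp

lemma sum_inverse_le: "(\<Sum>j<m. 1 / real (Suc j)) \<le> 1 + ln (real m)"
proof (induction m)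
  case (Suc m)
  show ?case
  proof (cases "m = 0")
    case False
    have "ln (real m / real (Suc m)) \<le> real m / real (Suc m) - 1" using False by (intro ln_le_minus_one) auto
    hence "ln (real m) - ln (real (Suc m)) \<le> - (1 / real (Suc m))"
      using False by (simp add: ln_div field_simps)
    thus ?thesis using Suc.IH by simp
  qed simp
qed simp

lemma one_le_ln:
  assumes "n \<ge> 3" shows "1 \<le> ln (real n)"
proof -
  have "exp 1 \<le> real n" using exp_le assms by simp
  thus ?thesis using assms by (subst ln_ge_iff) auto
qed

section \<open>Smoothing estimates for the perturbed semigroup and the product formula\<close>

text \<open>Common shape of the bounds on operators followed on the right by B. The 1 stems from the
  graph norm in the dual estimate and dominates for s \<ge> 1.\<close>

definition sing :: "real \<Rightarrow> real \<Rightarrow> real" where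
  "sing \<alpha> s = s powr (- \<alpha>) + 1"

lemma sing_pos: "sing \<alpha> s > 0"
  by (simp add: sing_def add_nonneg_pos)

lemma sing_ge_1: "sing \<alpha> s \<ge> 1"
  by (simp add: sing_def)

lemma sing_antimono: "0 \<le> \<alpha> \<Longrightarrow> 0 < r \<Longrightarrow> r \<le> s \<Longrightarrow> sing \<alpha> s \<le> sing \<alpha> r"
  by (simp add: sing_def powr_mono2')

lemma sing_le_powr: "0 \<le> \<alpha> \<Longrightarrow> 0 < s \<Longrightarrow> s \<le> 1 \<Longrightarrow> sing \<alpha> s \<le> 2 * s powr (- \<alpha>)"
  using powr_mono2'[of "- \<alpha>" s 1] by (simp add: sing_def)

text \<open>Trades the midpoint values produced by the convolution lemmas for values at the full
  time.\<close>

lemma sing_divide_le: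
  assumes "0 \<le> \<alpha>" "\<alpha> < 1" "s > 0" "c \<ge> 1"
  shows "sing \<alpha> (s / c) \<le> c * sing \<alpha> s"
proof -
  have "(s / c) powr (- \<alpha>) = s powr (- \<alpha>) * c powr \<alpha>"
    using assms by (subst powr_divide) (auto simp: powr_minus_divide)
  also have "\<dots> \<le> s powr (- \<alpha>) * c powr 1" using assms by (intro mult_left_mono powr_mono) auto
  finally show ?thesis using assms by (simp add: sing_def algebra_simps)
qed

lemma powr_mult_le_imp: "0 < s \<Longrightarrow> s powr \<alpha> * x \<le> c \<Longrightarrow> x \<le> c * s powr (- \<alpha>)" for s :: real
  by (simp add: powr_minus_divide pos_le_divide_eq mult.commute)

text \<open>All inputs in quantitative form with one constant, so that every later constant depends
  on \<open>K\<close> and \<open>\<alpha>\<close> only. \<open>PB\<close> carries the dual domain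
  condition; \<open>relB\<close> and \<open>relA\<close> come from uniform boundedness.\<close>

locale product_formula =
  fixes P Q T :: "real \<Rightarrow> ('a::complex_banach \<Rightarrow>\<^sub>L 'a)" and \<alpha> K :: real
  assumes P: "contraction_semigroup P" and Q: "contraction_semigroup Q" and T: "contraction_semigroup T"
    and gen: "generator T = operator_sum (generator P) (generator Q)"
    and dom: "Domain (generator P) \<subseteq> Domain (generator Q)"
    and \<alpha>: "0 \<le> \<alpha>" "\<alpha> < 1" and K: "K \<ge> 1"
    and smooth: "\<And>s x. s > 0 \<Longrightarrow> \<exists>y. (P s x, y) \<in> generator P \<and> norm y \<le> K / s * norm x"
    and PB: "\<And>s x y. s > 0 \<Longrightarrow> (x, y) \<in> generator Q \<Longrightarrow> norm (P s y) \<le> K * sing \<alpha> s * norm x"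
    and relB: "\<And>x y z. (x, y) \<in> generator P \<Longrightarrow> (x, z) \<in> generator Q \<Longrightarrow> norm z \<le> K * (norm x + norm y)"
    and relA: "\<And>x y z. (x, z) \<in> generator T \<Longrightarrow> (x, y) \<in> generator P \<Longrightarrow> norm y \<le> K * (norm x + norm z)"
begin

sublocale P: contractions P by standard (rule P)
sublocale Q: contractions Q by standard (rule Q)
sublocale T: contractions T by standard (rule T)

section \<open>Generator values and Duhamel derivatives\<close>

definition D where "D = Domain (generator P)"
definition A where "A x = (THE y. (x, y) \<in> generator P)"
definition B where "B x = (THE y. (x, y) \<in> generator Q)"

lemma A_eq: "(x, y) \<in> generator P \<Longrightarrow> A x = y"
  unfolding A_def using generator_unique by blast

lemma B_eq: "(x, y) \<in> generator Q \<Longrightarrow> B x = y"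
  unfolding B_def using generator_unique by blast

lemma gen_A: "x \<in> D \<Longrightarrow> (x, A x) \<in> generator P"
  using A_eq by (auto simp: D_def)

lemma gen_B: "x \<in> D \<Longrightarrow> (x, B x) \<in> generator Q"
  using B_eq dom by (auto simp: D_def)

lemma gen_T: "x \<in> D \<Longrightarrow> (x, A x + B x) \<in> generator T"
  using gen_A gen_B by (auto simp: gen operator_sum_def)

lemma gen_T_D: "(x, z) \<in> generator T \<Longrightarrow> x \<in> D \<and> z = A x + B x"
  using A_eq B_eq by (auto simp: gen operator_sum_def D_def)

lemma P_in_D: "s > 0 \<Longrightarrow> P s x \<in> D"
  using smooth[of s x] by (auto simp: D_def)

lemma norm_A_P: "s > 0 \<Longrightarrow> norm (A (P s x)) \<le> K / s * norm x"
  using smooth[of s x] A_eq by blast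

lemma P_invariant: "x \<in> D \<Longrightarrow> s \<ge> 0 \<Longrightarrow> P s x \<in> D \<and> A (P s x) = P s (A x)"
  using P.invariant[OF gen_A] A_eq by (auto simp: D_def)

lemma T_invariant: "x \<in> D \<Longrightarrow> s \<ge> 0 \<Longrightarrow> T s x \<in> D \<and> A (T s x) + B (T s x) = T s (A x + B x)"
  using gen_T_D[OF T.invariant[OF gen_T]] by simp

lemma D_diff: "x \<in> D \<Longrightarrow> y \<in> D \<Longrightarrow> x - y \<in> D"
  using generator_diff[OF gen_A gen_A] by (auto simp: D_def)

lemma dense_D: "closure D = UNIV"
  by (rule P.closure_eq_UNIV[OF P_in_D])

text \<open>Returns from the sum, which commutes with \<open>T\<close>, to A and B
  separately.\<close>

lemma norm_AB_le:
  assumes "x \<in> D"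
  shows "norm (A x) \<le> K * (norm x + norm (A x + B x))"
    and "norm (B x) \<le> norm (A x + B x) + K * (norm x + norm (A x + B x))"
proof -
  show 1: "norm (A x) \<le> K * (norm x + norm (A x + B x))"
    using relA[OF gen_T gen_A] assms by blast
  have "norm (B x) \<le> norm (A x + B x) + norm (A x)"
    by (metis add_diff_cancel_left' norm_triangle_ineq4)
  thus "norm (B x) \<le> norm (A x + B x) + K * (norm x + norm (A x + B x))" using 1 by simp
qed

text \<open>The A-terms cancel and leave B to the right of P, the order in which \<open>PB\<close>
  applies.\<close>

lemma P_T_derivative:
  assumes y: "y \<in> D" and r: "0 < r" "r < s"
  shows "((\<lambda>\<rho>. P (s - \<rho>) (T \<rho> y)) has_vector_derivative - P (s - r) (B (T r y))) (at r)"
proof -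
  have Ty: "T r y \<in> D" "A (T r y) + B (T r y) = T r (A y + B y)" using T_invariant[OF y] r by auto
  have "((\<lambda>\<rho>. P (s - \<rho>) (T \<rho> y)) has_vector_derivative
      P (s - r) (A (T r y)) + P (s - r) (- T r (A y + B y))) (at r)"
    by (rule P.product_derivative[OF T.orbit_derivative[OF gen_T[OF y] r(1)] gen_A[OF Ty(1)] r(2)])
  also have "P (s - r) (A (T r y)) + P (s - r) (- T r (A y + B y)) = - P (s - r) (B (T r y))"
    by (simp only: Ty(2)[symmetric]) (simp add: blinfun.bilinear_simps)
  finally show ?thesis .
qed

text \<open>Here B stands to the right of T; this form serves once T B has been estimated.\<close>

lemma T_P_derivative:
  assumes y: "y \<in> D" and r: "0 < r" "r < s"
  shows "((\<lambda>\<rho>. T (s - \<rho>) (P \<rho> y)) has_vector_derivative T (s - r) (B (P r y))) (at r)"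
proof -
  have Py: "P r y \<in> D" "A (P r y) = P r (A y)" using P_invariant[OF y] r by auto
  have "((\<lambda>\<rho>. T (s - \<rho>) (P \<rho> y)) has_vector_derivative
      T (s - r) (A (P r y) + B (P r y)) + T (s - r) (- P r (A y))) (at r)"
    by (rule T.product_derivative[OF P.orbit_derivative[OF gen_A[OF y] r(1)] gen_T[OF Py(1)] r(2)])
  also have "T (s - r) (A (P r y) + B (P r y)) + T (s - r) (- P r (A y)) = T (s - r) (B (P r y))"
    by (simp add: Py(2) blinfun.bilinear_simps)
  finally show ?thesis .
qed

text \<open>Time scale below which the singular Gronwall arguments are absorbed.\<close>

definition \<delta> where "\<delta> = min 1 (((1 - \<alpha>) / (16 * K)) powr (1 / (1 - \<alpha>)))"

text \<open>The feedback coefficient 8 K / (1 - \<alpha>) is that of the convolutions below: two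
  halves with 2 K each, doubled on passing from s / 2 to s. The 16 in \<open>\<delta>\<close> brings
  it down to 1 / 2.\<close>

lemma \<delta>: "\<delta> > 0" "\<delta> \<le> 1" "\<And>s. 0 < s \<Longrightarrow> s \<le> \<delta> \<Longrightarrow> 8 * K / (1 - \<alpha>) * s powr (1 - \<alpha>) \<le> 1 / 2"
proof -
  have pos: "(1 - \<alpha>) / (16 * K) > 0" using \<alpha> K by simp
  hence "((1 - \<alpha>) / (16 * K)) powr (1 / (1 - \<alpha>)) > 0" by (metis powr_gt_zero less_irrefl)
  thus "\<delta> > 0" unfolding \<delta>_def by (simp only: min_less_iff_conj zero_less_one simp_thms)
  show "\<delta> \<le> 1" unfolding \<delta>_def by (rule min.cobounded1)
  fix s assume s: "0 < s" "s \<le> \<delta>"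
  have "s powr (1 - \<alpha>) \<le> (((1 - \<alpha>) / (16 * K)) powr (1 / (1 - \<alpha>))) powr (1 - \<alpha>)"
  proof (rule powr_mono2)
    show "s \<le> ((1 - \<alpha>) / (16 * K)) powr (1 / (1 - \<alpha>))"
      using s(2) min.cobounded2[of 1] unfolding \<delta>_def by (rule order_trans)
  qed (use s \<alpha> in auto)
  also have "\<dots> = (1 - \<alpha>) / (16 * K)" using pos \<alpha> K by (simp add: powr_powr)
  finally have "8 * K / (1 - \<alpha>) * s powr (1 - \<alpha>) \<le> 8 * K / (1 - \<alpha>) * ((1 - \<alpha>) / (16 * K))"
    using \<alpha> K by (intro mult_left_mono) auto
  also have "\<dots> = 1 / 2" using \<alpha> K by (simp add: field_simps)
  finally show "8 * K / (1 - \<alpha>) * s powr (1 - \<alpha>) \<le> 1 / 2" .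
qed

section \<open>Singular Gronwall estimate for the semigroup of the sum\<close>

lemma half_powr_le: "s > 0 \<Longrightarrow> (s / 2) powr (- \<alpha>) * s powr (1 - \<alpha>) \<le> 2 * (s powr (- \<alpha>) * s powr (1 - \<alpha>))"
proof -
  assume s: "s > 0"
  have "(s / 2) powr (- \<alpha>) = s powr (- \<alpha>) * 2 powr \<alpha>"
    using s by (subst powr_divide) (auto simp: powr_minus_divide)
  also have "\<dots> \<le> s powr (- \<alpha>) * 2 powr 1" using \<alpha> by (intro mult_left_mono powr_mono) auto
  finally show ?thesis using mult_right_mono[of "(s / 2) powr (- \<alpha>)" "s powr (- \<alpha>) * 2" "s powr (1 - \<alpha>)"] by simp
qed

text \<open>Gronwall step: a weighted bound \<open>N\<close> on earlier times returns with the
  factor 1 / 2. The weight \<open>r powr \<alpha>\<close> compensates the singularity of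
  \<open>P s B\<close>.\<close>

lemma norm_T_le_convolution:
  assumes y: "y \<in> D" and s: "0 < s" "s \<le> \<delta>" and N: "\<And>r. 0 < r \<Longrightarrow> r < s \<Longrightarrow> r powr \<alpha> * norm (T r y) \<le> N"
  shows "s powr \<alpha> * norm (T s y) \<le> s powr \<alpha> * norm (P s y) + N / 2"
proof -
  have "0 \<le> (s / 2) powr \<alpha> * norm (T (s / 2) y)" by simp
  also have "\<dots> \<le> N" using s by (intro N) auto
  finally have N0: "N \<ge> 0" .
  let ?q = "\<lambda>r. r powr (- \<alpha>)" and ?q' = "\<lambda>r. r powr (1 - \<alpha>) / (1 - \<alpha>)"
  have q': "(?q' has_real_derivative ?q r) (at r)" if "r > 0" for r
    using that \<alpha> by (auto intro!: derivative_eq_intros)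
  have cq': "continuous_on S ?q'" if "S \<subseteq> {0..}" for S
    using that \<alpha> by (auto intro!: continuous_intros continuous_on_powr')
  have "norm (P (s - s) (T s y) - P (s - 0) (T 0 y)) \<le>
      2 * K * N * ?q (s / 2) * (?q' (s / 2) - ?q' 0) + ?q (s / 2) * (2 * K * N * ?q' (s / 2) - 2 * K * N * ?q' 0)"
  proof (rule derivative_convolution_bound[where f = "\<lambda>\<rho>. P (s - \<rho>) (T \<rho> y)" and p = "\<lambda>r. 2 * K * N * ?q r"
        and p' = "\<lambda>r. 2 * K * N * ?q' r" and q = ?q and q' = ?q' and f' = "\<lambda>r. - P (s - r) (B (T r y))"])
    show "continuous_on {0..s} (\<lambda>\<rho>. P (s - \<rho>) (T \<rho> y))"
      by (intro P.continuous_compose T.orbit_continuous continuous_intros) auto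
    fix r assume r: "0 < r" "r < s"
    show "((\<lambda>\<rho>. P (s - \<rho>) (T \<rho> y)) has_vector_derivative - P (s - r) (B (T r y))) (at r)"
      by (rule P_T_derivative[OF y r])
    have "norm (P (s - r) (B (T r y))) \<le> K * sing \<alpha> (s - r) * norm (T r y)"
      using r T_invariant[OF y, of r] by (intro PB gen_B) auto
    also have "\<dots> \<le> K * (2 * ?q (s - r)) * norm (T r y)"
      using r s \<delta>(1,2) \<alpha> K by (intro mult_right_mono mult_left_mono sing_le_powr) auto
    also have "norm (T r y) \<le> N * ?q r"
      using N[OF r] r by (intro powr_mult_le_imp)
    finally have "norm (P (s - r) (B (T r y))) \<le> K * (2 * ?q (s - r)) * (N * ?q r)"
      using K by (simp add: mult_left_mono)
    thus "norm (- P (s - r) (B (T r y))) \<le> 2 * K * N * ?q (s - r) * ?q r" by (simp add: mult_ac)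
    show "((\<lambda>r. 2 * K * N * ?q' r) has_real_derivative 2 * K * N * ?q r) (at r)"
      using r by (intro DERIV_cmult q')
    show "(?q' has_real_derivative ?q r) (at r)" using r by (intro q')
    show "0 \<le> 2 * K * N * ?q r" using K N0 by simp
  next
    show "continuous_on {0..s} (\<lambda>r. 2 * K * N * ?q' r)" "continuous_on {0..s} ?q'"
      by (intro continuous_on_mult_left cq'; simp)+
    show "antimono_on {0<..<s} ?q"
      using \<alpha> by (intro monotone_onI powr_mono2') auto
    thus "antimono_on {0<..<s} (\<lambda>r. 2 * K * N * ?q r)"
      using K N0 by (auto simp: monotone_on_def intro: mult_left_mono)
  qed (use s in auto)
  also have "\<dots> = 4 * K * N / (1 - \<alpha>) * (?q (s / 2) * (s / 2) powr (1 - \<alpha>))"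
    by (simp add: field_simps)
  also have "\<dots> \<le> 4 * K * N / (1 - \<alpha>) * (2 * (?q s * s powr (1 - \<alpha>)))"
  proof (intro mult_left_mono)
    have "?q (s / 2) * (s / 2) powr (1 - \<alpha>) \<le> ?q (s / 2) * s powr (1 - \<alpha>)"
      using s \<alpha> by (intro mult_left_mono powr_mono2) auto
    thus "?q (s / 2) * (s / 2) powr (1 - \<alpha>) \<le> 2 * (?q s * s powr (1 - \<alpha>))"
      using half_powr_le[OF s(1)] by linarith
  qed (use K N0 \<alpha> in auto)
  also have "\<dots> = N * ?q s * (8 * K / (1 - \<alpha>) * s powr (1 - \<alpha>))" by (simp add: field_simps)
  also have "\<dots> \<le> N * ?q s * (1 / 2)" using N0 \<delta>(3)[OF s] by (intro mult_left_mono) auto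
  finally have "norm (T s y - P s y) \<le> N * ?q s / 2" by (simp add: P.zero T.zero)
  hence "norm (T s y) \<le> norm (P s y) + N * ?q s / 2"
    using norm_triangle_sub[of "T s y" "P s y"] by linarith
  hence "s powr \<alpha> * norm (T s y) \<le> s powr \<alpha> * (norm (P s y) + N * ?q s / 2)" by (intro mult_left_mono) auto
  thus ?thesis using s by (simp add: algebra_simps powr_minus)
qed

text \<open>The vector \<open>w\<close> may lie outside \<open>D\<close>, so the Gronwall step is
  run for \<open>P e w\<close>. Its weighted supremum is finite by contractivity and satisfies N
  \<le> 2 K norm z + N / 2 uniformly in \<open>e\<close>; then \<open>e\<close> tends to 0.\<close>

lemma norm_T_B_small:
  assumes zw: "(z, w) \<in> generator Q" and s: "0 < s" "s \<le> \<delta>"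
  shows "s powr \<alpha> * norm (T s w) \<le> 4 * K * norm z"
proof -
  have reg: "s powr \<alpha> * norm (T s (P e w)) \<le> 4 * K * norm z" if e: "e > 0" for e
  proof -
    define y where "y = P e w"
    have y: "y \<in> D" unfolding y_def by (rule P_in_D[OF e])
    let ?f = "\<lambda>r. r powr \<alpha> * norm (T r y)"
    define N where "N = (SUP r\<in>{0<..\<delta>}. ?f r)"
    have bdd: "bdd_above (?f ` {0<..\<delta>})"
    proof (rule bdd_aboveI2)
      fix r assume "r \<in> {0<..\<delta>}"
      thus "?f r \<le> 1 * norm y" using \<delta>(1,2) \<alpha> T.norm_le[of r y] powr_mono2[of \<alpha> r 1]
        by (intro mult_mono) auto
    qed
    have N: "?f r \<le> N" if "0 < r" "r \<le> \<delta>" for r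
      unfolding N_def using that by (intro cSUP_upper bdd) auto
    have "N \<le> 2 * K * norm z + N / 2" unfolding N_def
    proof (rule cSUP_least)
      fix r assume r: "r \<in> {0<..\<delta>}"
      have "?f r \<le> r powr \<alpha> * norm (P r y) + N / 2"
        using r by (intro norm_T_le_convolution[OF y] N) auto
      also have "norm (P r y) \<le> norm (P r w)"
        unfolding y_def using P.commute[of r e w] P.norm_le[of e "P r w"] r e by simp
      also have "norm (P r w) \<le> K * sing \<alpha> r * norm z" using r zw by (intro PB) auto
      also have "K * sing \<alpha> r * norm z \<le> K * (2 * r powr (- \<alpha>)) * norm z"
        using r \<delta>(1,2) \<alpha> K by (intro mult_right_mono mult_left_mono sing_le_powr) auto
      finally have "?f r \<le> r powr \<alpha> * (K * (2 * r powr (- \<alpha>)) * norm z) + N / 2"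
        by (simp add: mult_left_mono)
      also have "r powr \<alpha> * (K * (2 * r powr (- \<alpha>)) * norm z) = 2 * K * norm z"
        using r by (simp add: powr_minus)
      finally show "?f r \<le> 2 * K * norm z + (SUP r\<in>{0<..\<delta>}. ?f r) / 2" by (simp add: N_def)
    qed (use \<delta>(1,2) in auto)
    thus ?thesis using N[OF s] by (simp add: y_def)
  qed
  have "((\<lambda>e. s powr \<alpha> * norm (T s (P e w))) \<longlongrightarrow> s powr \<alpha> * norm (T s w)) (at_right 0)"
    by (intro tendsto_mult tendsto_const tendsto_norm blinfun.tendsto P.tendsto_zero)
  thus ?thesis
    by (rule tendsto_upperbound)
       (use reg eventually_at_right_less[of 0] in \<open>auto elim: eventually_mono\<close>)
qed

text \<open>The short-time bound evaluated at \<open>\<delta>\<close>; from there on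
  \<open>T (s - \<delta>)\<close> is a contraction.\<close>

definition K1 where "K1 = 4 * K * \<delta> powr (- \<alpha>)"

lemma K1: "K1 \<ge> 4 * K" "K1 \<ge> 1"
proof -
  have "1 powr (- \<alpha>) \<le> \<delta> powr (- \<alpha>)" by (rule powr_mono2') (use \<delta>(1,2) \<alpha>(1) in simp_all)
  hence "\<delta> powr (- \<alpha>) \<ge> 1" by simp
  thus "K1 \<ge> 4 * K" using K by (simp add: K1_def)
  thus "K1 \<ge> 1" using K by simp
qed

lemma norm_T_B:
  assumes zw: "(z, w) \<in> generator Q" and s: "s > 0"
  shows "norm (T s w) \<le> K1 * sing \<alpha> s * norm z"
proof (cases "s \<le> \<delta>")
  case True
  have "norm (T s w) \<le> 4 * K * norm z * s powr (- \<alpha>)"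
    using norm_T_B_small[OF zw s True] s by (intro powr_mult_le_imp)
  also have "\<dots> = 4 * K * s powr (- \<alpha>) * norm z" by simp
  also have "\<dots> \<le> K1 * sing \<alpha> s * norm z"
    using K1 K by (intro mult_right_mono mult_mono) (auto simp: sing_def)
  finally show ?thesis .
next
  case False
  have "T s w = T (s - \<delta>) (T \<delta> w)" using T.add[of "s - \<delta>" \<delta> w] False \<delta>(1,2) by simp
  hence "norm (T s w) \<le> norm (T \<delta> w)" using T.norm_le False by simp
  also have "\<dots> \<le> 4 * K * norm z * \<delta> powr (- \<alpha>)"
    using norm_T_B_small[OF zw \<delta>(1)] \<delta>(1,2) by (intro powr_mult_le_imp) auto
  also have "\<dots> = K1 * 1 * norm z" by (simp add: K1_def)
  also have "\<dots> \<le> K1 * sing \<alpha> s * norm z"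
    using K1 sing_ge_1 by (intro mult_right_mono mult_left_mono) auto
  finally show ?thesis .
qed

text \<open>Convolves the kernel of T B with the decay V / (r + \<tau>). The shift by \<tau> makes
  that decay integrable at 0, and the logarithm is its integral.\<close>

lemma norm_T_decay:
  assumes v: "v \<in> D" and \<tau>: "\<tau> > 0" and V: "V \<ge> 0" "\<And>r. r \<ge> 0 \<Longrightarrow> norm (P r v) \<le> V / (r + \<tau>)" and s: "s > 0"
  shows "norm (T s v) \<le> V / (s + \<tau>) + K1 * V * sing \<alpha> (s / 2) * (ln ((s / 2 + \<tau>) / \<tau>) + 1 / (1 - \<alpha>))"
proof -
  let ?p = "\<lambda>r. K1 * sing \<alpha> r" and ?p' = "\<lambda>r. K1 * (r powr (1 - \<alpha>) / (1 - \<alpha>) + r)"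
  let ?q = "\<lambda>r. V / (r + \<tau>)" and ?q' = "\<lambda>r. V * ln (r + \<tau>)"
  have K1nn: "K1 \<ge> 0" using K1 by simp
  have "norm (T (s - s) (P s v) - T (s - 0) (P 0 v)) \<le>
      ?p (s / 2) * (?q' (s / 2) - ?q' 0) + ?q (s / 2) * (?p' (s / 2) - ?p' 0)"
  proof (rule derivative_convolution_bound[where f = "\<lambda>\<rho>. T (s - \<rho>) (P \<rho> v)" and p = ?p and p' = ?p'
        and q = ?q and q' = ?q' and f' = "\<lambda>r. T (s - r) (B (P r v))"])
    show "continuous_on {0..s} (\<lambda>\<rho>. T (s - \<rho>) (P \<rho> v))"
      by (intro T.continuous_compose P.orbit_continuous continuous_intros) auto
    fix r assume r: "0 < r" "r < s"
    show "((\<lambda>\<rho>. T (s - \<rho>) (P \<rho> v)) has_vector_derivative T (s - r) (B (P r v))) (at r)"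
      by (rule T_P_derivative[OF v r])
    have "norm (T (s - r) (B (P r v))) \<le> K1 * sing \<alpha> (s - r) * norm (P r v)"
      using r P_in_D[of r v] by (intro norm_T_B gen_B) auto
    also have "\<dots> \<le> K1 * sing \<alpha> (s - r) * ?q r"
      using r V(2)[of r] K1nn sing_pos[of \<alpha> "s - r"] by (intro mult_left_mono) auto
    finally show "norm (T (s - r) (B (P r v))) \<le> ?p (s - r) * ?q r" .
    show "(?p' has_real_derivative ?p r) (at r)"
      using r \<alpha> by (auto intro!: derivative_eq_intros simp: sing_def)
    show "(?q' has_real_derivative ?q r) (at r)"
      using r \<tau> by (auto intro!: derivative_eq_intros)
    show "0 \<le> ?p r" using K1nn sing_pos[of \<alpha> r] by simp
    show "0 \<le> ?q r" using V(1) r \<tau> by simp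
  next
    show "continuous_on {0..s} ?p'"
      using \<alpha> by (intro continuous_intros continuous_on_powr') auto
    show "continuous_on {0..s} ?q'"
      using \<tau> by (intro continuous_intros) auto
    show "antimono_on {0<..<s} ?p"
      using K1nn \<alpha> by (intro monotone_onI mult_left_mono sing_antimono) auto
    show "antimono_on {0<..<s} ?q"
      using V(1) \<tau> by (intro monotone_onI divide_left_mono) auto
  qed (rule s)
  also have "?q' (s / 2) - ?q' 0 = V * ln ((s / 2 + \<tau>) / \<tau>)"
    using s \<tau> by (simp add: ln_div right_diff_distrib)
  also have "?q (s / 2) * (?p' (s / 2) - ?p' 0) \<le> K1 * V * sing \<alpha> (s / 2) * (1 / (1 - \<alpha>))"
  proof -
    have "?q (s / 2) \<le> V / (s / 2)" using V(1) s \<tau> by (intro divide_left_mono) auto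
    hence "?q (s / 2) * (?p' (s / 2) - ?p' 0) \<le> V / (s / 2) * (?p' (s / 2) - ?p' 0)"
      using K1nn s \<alpha> by (intro mult_right_mono) auto
    also have "?p' (s / 2) - ?p' 0 = K1 * ((s / 2) powr (1 - \<alpha>) / (1 - \<alpha>) + s / 2)" by simp
    also have "V / (s / 2) * \<dots> = K1 * V * (((s / 2) powr (1 - \<alpha>) / (1 - \<alpha>) + s / 2) / (s / 2))" by simp
    also have "((s / 2) powr (1 - \<alpha>) / (1 - \<alpha>) + s / 2) / (s / 2) = (s / 2) powr (1 - \<alpha>) / (s / 2) / (1 - \<alpha>) + 1"
      using s by (simp add: add_divide_distrib)
    also have "(s / 2) powr (1 - \<alpha>) / (s / 2) = (s / 2) powr (- \<alpha>)"
      using s by (simp add: powr_diff powr_minus_divide)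
    also have "(s / 2) powr (- \<alpha>) / (1 - \<alpha>) + 1 \<le> sing \<alpha> (s / 2) * (1 / (1 - \<alpha>))"
    proof -
      have "1 \<le> 1 / (1 - \<alpha>)" using \<alpha> by simp
      thus ?thesis by (simp add: sing_def add_divide_distrib)
    qed
    hence "K1 * V * ((s / 2) powr (- \<alpha>) / (1 - \<alpha>) + 1) \<le> K1 * V * (sing \<alpha> (s / 2) * (1 / (1 - \<alpha>)))"
      using K1nn V(1) by (intro mult_left_mono) auto
    finally show ?thesis by (simp add: mult.assoc)
  qed
  finally have "norm (T s v - P s v) \<le> K1 * V * sing \<alpha> (s / 2) * (ln ((s / 2 + \<tau>) / \<tau>) + 1 / (1 - \<alpha>))"
    by (simp add: P.zero T.zero norm_minus_commute algebra_simps)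
  moreover have "norm (P s v) \<le> V / (s + \<tau>)" using V(2) s by simp
  moreover have "norm (T s v) \<le> norm (P s v) + norm (T s v - P s v)" by (rule norm_triangle_sub)
  ultimately show ?thesis by linarith
qed

text \<open>At time i \<tau>: the free decay of A P plus its Duhamel correction, which carries the
  logarithm.\<close>

definition rate :: "nat \<Rightarrow> real \<Rightarrow> real \<Rightarrow> real" where
  "rate n \<tau> i = 1 / (i * \<tau>) + ln (real n) * sing \<alpha> (i * \<tau>)"

lemma rate_ge:
  assumes "n \<ge> 3" "\<tau> > 0" "i > 0"
  shows "1 / (i * \<tau>) \<le> rate n \<tau> i" "ln (real n) * sing \<alpha> (i * \<tau>) \<le> rate n \<tau> i"
    "sing \<alpha> (i * \<tau>) \<le> rate n \<tau> i" "1 \<le> rate n \<tau> i" "0 \<le> rate n \<tau> i"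
proof -
  have L: "ln (real n) \<ge> 1" by (rule one_le_ln[OF assms(1)])
  have a: "1 / (i * \<tau>) \<ge> 0" using assms by simp
  have b: "sing \<alpha> (i * \<tau>) \<le> ln (real n) * sing \<alpha> (i * \<tau>)"
    using L sing_pos[of \<alpha> "i * \<tau>"] by simp
  show "1 / (i * \<tau>) \<le> rate n \<tau> i" "ln (real n) * sing \<alpha> (i * \<tau>) \<le> rate n \<tau> i"
    "sing \<alpha> (i * \<tau>) \<le> rate n \<tau> i" "1 \<le> rate n \<tau> i" "0 \<le> rate n \<tau> i"
    using a b sing_ge_1[of \<alpha> "i * \<tau>"] unfolding rate_def by linarith+
qed

lemma rate_antimono:
  assumes "n \<ge> 3" "\<tau> > 0" "0 < i" "i \<le> j"
  shows "rate n \<tau> j \<le> rate n \<tau> i"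
  unfolding rate_def using assms \<alpha> one_le_ln[of n]
  by (intro add_mono mult_left_mono divide_left_mono sing_antimono mult_right_mono) auto

definition K2 where "K2 = 1 + 8 * K1 / (1 - \<alpha>)"

lemma K2: "K2 \<ge> 1" using K1 \<alpha> by (simp add: K2_def)

text \<open>Sampling at k \<tau> turns s + \<tau> into (k + 1) \<tau>, and k \<le> n keeps the
  logarithm below ln n.\<close>

lemma norm_T_decay_discrete:
  assumes v: "v \<in> D" and \<tau>: "\<tau> > 0" and V: "V \<ge> 0" "\<And>r. r \<ge> 0 \<Longrightarrow> norm (P r v) \<le> V / (r + \<tau>)"
    and n: "n \<ge> 3" and k: "k \<le> n"
  shows "norm (T (real k * \<tau>) v) \<le> K2 * V * rate n \<tau> (real (Suc k))"
\<comment> \<open>The convolution needs a positive time; at k = 0 the decay assumption itself is V /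
  \<tau>.\<close>
proof (cases "k = 0")
  case True
  have "norm (T (real k * \<tau>) v) \<le> V * (1 / \<tau>)" using V(2)[of 0] True by (simp add: T.zero P.zero)
  also have "\<dots> \<le> V * rate n \<tau> (real (Suc k))"
    using rate_ge(1)[OF n \<tau>, of 1] V(1) True by (intro mult_left_mono) auto
  also have "\<dots> \<le> K2 * (V * rate n \<tau> (real (Suc k)))"
    using mult_right_mono[OF K2, of "V * rate n \<tau> (real (Suc k))"] V(1) rate_ge(5)[OF n \<tau>, of "real (Suc k)"] by simp
  finally show ?thesis by simp
next
  case False
  define s where "s = real k * \<tau>"
  have s: "s > 0" using False \<tau> by (simp add: s_def)
  have L: "ln (real n) \<ge> 1" by (rule one_le_ln[OF n])
  let ?S = "sing \<alpha> (real (Suc k) * \<tau>)"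
  have S: "?S > 0" by (rule sing_pos)
  \<comment> \<open>For k \<ge> 1 one has (k + 1) \<tau> \<le> 2 s, so the midpoint is moved to the
    next grid time at the cost of a factor 4.\<close>
  have "sing \<alpha> (s / 2) \<le> sing \<alpha> ((real (Suc k) * \<tau>) / 4)"
  proof (rule sing_antimono)
    have "real (Suc k) \<le> 2 * real k" using False by simp
    hence "real (Suc k) * \<tau> \<le> 2 * real k * \<tau>" using \<tau> by (intro mult_right_mono) auto
    hence "real (Suc k) * \<tau> \<le> 2 * s" by (simp add: s_def mult.assoc)
    thus "real (Suc k) * \<tau> / 4 \<le> s / 2" by linarith
  qed (use \<alpha> \<tau> in auto)
  also have "\<dots> \<le> 4 * ?S" using \<alpha> \<tau> by (intro sing_divide_le) auto
  finally have S4: "sing \<alpha> (s / 2) \<le> 4 * ?S" .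
  have "(s / 2 + \<tau>) / \<tau> = real k / 2 + 1" using \<tau> by (simp add: s_def field_simps)
  also have "\<dots> \<le> real n" using k n by simp
  finally have "ln ((s / 2 + \<tau>) / \<tau>) \<le> ln (real n)" using s \<tau> n by (intro ln_mono) auto
  moreover have "1 / (1 - \<alpha>) \<le> ln (real n) * (1 / (1 - \<alpha>))" using L \<alpha> by (intro mult_le_cancel_right1[THEN iffD2]) auto
  moreover have "ln (real n) \<le> ln (real n) * (1 / (1 - \<alpha>))" using L \<alpha> by (intro mult_le_cancel_left1[THEN iffD2]) auto
  ultimately have lg: "ln ((s / 2 + \<tau>) / \<tau>) + 1 / (1 - \<alpha>) \<le> 2 * (ln (real n) * (1 / (1 - \<alpha>)))" by linarith
  have lg0: "0 \<le> ln ((s / 2 + \<tau>) / \<tau>) + 1 / (1 - \<alpha>)"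
    using s \<tau> \<alpha> by (intro add_nonneg_nonneg ln_ge_zero) auto
  have "norm (T s v) \<le> V / (s + \<tau>) + K1 * V * sing \<alpha> (s / 2) * (ln ((s / 2 + \<tau>) / \<tau>) + 1 / (1 - \<alpha>))"
    by (rule norm_T_decay[OF v \<tau> V s])
  also have "K1 * V * sing \<alpha> (s / 2) * (ln ((s / 2 + \<tau>) / \<tau>) + 1 / (1 - \<alpha>)) \<le>
      K1 * V * (4 * ?S) * (2 * (ln (real n) * (1 / (1 - \<alpha>))))"
    using S4 lg lg0 K1 V(1) S by (intro mult_mono mult_left_mono mult_nonneg_nonneg) auto
  also have "\<dots> = (8 * K1 / (1 - \<alpha>)) * V * (ln (real n) * ?S)" by simp
  also have "\<dots> \<le> (8 * K1 / (1 - \<alpha>)) * V * rate n \<tau> (real (Suc k))"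
    using K1 V(1) \<alpha> rate_ge(2)[OF n \<tau>, of "real (Suc k)"] by (intro mult_left_mono) auto
  also have "V / (s + \<tau>) = V * (1 / (real (Suc k) * \<tau>))" by (simp add: s_def algebra_simps)
  also have "\<dots> \<le> V * rate n \<tau> (real (Suc k))"
    using V(1) rate_ge(1)[OF n \<tau>, of "real (Suc k)"] by (intro mult_left_mono) auto
  finally show ?thesis by (simp add: s_def K2_def algebra_simps)
qed

section \<open>Smoothing by powers of the product\<close>

primrec X :: "real \<Rightarrow> nat \<Rightarrow> ('a \<Rightarrow>\<^sub>L 'a)" where
  "X \<tau> 0 = P \<tau>"
| "X \<tau> (Suc m) = X \<tau> m o\<^sub>L (Q \<tau> o\<^sub>L P \<tau>)"

text \<open>Discrete Duhamel formula: each factor Q P at the right end is split as P + (Q - 1) P,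
  and the pure P-terms accumulate into one semigroup value.\<close>

lemma X_expand:
  assumes \<tau>: "\<tau> \<ge> 0"
  shows "X \<tau> m v = P (real (Suc m) * \<tau>) v +
    (\<Sum>j<m. X \<tau> (m - Suc j) (Q \<tau> (P (real (Suc j) * \<tau>) v) - P (real (Suc j) * \<tau>) v))"
proof (induction m arbitrary: v)
  case (Suc m)
  have PP: "P (real k * \<tau>) (P \<tau> v) = P (real (Suc k) * \<tau>) v" for k
    using P.add[of "real k * \<tau>" \<tau> v] \<tau> by (simp add: algebra_simps)
  let ?g = "\<lambda>j. X \<tau> (Suc m - Suc j) (Q \<tau> (P (real (Suc j) * \<tau>) v) - P (real (Suc j) * \<tau>) v)"
  have "X \<tau> (Suc m) v = X \<tau> m (P \<tau> v) + X \<tau> m (Q \<tau> (P \<tau> v) - P \<tau> v)" by (simp add: blinfun.diff_right)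
  also have "X \<tau> m (P \<tau> v) = P (real (Suc (Suc m)) * \<tau>) v + (\<Sum>j<m. ?g (Suc j))"
    by (subst Suc.IH) (simp add: PP del: of_nat_Suc)
  also have "X \<tau> m (Q \<tau> (P \<tau> v) - P \<tau> v) = ?g 0" by simp
  finally show ?case by (simp only: sum.lessThan_Suc_shift) (simp only: add_ac)
qed simp

text \<open>B commutes with its own semigroup, so (Q \<tau> - 1) u is, up to sign, an integral of B
  (Q r u); a bound on Y B turns this into a multiple of \<open>norm u\<close>, and the size of B u
  never enters.\<close>

lemma norm_Q_minus_one:
  fixes Y :: "'a \<Rightarrow>\<^sub>L 'a"
  assumes Y: "\<And>z w. (z, w) \<in> generator Q \<Longrightarrow> norm (Y w) \<le> b * norm z" and b: "b \<ge> 0"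
    and u: "u \<in> D" and \<tau>: "\<tau> \<ge> 0"
  shows "norm (Y (Q \<tau> u - u)) \<le> \<tau> * b * norm u"
proof -
  have "norm (Y (Q \<tau> u) - Y (Q 0 u)) \<le> (b * norm u) * (\<tau> - 0)"
  proof (rule norm_diff_le_of_derivative_bound[where f = "\<lambda>r. Y (Q r u)" and f' = "\<lambda>r. Y (- Q r (B u))"])
    show "continuous_on {0..\<tau>} (\<lambda>r. Y (Q r u))"
      by (intro blinfun.continuous_on continuous_on_const Q.orbit_continuous)
    fix r assume r: "0 < r" "r < \<tau>"
    show "((\<lambda>r. Y (Q r u)) has_vector_derivative Y (- Q r (B u))) (at r)"
      by (rule bounded_linear.has_vector_derivative[OF blinfun.bounded_linear_right Q.orbit_derivative[OF gen_B[OF u] r(1)]])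
    have "norm (Y (Q r (B u))) \<le> b * norm (Q r u)" using Q.invariant[OF gen_B[OF u]] r by (intro Y) auto
    also have "\<dots> \<le> b * norm u" using Q.norm_le[of r u] b r by (intro mult_left_mono) auto
    finally show "norm (Y (- Q r (B u))) \<le> b * norm u" by (simp add: blinfun.minus_right)
  qed (rule \<tau>)
  thus ?thesis by (simp add: Q.zero blinfun.diff_right mult_ac)
qed

text \<open>Discrete Gronwall. The expansion contains only \<open>X\<close> of smaller index, so
  strong induction replaces the supremum argument; 2 K comes from the P-term and 2 K from the sum,
  which \<open>\<delta>\<close> keeps small.\<close>

lemma norm_X_B_small:
  assumes \<tau>: "\<tau> > 0"
  shows "real (Suc m) * \<tau> \<le> \<delta> \<Longrightarrow> (z, w) \<in> generator Q \<Longrightarrow>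
    norm (X \<tau> m w) \<le> 4 * K * (real (Suc m) * \<tau>) powr (- \<alpha>) * norm z"
proof (induction m arbitrary: z w rule: less_induct)
  case (less m)
  define s where "s = real (Suc m) * \<tau>"
  have s: "0 < s" "s \<le> \<delta>" using less.prems \<tau> by (auto simp: s_def)
  let ?q = "\<lambda>i. (i * \<tau>) powr (- \<alpha>)"
  have small: "real i * \<tau> \<le> 1" if "i \<le> Suc m" for i
  proof -
    have "real i * \<tau> \<le> s" unfolding s_def using that \<tau> by (intro mult_right_mono) auto
    thus ?thesis using s \<delta>(2) by simp
  qed
  have Pw: "norm (P (real (Suc i) * \<tau>) w) \<le> 2 * K * ?q (real (Suc i)) * norm z" if "i \<le> m" for i
  proof -
    have "norm (P (real (Suc i) * \<tau>) w) \<le> K * sing \<alpha> (real (Suc i) * \<tau>) * norm z"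
      using \<tau> by (intro PB less.prems) simp
    also have "\<dots> \<le> K * (2 * ?q (real (Suc i))) * norm z"
      using \<tau> \<alpha> K small[of "Suc i"] that by (intro mult_right_mono mult_left_mono sing_le_powr) auto
    finally show ?thesis by (simp add: mult_ac)
  qed
  have anti: "antimono_on {0<..} ?q"
    using \<alpha> \<tau> by (intro monotone_onI powr_mono2') (auto intro: mult_right_mono)
  have sumq: "(\<Sum>j<m. ?q (real (Suc j))) \<le> \<tau> powr (- \<alpha>) * (real (Suc m) powr (1 - \<alpha>) / (1 - \<alpha>))"
  proof -
    have "(\<Sum>j<m. ?q (real (Suc j))) = \<tau> powr (- \<alpha>) * (\<Sum>j<m. real (Suc j) powr (- \<alpha>))"
      using \<tau> by (simp add: powr_mult sum_distrib_left mult.commute del: of_nat_Suc)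
    also have "\<dots> \<le> \<tau> powr (- \<alpha>) * (real m powr (1 - \<alpha>) / (1 - \<alpha>))"
      using sum_powr_le[OF \<alpha>, of m] by (intro mult_left_mono) auto
    also have "\<dots> \<le> \<tau> powr (- \<alpha>) * (real (Suc m) powr (1 - \<alpha>) / (1 - \<alpha>))"
      using \<alpha> by (intro mult_left_mono divide_right_mono powr_mono2) auto
    finally show ?thesis .
  qed
  have "norm (X \<tau> (m - Suc j) (Q \<tau> (P (real (Suc j) * \<tau>) w) - P (real (Suc j) * \<tau>) w))
      \<le> 8 * K\<^sup>2 * \<tau> * norm z * (?q (real (Suc j)) * ?q (real (m - j)))" if j: "j < m" for j
  proof -
    have "m - Suc j < m" and Sj: "Suc (m - Suc j) = m - j" using j by auto
    have "norm (X \<tau> (m - Suc j) w') \<le> 4 * K * ?q (real (m - j)) * norm z'" if "(z', w') \<in> generator Q" for z' w'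
      using less.IH[OF \<open>m - Suc j < m\<close> _ that] small[of "m - j"] unfolding Sj
      by (metis Suc_leD diff_le_self le_SucI less.prems(1) mult_right_mono of_nat_mono order_trans s_def s(2) \<tau> less_imp_le)
    hence "norm (X \<tau> (m - Suc j) (Q \<tau> (P (real (Suc j) * \<tau>) w) - P (real (Suc j) * \<tau>) w))
        \<le> \<tau> * (4 * K * ?q (real (m - j))) * norm (P (real (Suc j) * \<tau>) w)"
      using \<tau> K by (intro norm_Q_minus_one P_in_D) auto
    also have "\<dots> \<le> \<tau> * (4 * K * ?q (real (m - j))) * (2 * K * ?q (real (Suc j)) * norm z)"
      using Pw[of j] j \<tau> K by (intro mult_left_mono) auto
    finally show ?thesis by (simp add: power2_eq_square mult_ac)
  qed
  hence "norm (\<Sum>j<m. X \<tau> (m - Suc j) (Q \<tau> (P (real (Suc j) * \<tau>) w) - P (real (Suc j) * \<tau>) w))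
      \<le> (\<Sum>j<m. 8 * K\<^sup>2 * \<tau> * norm z * (?q (real (Suc j)) * ?q (real (m - j))))"
    by (intro sum_norm_le) auto
  also have "\<dots> = 8 * K\<^sup>2 * \<tau> * norm z * (\<Sum>j<m. ?q (real (Suc j)) * ?q (real (m - j)))"
    by (simp add: sum_distrib_left)
  also have "\<dots> \<le> 8 * K\<^sup>2 * \<tau> * norm z * (2 * (?q (real (Suc m) / 2) * (\<Sum>j<m. ?q (real (Suc j)))))"
    using sum_convolution_bound[OF anti anti, of m] \<tau> by (intro mult_left_mono) (auto simp: mult_ac)
  also have "\<dots> \<le> 8 * K\<^sup>2 * \<tau> * norm z * (2 * (?q (real (Suc m) / 2) *
      (\<tau> powr (- \<alpha>) * (real (Suc m) powr (1 - \<alpha>) / (1 - \<alpha>)))))"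
    using sumq \<tau> by (intro mult_left_mono) auto
  also have "\<dots> = 16 * K\<^sup>2 * norm z / (1 - \<alpha>) * ((s / 2) powr (- \<alpha>) * (\<tau> * \<tau> powr (- \<alpha>) * real (Suc m) powr (1 - \<alpha>)))"
    by (simp add: s_def mult_ac)
  \<comment> \<open>The \<tau> gained from Q - 1 is the mesh of a Riemann sum for the primitive at
    s.\<close>
  also have "\<tau> * \<tau> powr (- \<alpha>) * real (Suc m) powr (1 - \<alpha>) = s powr (1 - \<alpha>)"
  proof -
    have "\<tau> * \<tau> powr (- \<alpha>) = \<tau> powr (1 - \<alpha>)" using \<tau> by (simp add: powr_diff powr_minus_divide)
    thus ?thesis using \<tau> by (simp add: s_def powr_mult mult.commute del: of_nat_Suc)
  qed
  also have "16 * K\<^sup>2 * norm z / (1 - \<alpha>) * ((s / 2) powr (- \<alpha>) * s powr (1 - \<alpha>))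
      \<le> 16 * K\<^sup>2 * norm z / (1 - \<alpha>) * (2 * (s powr (- \<alpha>) * s powr (1 - \<alpha>)))"
    using half_powr_le[OF s(1)] \<alpha> by (intro mult_left_mono) auto
  also have "\<dots> = 4 * K * norm z * s powr (- \<alpha>) * (8 * K / (1 - \<alpha>) * s powr (1 - \<alpha>))"
    by (simp add: power2_eq_square)
  also have "\<dots> \<le> 4 * K * norm z * s powr (- \<alpha>) * (1 / 2)"
    using \<delta>(3)[OF s] K by (intro mult_left_mono) auto
  finally have sum: "norm (\<Sum>j<m. X \<tau> (m - Suc j) (Q \<tau> (P (real (Suc j) * \<tau>) w) - P (real (Suc j) * \<tau>) w))
      \<le> 2 * K * s powr (- \<alpha>) * norm z" by (simp add: mult_ac)
  have "norm (X \<tau> m w) \<le> norm (P s w) +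
      norm (\<Sum>j<m. X \<tau> (m - Suc j) (Q \<tau> (P (real (Suc j) * \<tau>) w) - P (real (Suc j) * \<tau>) w))"
    unfolding s_def using \<tau> by (subst X_expand) (auto intro: norm_triangle_ineq)
  also have "\<dots> \<le> 2 * K * s powr (- \<alpha>) * norm z + 2 * K * s powr (- \<alpha>) * norm z"
    using Pw[of m] sum by (intro add_mono) (auto simp: s_def)
  finally show ?case by (simp add: s_def mult_ac)
qed

text \<open>The last grid time not exceeding \<open>\<delta>\<close> is at least \<delta> / 2, which
  costs a factor 2.\<close>

definition K3 where "K3 = K1 * 2"

text \<open>P (Q P)^m = (P Q)^m P. The defining recursion peels factors off the right, for the
  Duhamel expansion; this form peels contractions off the left, for monotonicity and for
  powers.\<close>

lemma X_commute: "X \<tau> (Suc m) v = P \<tau> (Q \<tau> (X \<tau> m v))"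
  by (induction m arbitrary: v) simp_all

lemma norm_X_antimono:
  assumes \<tau>: "\<tau> \<ge> 0" and "k \<le> m"
  shows "norm (X \<tau> m w) \<le> norm (X \<tau> k w)"
  using \<open>k \<le> m\<close>
proof (induction m rule: dec_induct)
  case (step m)
  thus ?case unfolding X_commute using P.norm_le[OF \<tau>] Q.norm_le[OF \<tau>] by (meson order_trans)
qed simp

text \<open>Further factors on the left only decrease the norm, so beyond \<open>\<delta>\<close> an
  earlier index suffices. If \<tau> itself exceeds \<open>\<delta>\<close>, that index is 0, where
  \<open>PB\<close> applies.\<close>

lemma norm_X_B:
  assumes \<tau>: "\<tau> > 0" and zw: "(z, w) \<in> generator Q"
  shows "norm (X \<tau> m w) \<le> K3 * sing \<alpha> (real (Suc m) * \<tau>) * norm z"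
proof -
  have bound: "norm (X \<tau> m w) \<le> c * norm z \<Longrightarrow> c \<le> K3 * sing \<alpha> (real (Suc m) * \<tau>) \<Longrightarrow> ?thesis" for c
    by (meson mult_right_mono norm_ge_zero order_trans)
  have one: "K3 \<le> K3 * sing \<alpha> (real (Suc m) * \<tau>)"
    using sing_ge_1[of \<alpha> "real (Suc m) * \<tau>"] K1 by (simp add: K3_def)
  consider "real (Suc m) * \<tau> \<le> \<delta>" | "real (Suc m) * \<tau> > \<delta>" "\<tau> \<le> \<delta>" | "\<tau> > \<delta>" by linarith
  thus ?thesis
  proof cases
    case 1
    have "4 * K * (real (Suc m) * \<tau>) powr (- \<alpha>) \<le> K3 * sing \<alpha> (real (Suc m) * \<tau>)"
      using K1 K by (intro mult_mono) (auto simp: K3_def sing_def)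
    thus ?thesis using bound norm_X_B_small[OF \<tau> 1 zw] by blast
  next
    case 2
    \<comment> \<open>k + 1 is the number of whole steps fitting into \<open>\<delta>\<close>;
      \<open>fl\<close> ensures that the natural subtraction does not truncate.\<close>
    define k where "k = nat \<lfloor>\<delta> / \<tau>\<rfloor> - 1"
    have fl: "1 \<le> \<lfloor>\<delta> / \<tau>\<rfloor>" using 2 \<tau> by simp
    hence Sk: "real (Suc k) = of_int \<lfloor>\<delta> / \<tau>\<rfloor>" by (simp add: k_def)
    have k1: "real (Suc k) * \<tau> \<le> \<delta>" unfolding Sk using \<tau> by (simp flip: pos_le_divide_eq)
    have "\<delta> / \<tau> < 2 * real (Suc k)" unfolding Sk using fl by linarith
    hence k2: "\<delta> / 2 \<le> real (Suc k) * \<tau>" using \<tau> by (simp add: pos_divide_less_eq del: of_nat_Suc)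
    have "real (Suc k) * \<tau> < real (Suc m) * \<tau>" using k1 2 by linarith
    hence "k \<le> m" using \<tau> by simp
    hence "norm (X \<tau> m w) \<le> norm (X \<tau> k w)" using \<tau> by (intro norm_X_antimono) auto
    also have "\<dots> \<le> 4 * K * (real (Suc k) * \<tau>) powr (- \<alpha>) * norm z" by (rule norm_X_B_small[OF \<tau> k1 zw])
    finally have "norm (X \<tau> m w) \<le> 4 * K * (real (Suc k) * \<tau>) powr (- \<alpha>) * norm z" .
    moreover have "4 * K * (real (Suc k) * \<tau>) powr (- \<alpha>) \<le> K3"
    proof -
      have "(real (Suc k) * \<tau>) powr (- \<alpha>) \<le> (\<delta> / 2) powr (- \<alpha>)"
        using k2 \<delta>(1) \<alpha> by (intro powr_mono2') auto
      also have "\<dots> = \<delta> powr (- \<alpha>) * 2 powr \<alpha>"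
        using \<delta>(1) by (subst powr_divide) (auto simp: powr_minus_divide)
      also have "\<dots> \<le> \<delta> powr (- \<alpha>) * 2 powr 1" using \<alpha> by (intro mult_left_mono powr_mono) auto
      finally have "4 * K * (real (Suc k) * \<tau>) powr (- \<alpha>) \<le> 4 * K * (\<delta> powr (- \<alpha>) * 2)"
        using K by (intro mult_left_mono) auto
      thus ?thesis by (simp add: K3_def K1_def mult_ac)
    qed
    ultimately show ?thesis using bound one by (meson order_trans)
  next
    case 3
    have "norm (X \<tau> m w) \<le> norm (X \<tau> 0 w)" using \<tau> by (intro norm_X_antimono) auto
    also have "\<dots> \<le> K * sing \<alpha> \<tau> * norm z" using PB[OF \<tau> zw] by simp
    finally have "norm (X \<tau> m w) \<le> K * sing \<alpha> \<tau> * norm z" .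
    moreover have "K * sing \<alpha> \<tau> \<le> K3"
    proof -
      have "sing \<alpha> \<tau> \<le> sing \<alpha> \<delta>" using 3 \<delta>(1) \<alpha> by (intro sing_antimono) auto
      also have "\<dots> \<le> 2 * \<delta> powr (- \<alpha>)" using \<delta>(1,2) \<alpha> by (intro sing_le_powr) auto
      finally have "K * sing \<alpha> \<tau> \<le> K * (2 * \<delta> powr (- \<alpha>))" using K by (intro mult_left_mono) auto
      also have "\<dots> \<le> K3" using K by (simp add: K3_def K1_def)
      finally show ?thesis .
    qed
    ultimately show ?thesis using bound one by (meson order_trans)
  qed
qed

definition K4 where "K4 = 1 + 6 * K3 / (1 - \<alpha>)"

lemma K3: "K3 \<ge> 1" using K1 by (simp add: K3_def)

lemma K4: "K4 \<ge> 1" using K3 \<alpha> by (simp add: K4_def)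

text \<open>Written through the value at m + 1, because the convolution lemma multiplies the sum by
  2 / (m + 1) and so leaves a multiple of that value.\<close>

lemma sum_sing_le:
  assumes \<tau>: "\<tau> > 0"
  shows "(\<Sum>j<m. sing \<alpha> (real (Suc j) * \<tau>)) \<le> real (Suc m) * sing \<alpha> (real (Suc m) * \<tau>) / (1 - \<alpha>)"
proof -
  have "(\<Sum>j<m. sing \<alpha> (real (Suc j) * \<tau>)) = \<tau> powr (- \<alpha>) * (\<Sum>j<m. real (Suc j) powr (- \<alpha>)) + real m"
    using \<tau> by (simp add: sing_def powr_mult sum.distrib sum_distrib_left mult.commute del: of_nat_Suc)
  also have "\<dots> \<le> \<tau> powr (- \<alpha>) * (real (Suc m) powr (1 - \<alpha>) / (1 - \<alpha>)) + real (Suc m) * (1 / (1 - \<alpha>))"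
  proof (rule add_mono)
    have "(\<Sum>j<m. real (Suc j) powr (- \<alpha>)) \<le> real m powr (1 - \<alpha>) / (1 - \<alpha>)" by (rule sum_powr_le[OF \<alpha>])
    also have "\<dots> \<le> real (Suc m) powr (1 - \<alpha>) / (1 - \<alpha>)" using \<alpha> by (intro divide_right_mono powr_mono2) auto
    finally show "\<tau> powr (- \<alpha>) * (\<Sum>j<m. real (Suc j) powr (- \<alpha>)) \<le>
        \<tau> powr (- \<alpha>) * (real (Suc m) powr (1 - \<alpha>) / (1 - \<alpha>))" by (rule mult_left_mono) simp
    have "real m * 1 \<le> real (Suc m) * (1 / (1 - \<alpha>))" using \<alpha> by (intro mult_mono) auto
    thus "real m \<le> real (Suc m) * (1 / (1 - \<alpha>))" by simp
  qed
  also have "real (Suc m) powr (1 - \<alpha>) = real (Suc m) * real (Suc m) powr (- \<alpha>)"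
    by (simp add: powr_diff powr_minus_divide del: of_nat_Suc)
  also have "\<tau> powr (- \<alpha>) * (real (Suc m) * real (Suc m) powr (- \<alpha>) / (1 - \<alpha>)) + real (Suc m) * (1 / (1 - \<alpha>))
      = real (Suc m) * sing \<alpha> (real (Suc m) * \<tau>) / (1 - \<alpha>)"
    using \<tau> by (simp add: sing_def powr_mult add_divide_distrib distrib_left mult_ac del: of_nat_Suc)
  finally show ?thesis .
qed

text \<open>Discrete counterpart of the decay of T. The \<tau> gained from Q - 1 cancels the one in
  V / ((j + 1) \<tau>) and leaves a harmonic sum, the source of ln n. The singular bound V / r is
  admissible because P always acts at a positive grid time.\<close>

lemma norm_X_decay:
  assumes \<tau>: "\<tau> > 0" and V: "V \<ge> 0" "\<And>r. r > 0 \<Longrightarrow> norm (P r v) \<le> V / r"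
    and n: "n \<ge> 3" and m: "m \<le> n"
  shows "norm (X \<tau> m v) \<le> K4 * V * rate n \<tau> (real (Suc m))"
proof -
  let ?p = "\<lambda>i::real. 1 / i" and ?q = "\<lambda>i. sing \<alpha> (i * \<tau>)"
  let ?S = "?q (real (Suc m))"
  have L: "ln (real n) \<ge> 1" by (rule one_le_ln[OF n])
  have S: "?S > 0" by (rule sing_pos)
  have "norm (X \<tau> (m - Suc j) (Q \<tau> (P (real (Suc j) * \<tau>) v) - P (real (Suc j) * \<tau>) v))
      \<le> K3 * V * (?p (real (Suc j)) * ?q (real (m - j)))" if j: "j < m" for j
  proof -
    have Sj: "Suc (m - Suc j) = m - j" using j by auto
    have "norm (X \<tau> (m - Suc j) w) \<le> K3 * ?q (real (m - j)) * norm z" if "(z, w) \<in> generator Q" for z w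
      using norm_X_B[OF \<tau> that, of "m - Suc j"] unfolding Sj .
    hence "norm (X \<tau> (m - Suc j) (Q \<tau> (P (real (Suc j) * \<tau>) v) - P (real (Suc j) * \<tau>) v))
        \<le> \<tau> * (K3 * ?q (real (m - j))) * norm (P (real (Suc j) * \<tau>) v)"
      using \<tau> K3 sing_pos[of \<alpha> "real (m - j) * \<tau>"] by (intro norm_Q_minus_one P_in_D) auto
    also have "\<dots> \<le> \<tau> * (K3 * ?q (real (m - j))) * (V / (real (Suc j) * \<tau>))"
      using V(2)[of "real (Suc j) * \<tau>"] \<tau> K3 sing_pos[of \<alpha> "real (m - j) * \<tau>"]
      by (intro mult_left_mono) auto
    also have "\<dots> = K3 * V * (?p (real (Suc j)) * ?q (real (m - j)))" using \<tau> by simp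
    finally show ?thesis .
  qed
  hence "norm (\<Sum>j<m. X \<tau> (m - Suc j) (Q \<tau> (P (real (Suc j) * \<tau>) v) - P (real (Suc j) * \<tau>) v))
      \<le> (\<Sum>j<m. K3 * V * (?p (real (Suc j)) * ?q (real (m - j))))"
    by (intro sum_norm_le) auto
  also have "\<dots> = K3 * V * (\<Sum>j<m. ?p (real (Suc j)) * ?q (real (m - j)))" by (simp add: sum_distrib_left)
  \<comment> \<open>6 = 2 + 4: the summed \<open>sing\<close> gives 2; the harmonic sum gives 2 ln
    n, times 2 for the midpoint.\<close>
  also have "\<dots> \<le> K3 * V * (?S * ln (real n) * (6 / (1 - \<alpha>)))"
  proof (rule mult_left_mono)
    have i1: "1 \<le> 1 / (1 - \<alpha>)" using \<alpha> by simp
    have "(\<Sum>j<m. ?p (real (Suc j)) * ?q (real (m - j))) \<le>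
      ?p (real (Suc m) / 2) * (\<Sum>j<m. ?q (real (Suc j))) + ?q (real (Suc m) / 2) * (\<Sum>j<m. ?p (real (Suc j)))"
    proof (rule sum_convolution_bound)
      show "antimono_on {0<..} ?p" by (intro monotone_onI divide_left_mono) auto
      show "antimono_on {0<..} ?q" using \<alpha> \<tau> by (intro monotone_onI sing_antimono) auto
    qed (auto intro: less_imp_le[OF sing_pos])
    also have "?p (real (Suc m) / 2) * (\<Sum>j<m. ?q (real (Suc j))) \<le>
        ?p (real (Suc m) / 2) * (real (Suc m) * ?S / (1 - \<alpha>))"
      by (intro mult_left_mono sum_sing_le[OF \<tau>]) auto
    also have "\<dots> = 2 * ?S * (1 / (1 - \<alpha>))" by (simp del: of_nat_Suc)
    also have "\<dots> \<le> 2 * ?S * (ln (real n) * (1 / (1 - \<alpha>)))"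
    proof (rule mult_left_mono)
      show "1 / (1 - \<alpha>) \<le> ln (real n) * (1 / (1 - \<alpha>))"
        using mult_right_mono[OF L, of "1 / (1 - \<alpha>)"] \<alpha> by simp
    qed (use S in simp)
    also have "?q (real (Suc m) / 2) * (\<Sum>j<m. ?p (real (Suc j))) \<le> (2 * ?S) * (2 * (ln (real n) * (1 / (1 - \<alpha>))))"
    proof (rule mult_mono)
      show "?q (real (Suc m) / 2) \<le> 2 * ?S"
        using sing_divide_le[OF \<alpha>, of "real (Suc m) * \<tau>" 2] \<tau> by simp
      have "(\<Sum>j<m. ?p (real (Suc j))) \<le> 2 * ln (real n)"
      proof (cases "m = 0")
        case False
        have "(\<Sum>j<m. ?p (real (Suc j))) \<le> 1 + ln (real m)" by (rule sum_inverse_le)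
        also have "ln (real m) \<le> ln (real n)" using False m by (intro ln_mono) auto
        finally show ?thesis using L by linarith
      qed (use L in simp)
      also have "\<dots> \<le> 2 * (ln (real n) * (1 / (1 - \<alpha>)))"
        using mult_left_mono[OF i1, of "ln (real n)"] L by simp
      finally show "(\<Sum>j<m. ?p (real (Suc j))) \<le> 2 * (ln (real n) * (1 / (1 - \<alpha>)))" .
    qed (use S in \<open>auto intro!: sum_nonneg\<close>)
    finally show "(\<Sum>j<m. ?p (real (Suc j)) * ?q (real (m - j))) \<le> ?S * ln (real n) * (6 / (1 - \<alpha>))"
      by (simp add: mult_ac)
  qed (use K3 V(1) in simp)
  also have "\<dots> = (6 * K3 / (1 - \<alpha>)) * V * (ln (real n) * ?S)" by simp
  also have "\<dots> \<le> (6 * K3 / (1 - \<alpha>)) * V * rate n \<tau> (real (Suc m))"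
    using K3 \<alpha> V(1) rate_ge(2)[OF n \<tau>, of "real (Suc m)"] by (intro mult_left_mono) auto
  finally have sum: "norm (\<Sum>j<m. X \<tau> (m - Suc j) (Q \<tau> (P (real (Suc j) * \<tau>) v) - P (real (Suc j) * \<tau>) v))
      \<le> (6 * K3 / (1 - \<alpha>)) * V * rate n \<tau> (real (Suc m))" .
  have "norm (P (real (Suc m) * \<tau>) v) \<le> V * (1 / (real (Suc m) * \<tau>))"
    using V(2)[of "real (Suc m) * \<tau>"] \<tau> by simp
  also have "\<dots> \<le> V * rate n \<tau> (real (Suc m))"
    using V(1) rate_ge(1)[OF n \<tau>, of "real (Suc m)"] by (intro mult_left_mono) auto
  finally have fst: "norm (P (real (Suc m) * \<tau>) v) \<le> V * rate n \<tau> (real (Suc m))" .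
  have "norm (X \<tau> m v) \<le> norm (P (real (Suc m) * \<tau>) v) +
      norm (\<Sum>j<m. X \<tau> (m - Suc j) (Q \<tau> (P (real (Suc j) * \<tau>) v) - P (real (Suc j) * \<tau>) v))"
    using \<tau> by (subst X_expand) (auto intro: norm_triangle_ineq)
  also have "\<dots> \<le> V * rate n \<tau> (real (Suc m)) + (6 * K3 / (1 - \<alpha>)) * V * rate n \<tau> (real (Suc m))"
    by (intro add_mono fst sum)
  also have "\<dots> = K4 * V * rate n \<tau> (real (Suc m))" by (simp add: K4_def algebra_simps)
  finally show ?thesis .
qed

text \<open>Supplies V = K r norm w for the vector \<open>P r w - w\<close> in the decay estimate of
  \<open>X\<close>.\<close>

lemma norm_P_increment:
  assumes u: "u > 0" and r: "r \<ge> 0"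
  shows "norm (P u (P r w - w)) \<le> K * r * norm w / u"
proof -
  have "P u (P r w - w) = P r (P u w) - P u w" using P.commute[of u r w] u r by (simp add: blinfun.diff_right)
  also have "norm \<dots> \<le> r * norm (A (P u w))" by (rule P.orbit_lipschitz[OF gen_A[OF P_in_D[OF u]] r])
  also have "\<dots> \<le> r * (K / u * norm w)" using norm_A_P[OF u, of w] r by (intro mult_left_mono) auto
  finally show ?thesis by (simp add: mult_ac)
qed

lemma norm_X_increment:
  assumes "\<tau> > 0" "r \<ge> 0" "n \<ge> 3" "m \<le> n"
  shows "norm (X \<tau> m (P r w - w)) \<le> K4 * K * r * rate n \<tau> (real (Suc m)) * norm w"
  using norm_X_decay[OF assms(1) _ norm_P_increment assms(3,4), of r w] assms K by (simp add: mult_ac)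

lemma norm_X_B_rate:
  assumes \<tau>: "\<tau> > 0" and n: "n \<ge> 3" and zw: "(z, w) \<in> generator Q"
  shows "norm (X \<tau> m w) \<le> K3 * rate n \<tau> (real (Suc m)) * norm z"
proof -
  have "norm (X \<tau> m w) \<le> K3 * sing \<alpha> (real (Suc m) * \<tau>) * norm z" by (rule norm_X_B[OF \<tau> zw])
  also have "\<dots> \<le> K3 * rate n \<tau> (real (Suc m)) * norm z"
    using K3 rate_ge(3)[OF n \<tau>, of "real (Suc m)"] by (intro mult_right_mono mult_left_mono) auto
  finally show ?thesis .
qed

section \<open>Graph bounds and the local error\<close>

definition K5 where "K5 = K * K2 + 2 * K1 + K + K\<^sup>2"
text \<open>Dominates at once \<open>K5\<close> for A + B, \<open>K * (1 + K5)\<close> for A, and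
  their sum for B.\<close>

definition K6 where "K6 = (1 + K) * (1 + K5)"

lemma K5: "K5 \<ge> 1"
proof -
  have "K * K2 \<ge> 0" "K\<^sup>2 \<ge> 0" using K K2 by auto
  thus ?thesis using K1 K unfolding K5_def by linarith
qed

lemma K6: "K6 \<ge> 1" "K5 \<le> K6" "K * (1 + K5) \<le> K6" "K5 + K * (1 + K5) \<le> K6"
  using K K5 by (simp_all add: K6_def algebra_simps)

text \<open>A + B commutes with T, so it is estimated first, on \<open>P \<tau> y\<close>: the
  A-part by the decay lemma with V = K norm y, the B-part by the bound on T B. The relative bounds
  then separate A and B.\<close>

lemma T_P_graph_bound:
  fixes y :: 'a
  assumes \<tau>: "\<tau> > 0" and n: "n \<ge> 3" and k: "k \<le> n"
  defines "x \<equiv> T (real k * \<tau>) (P \<tau> y)"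
  shows "x \<in> D" "norm x \<le> norm y"
    "norm (A x + B x) \<le> K6 * rate n \<tau> (real (Suc k)) * norm y"
    "norm (A x) \<le> K6 * rate n \<tau> (real (Suc k)) * norm y"
    "norm (B x) \<le> K6 * rate n \<tau> (real (Suc k)) * norm y"
proof -
  define E where "E = rate n \<tau> (real (Suc k))"
  have E: "E \<ge> 1" "sing \<alpha> (real (Suc k) * \<tau>) \<le> E" "1 / (real (Suc k) * \<tau>) \<le> E"
    unfolding E_def using rate_ge[OF n \<tau>, of "real (Suc k)"] by auto
  have kt: "real k * \<tau> \<ge> 0" using \<tau> by simp
  have Py: "P \<tau> y \<in> D" by (rule P_in_D[OF \<tau>])
  show xD: "x \<in> D" and "norm x \<le> norm y"
    using T_invariant[OF Py kt] T.norm_le[OF kt, of "P \<tau> y"] P.norm_le[of \<tau> y] \<tau> by (auto simp: x_def)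
  have Ax: "norm (T (real k * \<tau>) (A (P \<tau> y))) \<le> K2 * (K * norm y) * E" unfolding E_def
  proof (rule norm_T_decay_discrete[OF _ \<tau> _ _ n k])
    \<comment> \<open>Halving \<tau> leaves a factor \<open>P (\<tau> / 2)\<close> in front, which
      puts \<open>A (P \<tau> y)\<close> into \<open>D\<close>.\<close>
    have "P (\<tau> / 2) (P (\<tau> / 2) y) = P \<tau> y" using P.add[of "\<tau> / 2" "\<tau> / 2" y] \<tau> by simp
    hence "A (P \<tau> y) = P (\<tau> / 2) (A (P (\<tau> / 2) y))"
      using P_invariant[OF P_in_D, of "\<tau> / 2" "\<tau> / 2" y] \<tau> by simp
    thus "A (P \<tau> y) \<in> D" using P_in_D[of "\<tau> / 2"] \<tau> by simp
    fix r :: real assume r: "r \<ge> 0"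
    have "P r (A (P \<tau> y)) = A (P (r + \<tau>) y)" using P_invariant[OF Py r] P.add[of r \<tau> y] r \<tau> by simp
    thus "norm (P r (A (P \<tau> y))) \<le> K * norm y / (r + \<tau>)" using norm_A_P[of "r + \<tau>" y] r \<tau> by simp
  qed (use K in simp)
  have Bx: "norm (T (real k * \<tau>) (B (P \<tau> y))) \<le> (2 * K1 + K + K\<^sup>2) * E * norm y"
  proof (cases "k = 0")
    case True
    \<comment> \<open>At k = 0 no T is left to smooth; the bound relative to A costs a multiple of 1
      / \<tau>, just what the rate permits at the first grid time.\<close>
    have "norm (B (P \<tau> y)) \<le> K * (norm (P \<tau> y) + norm (A (P \<tau> y)))" by (rule relB[OF gen_A[OF Py] gen_B[OF Py]])
    also have "\<dots> \<le> K * (norm y + K / \<tau> * norm y)"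
      using P.norm_le[of \<tau> y] norm_A_P[OF \<tau>, of y] \<tau> K by (intro mult_left_mono add_mono) auto
    also have "\<dots> = (K * 1 + K\<^sup>2 * (1 / \<tau>)) * norm y" by (simp add: power2_eq_square algebra_simps)
    also have "\<dots> \<le> (K * E + K\<^sup>2 * E) * norm y"
      using E K True by (intro mult_right_mono add_mono mult_left_mono) auto
    also have "\<dots> \<le> (2 * K1 + K + K\<^sup>2) * E * norm y"
      using K1 E by (intro mult_right_mono) (auto simp: distrib_right)
    finally show ?thesis using True by (simp add: T.zero)
  next
    case False
    have kt': "real k * \<tau> > 0" using False \<tau> by simp
    have "sing \<alpha> (real k * \<tau>) \<le> sing \<alpha> (real (Suc k) * \<tau> / 2)"
    proof (rule sing_antimono)
      have "real (Suc k) * \<tau> \<le> 2 * real k * \<tau>" using \<tau> False by (intro mult_right_mono) auto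
      thus "real (Suc k) * \<tau> / 2 \<le> real k * \<tau>" by simp
    qed (use \<alpha> \<tau> in auto)
    also have "\<dots> \<le> 2 * sing \<alpha> (real (Suc k) * \<tau>)" using \<alpha> \<tau> by (intro sing_divide_le) auto
    also have "\<dots> \<le> 2 * E" using E by simp
    finally have S: "sing \<alpha> (real k * \<tau>) \<le> 2 * E" .
    have "norm (T (real k * \<tau>) (B (P \<tau> y))) \<le> K1 * sing \<alpha> (real k * \<tau>) * norm (P \<tau> y)"
      by (rule norm_T_B[OF gen_B[OF Py] kt'])
    also have "\<dots> \<le> K1 * (2 * E) * norm y"
      using S K1 P.norm_le[of \<tau> y] \<tau> E sing_pos[of \<alpha> "real k * \<tau>"] by (intro mult_mono mult_left_mono) auto
    also have "\<dots> \<le> (2 * K1 + K + K\<^sup>2) * E * norm y"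
      using K E by (intro mult_right_mono) (auto simp: distrib_right)
    finally show ?thesis .
  qed
  have "A x + B x = T (real k * \<tau>) (A (P \<tau> y)) + T (real k * \<tau>) (B (P \<tau> y))"
    using T_invariant[OF Py kt] by (simp add: x_def blinfun.add_right)
  also have "norm \<dots> \<le> K2 * (K * norm y) * E + (2 * K1 + K + K\<^sup>2) * E * norm y"
    by (rule norm_triangle_le) (rule add_mono[OF Ax Bx])
  also have "\<dots> = K5 * E * norm y" by (simp add: K5_def algebra_simps)
  finally have H: "norm (A x + B x) \<le> K5 * E * norm y" .
  have xe: "norm x \<le> E * norm y"
    using \<open>norm x \<le> norm y\<close> mult_right_mono[OF E(1), of "norm y"] by simp
  have "K * (norm x + norm (A x + B x)) \<le> K * (E * norm y + K5 * E * norm y)"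
    using K xe H by (intro mult_left_mono) auto
  also have "\<dots> = K * (1 + K5) * (E * norm y)" by (simp add: algebra_simps)
  finally have K': "K * (norm x + norm (A x + B x)) \<le> K * (1 + K5) * (E * norm y)" .
  have Ey: "E * norm y \<ge> 0" using E by simp
  have "norm (A x + B x) \<le> K6 * (E * norm y)"
    using H mult_right_mono[OF K6(2) Ey] by (simp add: mult.assoc)
  thus "norm (A x + B x) \<le> K6 * rate n \<tau> (real (Suc k)) * norm y" by (simp add: E_def mult.assoc)
  have "norm (A x) \<le> K6 * (E * norm y)"
    using norm_AB_le(1)[OF xD] K' mult_right_mono[OF K6(3) Ey] by linarith
  thus "norm (A x) \<le> K6 * rate n \<tau> (real (Suc k)) * norm y" by (simp add: E_def mult.assoc)
  have "norm (B x) \<le> K6 * (E * norm y)"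
    using norm_AB_le(2)[OF xD] K' H mult_right_mono[OF K6(4) Ey] by (simp add: distrib_right mult.assoc)
  thus "norm (B x) \<le> K6 * rate n \<tau> (real (Suc k)) * norm y" by (simp add: E_def mult.assoc)
qed

definition K7 where "K7 = 3 * K\<^sup>2 * K4 + 3 * K3"

text \<open>The path \<open>Q r (P \<tau> x) - P (\<tau> - r) (T r x)\<close> runs from 0 to the
  error. With b = B (T r x), its derivative is (P (\<tau> - r) - 1) b plus B (T r x - Q r (P \<tau>
  x)). To the right of \<open>X\<close> the first is an increment and the second a B-term, each of
  order \<tau>; integration over r gives the other \<tau>.\<close>

lemma local_error:
  assumes \<tau>: "\<tau> > 0" and n: "n \<ge> 3" and m: "m \<le> n" and x: "x \<in> D"
    and G: "norm x \<le> G" "norm (A x + B x) \<le> G" "norm (A x) \<le> G" "norm (B x) \<le> G"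
  shows "norm (X \<tau> m (Q \<tau> (P \<tau> x) - T \<tau> x)) \<le> K7 * (\<tau>\<^sup>2 * rate n \<tau> (real (Suc m)) * G)"
proof -
  define E where "E = rate n \<tau> (real (Suc m))"
  have E: "E \<ge> 0" unfolding E_def using rate_ge(5)[OF n \<tau>] by simp
  have G0: "G \<ge> 0" using G(1) norm_ge_zero order_trans by blast
  have Px: "P \<tau> x \<in> D" by (rule P_in_D[OF \<tau>])
  let ?h = "\<lambda>r. X \<tau> m (Q r (P \<tau> x) - P (\<tau> - r) (T r x))"
  let ?h' = "\<lambda>r. X \<tau> m (- Q r (B (P \<tau> x)) - - P (\<tau> - r) (B (T r x)))"
  have "norm (?h \<tau> - ?h 0) \<le> (K7 * (\<tau> * E * G)) * (\<tau> - 0)"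
  proof (rule norm_diff_le_of_derivative_bound[where f' = ?h'])
    show "continuous_on {0..\<tau>} ?h"
      by (intro blinfun.continuous_on continuous_on_const continuous_on_diff Q.orbit_continuous
          P.continuous_compose T.orbit_continuous continuous_on_id) auto
    fix r assume r: "0 < r" "r < \<tau>"
    show "(?h has_vector_derivative ?h' r) (at r)"
      by (rule bounded_linear.has_vector_derivative[OF blinfun.bounded_linear_right
            has_vector_derivative_diff[OF Q.orbit_derivative[OF gen_B[OF Px] r(1)] P_T_derivative[OF x r]]])
    define b where "b = B (T r x)"
    have Tx: "T r x \<in> D" "A (T r x) + B (T r x) = T r (A x + B x)" using T_invariant[OF x] r by auto
    have TH: "norm (T r (A x + B x)) \<le> G" using T.norm_le[of r "A x + B x"] G(2) r by simp
    have Tn: "norm (T r x) \<le> G" using T.norm_le[of r x] G(1) r by simp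
    have "norm b \<le> norm (T r (A x + B x)) + K * (norm (T r x) + norm (T r (A x + B x)))"
      using norm_AB_le(2)[OF Tx(1)] by (simp add: b_def Tx(2))
    also have "\<dots> \<le> K * G + K * (G + G)"
      using TH Tn K G0 mult_right_mono[OF K G0] by (intro add_mono mult_left_mono) auto
    finally have b: "norm b \<le> 3 * K * G" by (simp add: mult_ac)
    have "norm (X \<tau> m (P (\<tau> - r) b - b)) \<le> K4 * K * (\<tau> - r) * E * norm b"
      unfolding E_def using r by (intro norm_X_increment[OF \<tau> _ n m]) auto
    also have "\<dots> \<le> K4 * K * \<tau> * E * (3 * K * G)"
      using r K4 K E b by (intro mult_mono mult_right_mono mult_left_mono) auto
    finally have 1: "norm (X \<tau> m (P (\<tau> - r) b - b)) \<le> 3 * K\<^sup>2 * K4 * (\<tau> * E * G)"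
      by (simp add: power2_eq_square mult_ac)
    \<comment> \<open>One error of size \<tau> G each for replacing \<open>T r\<close>,
      \<open>Q r\<close> and \<open>P \<tau>\<close> by the identity.\<close>
    have "T r x - Q r (P \<tau> x) = (T r x - x) + ((x - Q r x) + Q r (x - P \<tau> x))"
      by (simp add: blinfun.diff_right)
    also have "norm \<dots> \<le> \<tau> * G + (\<tau> * G + \<tau> * G)"
    proof (intro norm_triangle_le add_mono)
      have "norm (T r x - x) \<le> r * norm (A x + B x)" using r by (intro T.orbit_lipschitz[OF gen_T[OF x]]) auto
      also have "\<dots> \<le> \<tau> * G" using r G(2) by (intro mult_mono) auto
      finally show "norm (T r x - x) \<le> \<tau> * G" .
      have "norm (Q r x - x) \<le> r * norm (B x)" using r by (intro Q.orbit_lipschitz[OF gen_B[OF x]]) auto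
      also have "\<dots> \<le> \<tau> * G" using r G(4) by (intro mult_mono) auto
      finally show "norm (x - Q r x) \<le> \<tau> * G" by (simp add: norm_minus_commute)
      have "norm (Q r (x - P \<tau> x)) \<le> norm (P \<tau> x - x)" using Q.norm_le[of r "x - P \<tau> x"] r by (simp add: norm_minus_commute)
      also have "\<dots> \<le> \<tau> * norm (A x)" using \<tau> by (intro P.orbit_lipschitz[OF gen_A[OF x]]) auto
      also have "\<dots> \<le> \<tau> * G" using \<tau> G(3) by (intro mult_left_mono) auto
      finally show "norm (Q r (x - P \<tau> x)) \<le> \<tau> * G" .
    qed
    finally have d: "norm (T r x - Q r (P \<tau> x)) \<le> 3 * (\<tau> * G)" by (simp add: mult_ac)
    have "(T r x - Q r (P \<tau> x), b - Q r (B (P \<tau> x))) \<in> generator Q"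
      unfolding b_def using r by (intro generator_diff gen_B[OF Tx(1)] Q.invariant[OF gen_B[OF Px]]) auto
    hence "norm (X \<tau> m (b - Q r (B (P \<tau> x)))) \<le> K3 * E * norm (T r x - Q r (P \<tau> x))"
      unfolding E_def by (rule norm_X_B_rate[OF \<tau> n])
    also have "\<dots> \<le> K3 * E * (3 * (\<tau> * G))" using d K3 E by (intro mult_left_mono) auto
    finally have 2: "norm (X \<tau> m (b - Q r (B (P \<tau> x)))) \<le> 3 * K3 * (\<tau> * E * G)" by (simp add: mult_ac)
    have "?h' r = X \<tau> m (P (\<tau> - r) b - b) + X \<tau> m (b - Q r (B (P \<tau> x)))"
      by (simp add: b_def blinfun.bilinear_simps)
    also have "norm \<dots> \<le> 3 * K\<^sup>2 * K4 * (\<tau> * E * G) + 3 * K3 * (\<tau> * E * G)"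
      by (rule norm_triangle_le) (rule add_mono[OF 1 2])
    also have "\<dots> = K7 * (\<tau> * E * G)" by (simp add: K7_def algebra_simps)
    finally show "norm (?h' r) \<le> K7 * (\<tau> * E * G)" .
  qed (use \<tau> in simp)
  thus ?thesis by (simp add: P.zero Q.zero T.zero blinfun.diff_right E_def power2_eq_square mult_ac)
qed

section \<open>Telescoping the error\<close>

lemma blinfun_pow_eq_X: "blinfun_pow (Suc m) (P \<tau> o\<^sub>L Q \<tau>) v = X \<tau> m (Q \<tau> v)"
  by (induction m arbitrary: v) (simp_all add: X_commute del: X.simps(2))

definition K8 where "K8 = 2 * K * K4 + 2 * K3 + K7 * K6 + K6 + 4 * K * K2"

lemma K7: "K7 \<ge> 0" using K K4 K3 by (simp add: K7_def)

lemma K8: "K8 \<ge> 0" unfolding K8_def using K K2 K3 K4 K6(1) K7 by (intro add_nonneg_nonneg mult_nonneg_nonneg) auto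

text \<open>Besides the telescoping sum (b) there are the corrections for the auxiliary
  \<open>P \<tau>\<close>: inserting it to the right of the power (a), removing it to the left (c)
  and to the right (d) of T. \<open>K8\<close> adds up the four constants.\<close>

lemma product_error_on_domain:
  assumes \<tau>: "\<tau> > 0" and n: "n \<ge> 3" and y: "y \<in> D"
  shows "norm (blinfun_pow n (P \<tau> o\<^sub>L Q \<tau>) y - T (real n * \<tau>) y) \<le>
    K8 * (\<tau> * rate n \<tau> (real n) + \<tau>\<^sup>2 * (\<Sum>m<n. rate n \<tau> (real (Suc m)) * rate n \<tau> (real (n - m)))) * norm y"
proof -
  define E where "E = rate n \<tau> (real n)"
  define S where "S = (\<Sum>m<n. rate n \<tau> (real (Suc m)) * rate n \<tau> (real (n - m)))"
  obtain p where p: "n = Suc p" using n by (cases n) auto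
  have E: "E \<ge> 0" unfolding E_def using rate_ge(5)[OF n \<tau>] n by simp
  have S: "S \<ge> 0" unfolding S_def using rate_ge(5)[OF n \<tau>] by (intro sum_nonneg mult_nonneg_nonneg) auto
  have E': "rate n \<tau> (real (Suc n)) \<le> E" unfolding E_def using n by (intro rate_antimono \<tau>) auto
  have PP: "P \<tau> (P \<tau> y) = P (2 * \<tau>) y" using P.add[of \<tau> \<tau> y] \<tau> by simp
  have Py: "P \<tau> y \<in> D" by (rule P_in_D[OF \<tau>])
  have yn: "norm y \<ge> 0" by simp

  have a: "norm (blinfun_pow n (P \<tau> o\<^sub>L Q \<tau>) y - X \<tau> n (P \<tau> y)) \<le> (2 * K * K4 + 2 * K3) * (\<tau> * E * norm y)"
  proof -
    \<comment> \<open>The power is X p Q, and X n P is X p Q applied after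
      \<open>P (2 * \<tau>)\<close>, so the difference is X p Q u; splitting Q = (Q - 1) + 1 yields
      a B-term and an increment.\<close>
    define u where "u = y - P (2 * \<tau>) y"
    have u: "u \<in> D" unfolding u_def using \<tau> by (intro D_diff y P_in_D) auto
    have un: "norm u \<le> 2 * norm y"
      unfolding u_def using norm_triangle_ineq4[of y "P (2 * \<tau>) y"] P.norm_le[of "2 * \<tau>" y] \<tau> by simp
    have "blinfun_pow n (P \<tau> o\<^sub>L Q \<tau>) y - X \<tau> n (P \<tau> y) = X \<tau> p (Q \<tau> u - u) - X \<tau> p (P (2 * \<tau>) y - y)"
      unfolding p blinfun_pow_eq_X by (simp add: PP u_def blinfun.diff_right)
    also have "norm \<dots> \<le> norm (X \<tau> p (Q \<tau> u - u)) + norm (X \<tau> p (P (2 * \<tau>) y - y))"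
      by (rule norm_triangle_ineq4)
    also have "norm (X \<tau> p (Q \<tau> u - u)) \<le> \<tau> * (K3 * E) * norm u"
      using norm_X_B_rate[OF \<tau> n, of _ _ p] K3 E u \<tau>
      by (intro norm_Q_minus_one) (auto simp: E_def p)
    also have "\<dots> \<le> \<tau> * (K3 * E) * (2 * norm y)" using un \<tau> K3 E by (intro mult_left_mono) auto
    also have "norm (X \<tau> p (P (2 * \<tau>) y - y)) \<le> K4 * K * (2 * \<tau>) * E * norm y"
      using norm_X_increment[OF \<tau>, of "2 * \<tau>" n p y] n \<tau> p by (simp add: E_def)
    finally show ?thesis by (simp add: algebra_simps)
  qed

  have b: "norm (X \<tau> n (P \<tau> y) - P \<tau> (T (real n * \<tau>) (P \<tau> y))) \<le> K7 * K6 * (\<tau>\<^sup>2 * S * norm y)"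
  proof -
    \<comment> \<open>Runs from \<open>P \<tau> (T (real n * \<tau>) (P \<tau> y))\<close> at 0 to
      \<open>X \<tau> n (P \<tau> y)\<close> at n; neighbouring values differ by one local
      error.\<close>
    define g where "g m = X \<tau> m (T (real (n - m) * \<tau>) (P \<tau> y))" for m
    have "norm (g (Suc m) - g m) \<le> K7 * K6 * (\<tau>\<^sup>2 * norm y) * (rate n \<tau> (real (Suc m)) * rate n \<tau> (real (n - m)))"
      if m: "m < n" for m
    proof -
      define k where "k = n - Suc m"
      have k: "n - m = Suc k" "k \<le> n" using m by (auto simp: k_def)
      define x where "x = T (real k * \<tau>) (P \<tau> y)"
      have Tk: "T (real (Suc k) * \<tau>) (P \<tau> y) = T \<tau> x"
        using T.add[of \<tau> "real k * \<tau>" "P \<tau> y"] \<tau> by (simp add: x_def algebra_simps)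
      have gd: "g (Suc m) - g m = X \<tau> m (Q \<tau> (P \<tau> x) - T \<tau> x)"
        unfolding g_def k(1) Tk by (simp add: k_def[symmetric] x_def blinfun.diff_right)
      note tp = T_P_graph_bound[OF \<tau> n k(2), of y, folded x_def]
      have "norm y \<le> K6 * rate n \<tau> (real (Suc k)) * norm y"
      proof -
        have "1 * 1 \<le> K6 * rate n \<tau> (real (Suc k))"
          using K6(1) rate_ge(4)[OF n \<tau>, of "real (Suc k)"] by (intro mult_mono) auto
        thus ?thesis using mult_right_mono[OF _ yn, of 1] by simp
      qed
      hence "norm x \<le> K6 * rate n \<tau> (real (Suc k)) * norm y" using tp(2) by linarith
      hence "norm (X \<tau> m (Q \<tau> (P \<tau> x) - T \<tau> x)) \<le>
          K7 * (\<tau>\<^sup>2 * rate n \<tau> (real (Suc m)) * (K6 * rate n \<tau> (real (Suc k)) * norm y))"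
        using m by (intro local_error[OF \<tau> n _ tp(1)] tp(3-5)) auto
      thus ?thesis unfolding gd k(1) by (simp add: mult_ac)
    qed
    hence "norm (\<Sum>m<n. g (Suc m) - g m) \<le>
        (\<Sum>m<n. K7 * K6 * (\<tau>\<^sup>2 * norm y) * (rate n \<tau> (real (Suc m)) * rate n \<tau> (real (n - m))))"
      by (intro sum_norm_le) auto
    also have "\<dots> = K7 * K6 * (\<tau>\<^sup>2 * S * norm y)" by (simp add: S_def sum_distrib_left mult_ac)
    also have "(\<Sum>m<n. g (Suc m) - g m) = g n - g 0" by (rule sum_lessThan_telescope)
    finally show ?thesis by (simp add: g_def T.zero)
  qed

  have c: "norm (P \<tau> (T (real n * \<tau>) (P \<tau> y)) - T (real n * \<tau>) (P \<tau> y)) \<le> K6 * (\<tau> * E * norm y)"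
  proof -
    note tp = T_P_graph_bound[OF \<tau> n order_refl, of y]
    have "norm (P \<tau> (T (real n * \<tau>) (P \<tau> y)) - T (real n * \<tau>) (P \<tau> y)) \<le> \<tau> * norm (A (T (real n * \<tau>) (P \<tau> y)))"
      using \<tau> by (intro P.orbit_lipschitz[OF gen_A[OF tp(1)]]) auto
    also have "\<dots> \<le> \<tau> * (K6 * rate n \<tau> (real (Suc n)) * norm y)" using tp(4) \<tau> by (intro mult_left_mono) auto
    also have "\<dots> \<le> \<tau> * (K6 * E * norm y)"
      using E' K6(1) \<tau> by (intro mult_left_mono mult_right_mono) auto
    finally show ?thesis by (simp add: mult_ac)
  qed

  have d: "norm (T (real n * \<tau>) (P \<tau> y - y)) \<le> 4 * K * K2 * (\<tau> * E * norm y)"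
  proof -
    have "norm (T (real n * \<tau>) (P \<tau> y - y)) \<le> K2 * (4 * K * \<tau> * norm y) * rate n \<tau> (real (Suc n))"
    proof (rule norm_T_decay_discrete[OF D_diff[OF Py y] \<tau> _ _ n order_refl])
      fix r :: real assume r: "r \<ge> 0"
      \<comment> \<open>For r \<le> \<tau> contractivity gives 2 norm y times 2 \<tau>; for larger r
        the increment bound K \<tau> norm y / r meets r + \<tau> \<le> 2 r. The constant 4 K covers
        both.\<close>
      have "norm (P r (P \<tau> y - y)) * (r + \<tau>) \<le> 4 * K * \<tau> * norm y"
      proof (cases "r \<le> \<tau>")
        case True
        have "norm (P r (P \<tau> y - y)) \<le> 2 * norm y"
          using P.norm_le[OF r, of "P \<tau> y - y"] norm_triangle_ineq4[of "P \<tau> y" y] P.norm_le[of \<tau> y] \<tau> by simp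
        hence "norm (P r (P \<tau> y - y)) * (r + \<tau>) \<le> (2 * norm y) * (2 * \<tau>)"
          using True r \<tau> by (intro mult_mono) auto
        also have "\<dots> = 1 * (4 * \<tau> * norm y)" by simp
        also have "\<dots> \<le> K * (4 * \<tau> * norm y)" using K \<tau> by (intro mult_right_mono) auto
        finally show ?thesis by simp
      next
        case False
        hence r0: "r > 0" using \<tau> by simp
        have "norm (P r (P \<tau> y - y)) * (r + \<tau>) \<le> (K * \<tau> * norm y / r) * (2 * r)"
          using norm_P_increment[OF r0, of \<tau> y] False r0 \<tau> K by (intro mult_mono) auto
        also have "\<dots> = 2 * (K * \<tau> * norm y)" using r0 by simp
        also have "\<dots> \<le> 4 * K * \<tau> * norm y" using K \<tau> by simp
        finally show ?thesis .
      qed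
      thus "norm (P r (P \<tau> y - y)) \<le> 4 * K * \<tau> * norm y / (r + \<tau>)" using r \<tau> by (simp add: pos_le_divide_eq)
    qed (use K \<tau> in simp)
    also have "\<dots> \<le> K2 * (4 * K * \<tau> * norm y) * E" using E' K2 K \<tau> by (intro mult_left_mono) auto
    finally show ?thesis by (simp add: mult_ac)
  qed

  have "blinfun_pow n (P \<tau> o\<^sub>L Q \<tau>) y - T (real n * \<tau>) y =
      ((blinfun_pow n (P \<tau> o\<^sub>L Q \<tau>) y - X \<tau> n (P \<tau> y)) + (X \<tau> n (P \<tau> y) - P \<tau> (T (real n * \<tau>) (P \<tau> y)))) +
      ((P \<tau> (T (real n * \<tau>) (P \<tau> y)) - T (real n * \<tau>) (P \<tau> y)) + T (real n * \<tau>) (P \<tau> y - y))"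
    by (simp add: blinfun.diff_right)
  also have "norm \<dots> \<le> ((2 * K * K4 + 2 * K3) * (\<tau> * E * norm y) + K7 * K6 * (\<tau>\<^sup>2 * S * norm y)) +
      (K6 * (\<tau> * E * norm y) + 4 * K * K2 * (\<tau> * E * norm y))"
    by (intro norm_triangle_le add_mono a b c d)
  also have "\<dots> \<le> K8 * (\<tau> * E * norm y) + K8 * (\<tau>\<^sup>2 * S * norm y)"
  proof -
    have "(2 * K * K4 + 2 * K3 + K6 + 4 * K * K2) * (\<tau> * E * norm y) \<le> K8 * (\<tau> * E * norm y)"
      using K7 K6(1) \<tau> E by (intro mult_right_mono) (auto simp: K8_def)
    moreover have "K7 * K6 * (\<tau>\<^sup>2 * S * norm y) \<le> K8 * (\<tau>\<^sup>2 * S * norm y)"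
      using K K2 K3 K4 K6(1) S by (intro mult_right_mono) (auto simp: K8_def)
    ultimately show ?thesis by (simp add: algebra_simps)
  qed
  finally show ?thesis by (simp add: E_def S_def algebra_simps)
qed

section \<open>From grid rates to the rate in n\<close>

lemma step_rate_le:
  assumes t: "t > 0" and n: "n \<ge> 3" and i: "i > 0" "i \<le> real n"
  shows "t / n * rate n (t / n) i \<le> 2 * (1 + t) * (1 / i + ln n * (n powr (\<alpha> - 1) * i powr (- \<alpha>)))"
proof -
  define \<tau> where "\<tau> = t / n"
  have \<tau>: "\<tau> > 0" using t n by (simp add: \<tau>_def)
  have L: "ln (real n) \<ge> 1" by (rule one_le_ln[OF n])
  let ?w = "n powr (\<alpha> - 1) * i powr (- \<alpha>)"
  have "\<tau> * (i * \<tau>) powr (- \<alpha>) = \<tau> powr 1 * \<tau> powr (- \<alpha>) * i powr (- \<alpha>)"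
    using \<tau> i by (simp add: powr_mult)
  also have "\<tau> powr 1 * \<tau> powr (- \<alpha>) = \<tau> powr (1 - \<alpha>)" by (subst powr_add[symmetric]) simp
  also have "\<dots> = t powr (1 - \<alpha>) * n powr (\<alpha> - 1)"
    unfolding \<tau>_def using t n by (subst powr_divide) (auto simp: powr_diff)
  \<comment> \<open>Pushes the dependence on t into the factor 1 + t, uniformly in \<alpha>.\<close>
  also have "t powr (1 - \<alpha>) \<le> 1 + t"
  proof (cases "t \<le> 1")
    case True
    have "t powr (1 - \<alpha>) \<le> 1 powr (1 - \<alpha>)" using True t \<alpha> by (intro powr_mono2) auto
    thus ?thesis using t by simp
  next
    case False
    have "t powr (1 - \<alpha>) \<le> t powr 1" using False \<alpha> by (intro powr_mono) auto
    thus ?thesis using t by simp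
  qed
  finally have 1: "\<tau> * (i * \<tau>) powr (- \<alpha>) \<le> (1 + t) * ?w"
    by (simp add: mult_right_mono mult.assoc)
  \<comment> \<open>Because i \<le> n, the constant part of \<open>sing\<close> is dominated by the
    same weight as the singular part.\<close>
  have "n powr (- 1) = n powr (\<alpha> - 1) * n powr (- \<alpha>)" by (subst powr_add[symmetric]) simp
  also have "\<dots> \<le> ?w" using i \<alpha> by (intro mult_left_mono powr_mono2') auto
  finally have "1 / n \<le> ?w" using n by (simp add: powr_minus_divide)
  hence "\<tau> \<le> t * ?w" using mult_left_mono[of "1 / n" ?w t] t by (simp add: \<tau>_def)
  hence "\<tau> * sing \<alpha> (i * \<tau>) \<le> (1 + t) * ?w + t * ?w" using 1 by (simp add: sing_def distrib_left)
  also have "\<dots> \<le> 2 * (1 + t) * ?w" by (simp add: algebra_simps)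
  finally have "ln n * (\<tau> * sing \<alpha> (i * \<tau>)) \<le> ln n * (2 * (1 + t) * ?w)" using L by (intro mult_left_mono) auto
  moreover have "\<tau> * rate n \<tau> i = 1 / i + ln n * (\<tau> * sing \<alpha> (i * \<tau>))"
    using \<tau> i by (simp add: rate_def field_simps)
  moreover have "1 / i \<le> 2 * (1 + t) * (1 / i)" using i t by (simp add: field_simps)
  ultimately have "\<tau> * rate n \<tau> i \<le> 2 * (1 + t) * (1 / i) + ln n * (2 * (1 + t) * ?w)" by linarith
  also have "\<dots> = 2 * (1 + t) * (1 / i + ln n * ?w)" by (simp add: algebra_simps)
  finally show ?thesis by (simp only: \<tau>_def)
qed

text \<open>\<open>e\<close> bounds \<tau> times the rate up to a factor depending on t. Its sum is
  O(ln n) and its midpoint value O(ln n / n); the midpoint split multiplies them, with 24 = 2 * 4 *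
  3.\<close>

lemma sum_step_rate_le:
  fixes e :: "real \<Rightarrow> real"
  assumes n: "n \<ge> 3"
  defines "e \<equiv> \<lambda>i. 1 / i + ln n * (n powr (\<alpha> - 1) * i powr (- \<alpha>))"
  shows "(\<Sum>m<n. e (real (Suc m)) * e (real (n - m))) \<le> 24 / (1 - \<alpha>) * ((ln n)\<^sup>2 / n)"
    and "e n \<le> 2 * ((ln n)\<^sup>2 / n)"
proof -
  have L: "ln (real n) \<ge> 1" by (rule one_le_ln[OF n])
  have n0: "real n > 0" using n by simp
  have anti: "antimono_on {0<..} e"
    unfolding e_def using \<alpha> L
    by (intro monotone_onI add_mono divide_left_mono mult_left_mono powr_mono2') auto
  have nonneg: "0 \<le> e r" if "0 < r" for r
    unfolding e_def using that L by (intro add_nonneg_nonneg mult_nonneg_nonneg) auto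
  have nn: "n powr (\<alpha> - 1) * n powr (- \<alpha>) = 1 / n"
    using n0 by (subst powr_add[symmetric]) (simp add: powr_minus_divide)
  have "e (real (Suc n) / 2) \<le> e (n / 2)" using n0 by (intro monotone_onD[OF anti, of "n / 2"]) auto
  also have "e (n / 2) = 2 / n + ln n * (2 powr \<alpha> * (n powr (\<alpha> - 1) * n powr (- \<alpha>)))"
    unfolding e_def using n0 by (subst powr_divide) (auto simp: powr_minus_divide)
  also have "\<dots> = (2 + ln n * 2 powr \<alpha>) / n" unfolding nn by (simp add: add_divide_distrib)
  also have "\<dots> \<le> (4 * ln n) / n"
  proof (rule divide_right_mono)
    have "2 powr \<alpha> \<le> 2 powr 1" using \<alpha> by (intro powr_mono) auto
    hence "ln n * 2 powr \<alpha> \<le> ln n * 2" using L by (intro mult_left_mono) auto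
    thus "2 + ln n * 2 powr \<alpha> \<le> 4 * ln n" using L by linarith
  qed simp
  finally have half: "e (real (Suc n) / 2) \<le> 4 * ln n / n" .
  have "(\<Sum>j<n. e (real (Suc j))) = (\<Sum>j<n. 1 / real (Suc j)) + ln n * (n powr (\<alpha> - 1) * (\<Sum>j<n. real (Suc j) powr (- \<alpha>)))"
    unfolding e_def by (simp add: sum.distrib sum_distrib_left del: of_nat_Suc)
  also have "\<dots> \<le> (1 + ln n) + ln n * (n powr (\<alpha> - 1) * (n powr (1 - \<alpha>) / (1 - \<alpha>)))"
    using L by (intro add_mono sum_inverse_le mult_left_mono sum_powr_le \<alpha>) auto
  also have "n powr (\<alpha> - 1) * (n powr (1 - \<alpha>) / (1 - \<alpha>)) = 1 / (1 - \<alpha>)"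
    using n0 by (simp flip: powr_add)
  also have "1 + ln n + ln n * (1 / (1 - \<alpha>)) \<le> 3 * ln n / (1 - \<alpha>)"
  proof -
    have "ln n * 1 \<le> ln n * (1 / (1 - \<alpha>))" using L \<alpha> by (intro mult_left_mono) auto
    thus ?thesis using L by simp
  qed
  finally have sum: "(\<Sum>j<n. e (real (Suc j))) \<le> 3 * ln n / (1 - \<alpha>)" .
  have "(\<Sum>m<n. e (real (Suc m)) * e (real (n - m))) \<le> 2 * (e (real (Suc n) / 2) * (\<Sum>j<n. e (real (Suc j))))"
    using sum_convolution_bound[OF anti anti nonneg nonneg, of n] by (simp add: mult_ac)
  also have "\<dots> \<le> 2 * ((4 * ln n / n) * (3 * ln n / (1 - \<alpha>)))"
    using half sum L nonneg by (intro mult_left_mono mult_mono sum_nonneg) auto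
  also have "\<dots> = 24 / (1 - \<alpha>) * ((ln n)\<^sup>2 / n)" by (simp add: power2_eq_square)
  finally show "(\<Sum>m<n. e (real (Suc m)) * e (real (n - m))) \<le> 24 / (1 - \<alpha>) * ((ln n)\<^sup>2 / n)" .
  have "e n = (1 + ln n) / n" unfolding e_def nn by (simp add: add_divide_distrib)
  also have "\<dots> \<le> (2 * (ln n)\<^sup>2) / n"
  proof (rule divide_right_mono)
    have "ln n * 1 \<le> ln n * ln n" using L by (intro mult_left_mono) auto
    thus "1 + ln n \<le> 2 * (ln n)\<^sup>2" using L unfolding power2_eq_square by linarith
  qed simp
  finally show "e n \<le> 2 * ((ln n)\<^sup>2 / n)" by simp
qed

text \<open>Each summand carries two rates, one on either side of the local error, whence the square
  of 1 + t; 96 = 4 * 24.\<close>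

theorem product_formula_error:
  "\<exists>C\<ge>0. \<forall>t\<ge>0. \<forall>n\<ge>3. norm (blinfun_pow n (P (t / real n) o\<^sub>L Q (t / real n)) - T t)
     \<le> C * (1 + t)\<^sup>2 * ((ln (real n))\<^sup>2 / real n)"
proof -
  define C where "C = K8 * (4 + 96 / (1 - \<alpha>))"
  have C: "C \<ge> 0" using K8 \<alpha> by (simp add: C_def)
  have "norm (blinfun_pow n (P (t / real n) o\<^sub>L Q (t / real n)) - T t) \<le> C * (1 + t)\<^sup>2 * ((ln (real n))\<^sup>2 / real n)"
    if t: "t > 0" and n: "n \<ge> 3" for t n
  proof -
    define \<tau> where "\<tau> = t / real n"
    have \<tau>: "\<tau> > 0" and n\<tau>: "real n * \<tau> = t" using t n by (auto simp: \<tau>_def)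
    define e where "e i = 1 / i + ln n * (n powr (\<alpha> - 1) * i powr (- \<alpha>))" for i
    define R where "R = (ln (real n))\<^sup>2 / real n"
    have R: "R \<ge> 0" by (simp add: R_def)
    have step: "\<tau> * rate n \<tau> i \<le> 2 * (1 + t) * e i" if "i > 0" "i \<le> real n" for i
      unfolding \<tau>_def e_def by (rule step_rate_le[OF t n that])
    have sums: "(\<Sum>m<n. e (real (Suc m)) * e (real (n - m))) \<le> 24 / (1 - \<alpha>) * R" "e n \<le> 2 * R"
      unfolding e_def R_def by (rule sum_step_rate_le[OF n])+
    have t1: "1 + t \<le> (1 + t)\<^sup>2" using t by (simp add: power2_eq_square algebra_simps)
    have "\<tau> * rate n \<tau> (real n) \<le> 2 * (1 + t) * e n" using n by (intro step) auto
    also have "\<dots> \<le> 2 * (1 + t) * (2 * R)" using sums t by (intro mult_left_mono) auto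
    also have "\<dots> = 4 * ((1 + t) * R)" by simp
    also have "\<dots> \<le> 4 * ((1 + t)\<^sup>2 * R)" by (intro mult_left_mono mult_right_mono t1 R) simp
    finally have 1: "\<tau> * rate n \<tau> (real n) \<le> 4 * ((1 + t)\<^sup>2 * R)" .
    have "\<tau>\<^sup>2 * (\<Sum>m<n. rate n \<tau> (real (Suc m)) * rate n \<tau> (real (n - m))) =
        (\<Sum>m<n. (\<tau> * rate n \<tau> (real (Suc m))) * (\<tau> * rate n \<tau> (real (n - m))))"
      by (simp add: sum_distrib_left power2_eq_square mult_ac)
    also have "\<dots> \<le> (\<Sum>m<n. (2 * (1 + t) * e (real (Suc m))) * (2 * (1 + t) * e (real (n - m))))"
    proof (rule sum_mono)
      fix m assume m: "m \<in> {..<n}"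
      have s: "\<tau> * rate n \<tau> (real (Suc m)) \<le> 2 * (1 + t) * e (real (Suc m))"
        "\<tau> * rate n \<tau> (real (n - m)) \<le> 2 * (1 + t) * e (real (n - m))"
        using m by (intro step; simp)+
      have nn: "0 \<le> \<tau> * rate n \<tau> (real (Suc m))" "0 \<le> \<tau> * rate n \<tau> (real (n - m))"
        using \<tau> m rate_ge(5)[OF n \<tau>] by auto
      show "(\<tau> * rate n \<tau> (real (Suc m))) * (\<tau> * rate n \<tau> (real (n - m)))
        \<le> (2 * (1 + t) * e (real (Suc m))) * (2 * (1 + t) * e (real (n - m)))"
        by (rule mult_mono[OF s order_trans[OF nn(1) s(1)] nn(2)])
    qed
    also have "\<dots> = 4 * (1 + t)\<^sup>2 * (\<Sum>m<n. e (real (Suc m)) * e (real (n - m)))"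
    proof -
      have "(2 * (1 + t) * a) * (2 * (1 + t) * b) = 4 * (1 + t)\<^sup>2 * (a * b)" for a b
        by (simp add: power2_eq_square algebra_simps)
      thus ?thesis by (simp only: sum_distrib_left)
    qed
    also have "\<dots> \<le> 4 * (1 + t)\<^sup>2 * (24 / (1 - \<alpha>) * R)" using sums by (intro mult_left_mono) auto
    finally have 2: "\<tau>\<^sup>2 * (\<Sum>m<n. rate n \<tau> (real (Suc m)) * rate n \<tau> (real (n - m))) \<le>
        96 / (1 - \<alpha>) * ((1 + t)\<^sup>2 * R)" by simp
    have bound: "K8 * (\<tau> * rate n \<tau> (real n) + \<tau>\<^sup>2 * (\<Sum>m<n. rate n \<tau> (real (Suc m)) * rate n \<tau> (real (n - m))))
        \<le> C * (1 + t)\<^sup>2 * R"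
    proof -
      have "K8 * (\<tau> * rate n \<tau> (real n) + \<tau>\<^sup>2 * (\<Sum>m<n. rate n \<tau> (real (Suc m)) * rate n \<tau> (real (n - m))))
        \<le> K8 * (4 * ((1 + t)\<^sup>2 * R) + 96 / (1 - \<alpha>) * ((1 + t)\<^sup>2 * R))"
        using 1 2 K8 by (intro mult_left_mono add_mono) auto
      also have "\<dots> = C * (1 + t)\<^sup>2 * R" unfolding C_def distrib_right[symmetric] by simp
      finally show ?thesis .
    qed
    show ?thesis
    proof (rule norm_blinfun_bound)
      show "0 \<le> C * (1 + t)\<^sup>2 * ((ln (real n))\<^sup>2 / real n)" using C by simp
      fix x
      show "norm ((blinfun_pow n (P (t / real n) o\<^sub>L Q (t / real n)) - T t) x) \<le>
          C * (1 + t)\<^sup>2 * ((ln (real n))\<^sup>2 / real n) * norm x"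
      proof (rule dense_bound_extends[OF dense_D])
        fix y assume y: "y \<in> D"
        have "norm ((blinfun_pow n (P \<tau> o\<^sub>L Q \<tau>) - T (real n * \<tau>)) y) \<le>
          K8 * (\<tau> * rate n \<tau> (real n) + \<tau>\<^sup>2 * (\<Sum>m<n. rate n \<tau> (real (Suc m)) * rate n \<tau> (real (n - m)))) * norm y"
          using product_error_on_domain[OF \<tau> n y] by (simp add: blinfun.diff_left)
        also have "\<dots> \<le> C * (1 + t)\<^sup>2 * R * norm y" by (intro mult_right_mono bound) auto
        finally show "norm ((blinfun_pow n (P (t / real n) o\<^sub>L Q (t / real n)) - T t) y) \<le>
          C * (1 + t)\<^sup>2 * ((ln (real n))\<^sup>2 / real n) * norm y"
          unfolding n\<tau> by (simp add: \<tau>_def R_def)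
      qed
    qed
  qed
  \<comment> \<open>The estimates above divide by \<tau>; at t = 0 both operators are the
    identity.\<close>
  moreover have "norm (blinfun_pow n (P (0 / real n) o\<^sub>L Q (0 / real n)) - T 0) \<le> C * (1 + 0)\<^sup>2 * ((ln (real n))\<^sup>2 / real n)" for n
  proof -
    have "blinfun_pow n (P 0 o\<^sub>L Q 0) x = x" for x
      by (induction n) (simp_all add: P.zero Q.zero)
    hence "blinfun_pow n (P 0 o\<^sub>L Q 0) = T 0" by (intro blinfun_eqI) (simp add: T.zero)
    thus ?thesis using C by simp
  qed
  ultimately have "norm (blinfun_pow n (P (t / real n) o\<^sub>L Q (t / real n)) - T t) \<le> C * (1 + t)\<^sup>2 * ((ln (real n))\<^sup>2 / real n)"
    if "t \<ge> 0" "n \<ge> 3" for t n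
    using that by (cases "t = 0") auto
  thus ?thesis using C by blast
qed

end

section \<open>Supplying the quantitative inputs and reading off the constants\<close>

theorem theorem2p7:
  fixes UA :: "complex \<Rightarrow> ('a::complex_banach \<Rightarrow>\<^sub>L 'a)"
    and UB T :: "real \<Rightarrow> ('a \<Rightarrow>\<^sub>L 'a)"
    and A B :: "('a \<times> 'a) set"
    and \<theta> \<alpha> :: real
  assumes theta: "0 < \<theta>" "\<theta> \<le> pi / 2"
    and UA: "holomorphic_contraction_semigroup \<theta> UA"
    and A: "A = generator (\<lambda>t. UA (complex_of_real t))"
    and UB: "contraction_semigroup UB"
    and B: "B = generator UB"
    and alpha: "0 \<le> \<alpha>" "\<alpha> < 1"
    and dom_frac:
      "Domain (adjoint_operator (fractional_power (\<lambda>t. UA (complex_of_real t)) \<alpha>))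
         \<subseteq> Domain (adjoint_operator B)"
    and dom: "Domain A \<subseteq> Domain B"
    and dom_adj: "Domain (adjoint_operator A) \<subseteq> Domain (adjoint_operator B)"
    and T: "C0_semigroup T" "generator T = operator_sum A B"
  shows "\<exists>M3 M4 M4' \<eta> :: real. M3 > 0 \<and> M4 > 0 \<and> M4' > 0 \<and> \<eta> > 0 \<and>
    (\<alpha> > 0 \<longrightarrow> (\<forall>t\<ge>0. \<forall>n::nat. n > 2 \<longrightarrow>
      norm (blinfun_pow n (UA (complex_of_real (t / n)) o\<^sub>L UB (t / n)) - T t)
        \<le> exp (\<eta> * t) * (M3 + M4 * t powr (1 - \<alpha>)) * (ln n / n powr (1 - \<alpha>)))) \<and>
    (\<alpha> = 0 \<longrightarrow> (\<forall>t\<ge>0. \<forall>n::nat. n > 2 \<longrightarrow>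
      norm (blinfun_pow n (UA (complex_of_real (t / n)) o\<^sub>L UB (t / n)) - T t)
        \<le> exp (\<eta> * t) * (M3 + M4' * t) * (2 * (ln n)\<^sup>2 / n)))"
proof -
  define P where "P = (\<lambda>t. UA (complex_of_real t))"
  have P: "contraction_semigroup P"
    using UA by (simp add: holomorphic_contraction_semigroup_def P_def)
  interpret P: contractions P by standard (rule P)
  obtain Ks where Ks: "Ks \<ge> 0"
    and smooth: "\<And>s x. s > 0 \<Longrightarrow> \<exists>y. (P s x, y) \<in> generator P \<and> norm y \<le> Ks / s * norm x"
    using holomorphic_semigroup_smoothing[OF theta UA] unfolding P_def by blast
  have gen: "generator T = operator_sum (generator P) (generator UB)"
    using T(2) by (simp add: A B P_def)
  have dom': "Domain (generator P) \<subseteq> Domain (generator UB)" using dom by (simp add: A B P_def)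
  have domT: "Domain (generator T) = Domain (generator P)"
  proof
    show "Domain (generator P) \<subseteq> Domain (generator T)"
    proof
      fix x assume "x \<in> Domain (generator P)"
      then obtain y z where "(x, y) \<in> generator P" "(x, z) \<in> generator UB" using dom' by blast
      hence "(x, y + z) \<in> generator T" unfolding gen operator_sum_def by blast
      thus "x \<in> Domain (generator T)" by blast
    qed
  qed (auto simp: gen operator_sum_def)
  have Tc: "contraction_semigroup T"
  proof (rule contraction_semigroup_of_generator_sum[OF P UB T(1) gen])
    show "closure (Domain (generator T)) = UNIV"
      unfolding domT using smooth by (intro P.closure_eq_UNIV) blast
  qed
  obtain Kp where Kp: "Kp \<ge> 0" "\<And>s x y. s > 0 \<Longrightarrow> (x, y) \<in> generator UB \<Longrightarrow>
      norm (P s y) \<le> Kp * (s powr (- \<alpha>) + 1) * norm x"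
    using smoothing_after_generator[OF P alpha Ks smooth, of UB] dom_frac unfolding P_def B by blast
  obtain Kb where Kb: "Kb \<ge> 0" "\<And>x y z. (x, y) \<in> generator P \<Longrightarrow> (x, z) \<in> generator UB \<Longrightarrow>
      norm z \<le> Kb * (norm x + norm y)"
    using generator_relatively_bounded[OF P UB dom'] by blast
  \<comment> \<open>The generators of \<open>T\<close> and \<open>P\<close> have the same domain, so
    A is bounded relative to A + B; the lemma applies because \<open>T\<close> is now known to be
    contractive.\<close>
  obtain Ka where Ka: "Ka \<ge> 0" "\<And>x y z. (x, z) \<in> generator T \<Longrightarrow> (x, y) \<in> generator P \<Longrightarrow>
      norm y \<le> Ka * (norm x + norm z)"
    using generator_relatively_bounded[OF Tc P] domT by blast
  define K where "K = 1 + Ks + Kp + Kb + Ka"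
  have K: "K \<ge> 1" "Ks \<le> K" "Kp \<le> K" "Kb \<le> K" "Ka \<le> K" using Ks Kp(1) Kb(1) Ka(1) by (auto simp: K_def)
  interpret product_formula P UB T \<alpha> K
  proof
    fix s :: real and x :: 'a assume s: "s > 0"
    have "Ks / s * norm x \<le> K / s * norm x" using K s by (intro mult_right_mono divide_right_mono) auto
    thus "\<exists>y. (P s x, y) \<in> generator P \<and> norm y \<le> K / s * norm x" using smooth[OF s, of x] by force
  next
    fix s :: real and x y assume "s > 0" "(x, y) \<in> generator UB"
    from Kp(2)[OF this] have "norm (P s y) \<le> Kp * sing \<alpha> s * norm x" by (simp add: sing_def)
    also have "\<dots> \<le> K * sing \<alpha> s * norm x"
      using K sing_pos[of \<alpha> s] by (intro mult_right_mono) auto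
    finally show "norm (P s y) \<le> K * sing \<alpha> s * norm x" .
  next
    fix x y z assume "(x, y) \<in> generator P" "(x, z) \<in> generator UB"
    from Kb(2)[OF this] show "norm z \<le> K * (norm x + norm y)"
      using mult_right_mono[OF K(4), of "norm x + norm y"] by simp
  next
    fix x y z assume "(x, z) \<in> generator T" "(x, y) \<in> generator P"
    from Ka(2)[OF this] show "norm y \<le> K * (norm x + norm z)"
      using mult_right_mono[OF K(5), of "norm x + norm z"] by simp
  qed (use P UB Tc gen dom' alpha K in auto)
  obtain C where C: "C \<ge> 0" and error: "\<And>t n. t \<ge> 0 \<Longrightarrow> n \<ge> 3 \<Longrightarrow>
      norm (blinfun_pow n (P (t / real n) o\<^sub>L UB (t / real n)) - T t) \<le> C * (1 + t)\<^sup>2 * ((ln (real n))\<^sup>2 / real n)"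
    using product_formula_error by blast
  \<comment> \<open>Quadratic growth in t goes into the exponential, which fixes \<eta> = 2.\<close>
  have poly: "(1 + t)\<^sup>2 \<le> exp (2 * t)" if "t \<ge> 0" for t :: real
  proof -
    have "(1 + t)\<^sup>2 \<le> (exp t)\<^sup>2" using that by (intro power_mono exp_ge_add_one_self) auto
    thus ?thesis by (simp add: exp_double)
  qed
  \<comment> \<open>\<open>C / \<alpha>\<close> pays for trading one ln n for n powr \<alpha> /
    \<alpha>. At \<alpha> = 0 this quotient is 0, and the summand 1 keeps \<open>M\<close> positive
    in every case.\<close>
  define M where "M = C + C / \<alpha> + 1"
  have M: "M > 0" "C \<le> M" "C / \<alpha> \<le> M" using C alpha by (auto simp: M_def intro: add_nonneg_pos)
  have error': "norm (blinfun_pow n (UA (complex_of_real (t / n)) o\<^sub>L UB (t / n)) - T t)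
      \<le> exp (2 * t) * (C * ((ln (real n))\<^sup>2 / real n))" if t: "t \<ge> 0" and n: "n > 2" for t and n :: nat
  proof -
    have "C * ((ln (real n))\<^sup>2 / real n) \<ge> 0" using C by simp
    from mult_right_mono[OF poly[OF t] this] error[of t n] t n show ?thesis by (simp add: P_def mult_ac)
  qed
  have pos_case: "norm (blinfun_pow n (UA (complex_of_real (t / n)) o\<^sub>L UB (t / n)) - T t)
      \<le> exp (2 * t) * (M + 1 * t powr (1 - \<alpha>)) * (ln n / n powr (1 - \<alpha>))"
    if \<alpha>0: "\<alpha> > 0" and t: "t \<ge> 0" and n: "n > 2" for t and n :: nat
  proof -
    have L: "ln (real n) \<ge> 0" using n by simp
    have "ln (real n) \<le> n powr \<alpha> / \<alpha>" using n \<alpha>0 by (intro ln_powr_bound) auto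
    hence "ln (real n) * ln (real n) \<le> ln (real n) * (n powr \<alpha> / \<alpha>)" using L by (intro mult_left_mono)
    hence "(ln (real n))\<^sup>2 / real n \<le> ln (real n) * (n powr \<alpha> / \<alpha>) / real n"
      unfolding power2_eq_square by (intro divide_right_mono) auto
    also have "\<dots> = 1 / \<alpha> * (ln n / n powr (1 - \<alpha>))" using n by (simp add: powr_diff)
    finally have "C * ((ln (real n))\<^sup>2 / real n) \<le> C / \<alpha> * (ln n / n powr (1 - \<alpha>))"
      using mult_left_mono[OF _ C] by fastforce
    also have "\<dots> \<le> (M + 1 * t powr (1 - \<alpha>)) * (ln n / n powr (1 - \<alpha>))"
      using M(3) L by (intro mult_right_mono) (auto intro: order_trans[OF M(3)])
    finally have "exp (2 * t) * (C * ((ln (real n))\<^sup>2 / real n)) \<le>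
        exp (2 * t) * ((M + 1 * t powr (1 - \<alpha>)) * (ln n / n powr (1 - \<alpha>)))" by (intro mult_left_mono) auto
    with error'[OF t n] show ?thesis by (simp only: mult.assoc)
  qed
  have zero_case: "norm (blinfun_pow n (UA (complex_of_real (t / n)) o\<^sub>L UB (t / n)) - T t)
      \<le> exp (2 * t) * (M + 1 * t) * (2 * (ln n)\<^sup>2 / n)"
    if t: "t \<ge> 0" and n: "n > 2" for t and n :: nat
  proof -
    have "C * ((ln (real n))\<^sup>2 / real n) \<le> (M + 1 * t) * (2 * (ln n)\<^sup>2 / n)"
      using M t C by (intro mult_mono divide_right_mono) auto
    hence "exp (2 * t) * (C * ((ln (real n))\<^sup>2 / real n)) \<le>
        exp (2 * t) * ((M + 1 * t) * (2 * (ln n)\<^sup>2 / n))" by (intro mult_left_mono) auto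
    with error'[OF t n] show ?thesis by (simp only: mult.assoc)
  qed
  show ?thesis
    \<comment> \<open>With the growth in t already inside the exponential, 1 serves for both
      \<open>M4\<close> and \<open>M4'\<close>.\<close>
    by (rule exI[of _ M], rule exI[of _ 1], rule exI[of _ 1], rule exI[of _ 2])
       (use M(1) pos_case zero_case in auto)
qed

end
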